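(* Let $\mathfrak{A}$ be a weak-$*$-closed unital subalgebra of $H^\infty$. Let $E=\{\lambda_1,\dots,\lambda_n\}$ be a finite subset of $\mathbb{D}$ which is separated by $\mathfrak{A}$, and let $w_1,\dots,w_n\in\mathbb{C}$. Then there is a multiplier $f$ in the (closed) unit ball of $\mathfrak{A}$ with $f(\lambda_i)=w_i$ for $1\le i\le n$ if and only if \[ \Big[(1-w_i\overline{w_j})\,\langle P_Lk_{\lambda_j},k_{\lambda_i}\rangle\Big]_{i,j=1}^n\ \geq\ 0 \] for all cyclic subspaces $L=\mathfrak{A}[h]$ where $h\in H^2$ is outer.
   Context: $\mathbb{D}$ is the open unit disk, $H^2$ the Hardy space on $\mathbb{D}$, and $H^\infty$ the algebra of bounded analytic functions on $\mathbb{D}$ with the supremum norm, identified with the multiplier algebra of $H^2$ (acting by multiplication operators $M_f$ on $H^2$; the weak-$*$ topology is that inherited from $\mathcal{B}(H^2)$). $k_\lambda(z)=(1-\overline{\lambda}z)^{-1}$ is the Szegő kernel, the reproducing kernel of $H^2$. $\mathfrak{A}$ separates $E$ if for distinct $\lambda,\mu\in E$ some $f\in\mathfrak{A}$ has $f(\lambda)\neq f(\mu)$. $\mathfrak{A}[h]=\overline{\{fh:f\in\mathfrak{A}\}}$ (closure in $H^2$), $P_L$ is the orthogonal projection of $H^2$ onto $L$, and $\ge0$ means positive semidefinite. *)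

theory Defs
  imports "HOL-Complex_Analysis.Complex_Analysis"
begin

section \<open>Taylor coefficients at 0\<close>

definition taylor :: "(complex \<Rightarrow> complex) \<Rightarrow> nat \<Rightarrow> complex" where
  "taylor f n = (deriv ^^ n) f 0 / fact n"

lemma taylor_sums:
  assumes "f holomorphic_on ball 0 1" "z \<in> ball 0 1"
  shows "(\<lambda>n. taylor f n * z ^ n) sums f z"
  using holomorphic_power_series[OF assms] by (simp add: taylor_def)

lemma taylor_add:
  assumes "f holomorphic_on ball 0 1" "g holomorphic_on ball 0 1"
  shows "taylor (\<lambda>z. f z + g z) n = taylor f n + taylor g n"
  using higher_deriv_add[OF assms, of 0 n] by (simp add: taylor_def add_divide_distrib)

lemma taylor_cmult:
  assumes "f holomorphic_on ball 0 1"
  shows "taylor (\<lambda>z. c * f z) n = c * taylor f n"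
  using higher_deriv_cmult[OF assms, of 0 n c] by (simp add: taylor_def)

lemma taylor_zero [simp]: "taylor (\<lambda>z. 0) n = 0"
  using taylor_cmult[of "\<lambda>z. 0" 0 n] by simp

lemma taylor_unique:
  assumes "\<And>z. z \<in> ball 0 1 \<Longrightarrow> (\<lambda>n. a n * z ^ n) sums f z"
  shows "f holomorphic_on ball 0 1" "taylor f n = a n"
proof -
  show "f holomorphic_on ball 0 1"
    by (rule power_series_holomorphic[of 0 1 a]) (use assms in simp)
  have "eventually (\<lambda>z::complex. z \<in> ball 0 1) (nhds 0)"
    by (rule eventually_nhds_in_open) auto
  then have "eventually (\<lambda>z. (\<lambda>n. fps_nth (Abs_fps a) n * z ^ n) sums f z) (nhds 0)"
    by (rule eventually_mono) (use assms in simp)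
  then have "f has_fps_expansion Abs_fps a"
    by (rule has_fps_expansionI)
  from fps_nth_fps_expansion[OF this, of n] show "taylor f n = a n"
    by (simp add: taylor_def)
qed

section \<open>The Hardy space $H^2$\<close>

text \<open>
  $H^2$ consists of the holomorphic functions on the disk with square-summable Taylor
  coefficients. Setting the functions to 0 off the disk makes equality in the type the same as
  equality on the disk.
\<close>

definition in_hardy2 :: "(complex \<Rightarrow> complex) \<Rightarrow> bool" where
  "in_hardy2 f \<longleftrightarrow> f holomorphic_on ball 0 1 \<and> (\<forall>z. z \<notin> ball 0 1 \<longrightarrow> f z = 0) \<and>
     summable (\<lambda>n. (cmod (taylor f n))\<^sup>2)"

lemma in_hardy2_zero: "in_hardy2 (\<lambda>z. 0)"
  by (simp add: in_hardy2_def)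

lemma in_hardy2_add:
  assumes "in_hardy2 f" "in_hardy2 g"
  shows "in_hardy2 (\<lambda>z. f z + g z)"
proof -
  have hol: "f holomorphic_on ball 0 1" "g holomorphic_on ball 0 1"
    using assms by (auto simp: in_hardy2_def)
  have "summable (\<lambda>n. 2 * (cmod (taylor f n))\<^sup>2 + 2 * (cmod (taylor g n))\<^sup>2)"
    using assms by (intro summable_add summable_mult) (auto simp: in_hardy2_def)
  moreover have "norm ((cmod (taylor f n + taylor g n))\<^sup>2)
      \<le> 2 * (cmod (taylor f n))\<^sup>2 + 2 * (cmod (taylor g n))\<^sup>2" for n
  proof -
    have "(cmod (taylor f n + taylor g n))\<^sup>2 \<le> (cmod (taylor f n) + cmod (taylor g n))\<^sup>2"
      by (intro power_mono norm_triangle_ineq norm_ge_zero)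
    also have "\<dots> \<le> 2 * (cmod (taylor f n))\<^sup>2 + 2 * (cmod (taylor g n))\<^sup>2"
      using zero_le_power2[of "cmod (taylor f n) - cmod (taylor g n)"]
      by (simp add: power2_sum power2_diff)
    finally show ?thesis by simp
  qed
  ultimately have "summable (\<lambda>n. (cmod (taylor f n + taylor g n))\<^sup>2)"
    by (rule summable_comparison_test'[where N = 0])
  then show ?thesis
    using assms hol by (auto simp: in_hardy2_def taylor_add intro: holomorphic_on_add)
qed

lemma in_hardy2_cmult:
  assumes "in_hardy2 f"
  shows "in_hardy2 (\<lambda>z. c * f z)"
  using assms
  by (auto simp: in_hardy2_def taylor_cmult norm_mult power_mult_distrib
      intro!: holomorphic_intros summable_mult)

typedef hardy2 = "{f. in_hardy2 f}"
  morphisms hfun Abs_hardy2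
  using in_hardy2_zero by blast

setup_lifting type_definition_hardy2

lemma in_hardy2_hfun [simp]: "in_hardy2 (hfun f)"
  using hfun by simp

lemma hfun_holomorphic: "hfun f holomorphic_on ball 0 1"
  using in_hardy2_hfun unfolding in_hardy2_def by blast

lemma hardy2_eqI:
  assumes "\<And>z. z \<in> ball 0 1 \<Longrightarrow> hfun f z = hfun g z"
  shows "f = g"
proof -
  have "hfun f z = hfun g z" for z
    using assms in_hardy2_hfun[of f] in_hardy2_hfun[of g] unfolding in_hardy2_def
    by (cases "z \<in> ball 0 1") auto
  then show ?thesis by (simp add: hfun_inject[symmetric] fun_eq_iff)
qed

lift_definition scaleC :: "complex \<Rightarrow> hardy2 \<Rightarrow> hardy2" is "\<lambda>c f z. c * f z"
  by (rule in_hardy2_cmult)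

abbreviation hcoeff :: "hardy2 \<Rightarrow> nat \<Rightarrow> complex" where
  "hcoeff f \<equiv> taylor (hfun f)"

lemma hardy2_eq_zeroI:
  assumes "\<And>n. hcoeff f n = 0" "z \<in> ball 0 1"
  shows "hfun f z = 0"
  using taylor_sums[OF hfun_holomorphic assms(2), of f] assms(1) by (simp add: sums_iff)

definition hinner :: "hardy2 \<Rightarrow> hardy2 \<Rightarrow> complex" where
  "hinner f g = (\<Sum>n. hcoeff f n * cnj (hcoeff g n))"

lemma summable_hcoeff: "summable (\<lambda>n. (cmod (hcoeff f n))\<^sup>2)"
  using in_hardy2_hfun[of f] by (simp add: in_hardy2_def)

lemma summable_hinner: "summable (\<lambda>n. hcoeff f n * cnj (hcoeff g n))"
proof (rule summable_comparison_test'[where N = 0])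
  show "summable (\<lambda>n. (cmod (hcoeff f n))\<^sup>2 + (cmod (hcoeff g n))\<^sup>2)"
    by (intro summable_add summable_hcoeff)
  show "norm (hcoeff f n * cnj (hcoeff g n)) \<le> (cmod (hcoeff f n))\<^sup>2 + (cmod (hcoeff g n))\<^sup>2" for n
    using zero_le_power2[of "cmod (hcoeff f n) - cmod (hcoeff g n)"]
      mult_nonneg_nonneg[of "cmod (hcoeff f n)" "cmod (hcoeff g n)"]
    by (simp add: norm_mult power2_diff del: mult_nonneg_nonneg)
qed

lemma hinner_commute: "hinner f g = cnj (hinner g f)"
proof -
  have "(\<lambda>n. cnj (hcoeff g n * cnj (hcoeff f n))) sums cnj (hinner g f)"
    unfolding hinner_def sums_cnj by (rule summable_sums[OF summable_hinner])
  then show ?thesis by (simp add: hinner_def sums_iff mult.commute)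
qed

lemma hinner_self: "hinner f f = of_real (\<Sum>n. (cmod (hcoeff f n))\<^sup>2)"
  unfolding hinner_def complex_norm_square[symmetric]
  using suminf_of_real[OF summable_hcoeff, of f, where 'a = complex] by simp

lemma hcoeff_scaleC: "hcoeff (scaleC c f) n = c * hcoeff f n"
  by (simp add: scaleC.rep_eq taylor_cmult hfun_holomorphic)

lemma hinner_scaleC_left: "hinner (scaleC c f) g = c * hinner f g"
  using suminf_mult[OF summable_hinner, of c f g] by (simp add: hinner_def hcoeff_scaleC mult.assoc)

instantiation hardy2 :: real_inner
begin

lift_definition zero_hardy2 :: hardy2 is "\<lambda>z. 0"
  by (rule in_hardy2_zero)

lift_definition plus_hardy2 :: "hardy2 \<Rightarrow> hardy2 \<Rightarrow> hardy2" is "\<lambda>f g z. f z + g z"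
  by (rule in_hardy2_add)

definition uminus_hardy2 :: "hardy2 \<Rightarrow> hardy2" where
  "uminus_hardy2 f = scaleC (-1) f"

definition minus_hardy2 :: "hardy2 \<Rightarrow> hardy2 \<Rightarrow> hardy2" where
  "minus_hardy2 f g = f + - g"

definition scaleR_hardy2 :: "real \<Rightarrow> hardy2 \<Rightarrow> hardy2" where
  "scaleR_hardy2 r f = scaleC (of_real r) f"

definition inner_hardy2 :: "hardy2 \<Rightarrow> hardy2 \<Rightarrow> real" where
  "inner_hardy2 f g = Re (hinner f g)"

definition norm_hardy2 :: "hardy2 \<Rightarrow> real" where
  "norm_hardy2 f = sqrt (inner f f)"

definition sgn_hardy2 :: "hardy2 \<Rightarrow> hardy2" where
  "sgn_hardy2 f = inverse (norm f) *\<^sub>R f"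

definition dist_hardy2 :: "hardy2 \<Rightarrow> hardy2 \<Rightarrow> real" where
  "dist_hardy2 f g = norm (f - g)"

definition uniformity_hardy2 :: "(hardy2 \<times> hardy2) filter" where
  "uniformity_hardy2 = (INF e\<in>{0<..}. principal {(x, y). dist x y < e})"

definition open_hardy2 :: "hardy2 set \<Rightarrow> bool" where
  "open_hardy2 U \<longleftrightarrow> (\<forall>x\<in>U. eventually (\<lambda>(x', y). x' = x \<longrightarrow> y \<in> U) uniformity)"

instance
proof
  fix f g k :: hardy2 and r s :: real
  note ext_simps = zero_hardy2.rep_eq plus_hardy2.rep_eq scaleC.rep_eq uminus_hardy2_def
    minus_hardy2_def scaleR_hardy2_def
  show "f + g + k = f + (g + k)" by (rule hardy2_eqI) (simp add: ext_simps)
  show "f + g = g + f" by (rule hardy2_eqI) (simp add: ext_simps)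
  show "0 + f = f" by (rule hardy2_eqI) (simp add: ext_simps)
  show "- f + f = 0" by (rule hardy2_eqI) (simp add: ext_simps)
  show "f - g = f + - g" by (simp add: minus_hardy2_def)
  show "r *\<^sub>R (f + g) = r *\<^sub>R f + r *\<^sub>R g"
    by (rule hardy2_eqI) (simp add: ext_simps algebra_simps)
  show "(r + s) *\<^sub>R f = r *\<^sub>R f + s *\<^sub>R f"
    by (rule hardy2_eqI) (simp add: ext_simps algebra_simps)
  show "r *\<^sub>R s *\<^sub>R f = (r * s) *\<^sub>R f" by (rule hardy2_eqI) (simp add: ext_simps)
  show "1 *\<^sub>R f = f" by (rule hardy2_eqI) (simp add: ext_simps)
  show "sgn f = inverse (norm f) *\<^sub>R f" by (rule sgn_hardy2_def)
  show "dist f g = norm (f - g)" by (rule dist_hardy2_def)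
  show "uniformity = (INF e\<in>{0<..}. principal {(x::hardy2, y). dist x y < e})"
    by (rule uniformity_hardy2_def)
  show "open U \<longleftrightarrow> (\<forall>x\<in>U. eventually (\<lambda>(x', y). x' = x \<longrightarrow> y \<in> U) uniformity)"
    for U :: "hardy2 set" by (rule open_hardy2_def)
  show "inner f g = inner g f"
    unfolding inner_hardy2_def by (subst hinner_commute) simp
  have coeff_add: "hcoeff (f + g) n = hcoeff f n + hcoeff g n" for n
    by (simp add: plus_hardy2.rep_eq taylor_add hfun_holomorphic)
  show "inner (f + g) k = inner f k + inner g k"
    using suminf_add[OF summable_hinner summable_hinner, of f k g k]
    by (simp add: inner_hardy2_def hinner_def coeff_add distrib_right flip: plus_complex.sel)
  show "inner (r *\<^sub>R f) g = r * inner f g"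
    by (simp add: inner_hardy2_def scaleR_hardy2_def hinner_scaleC_left)
  show "0 \<le> inner f f"
    by (simp add: inner_hardy2_def hinner_self suminf_nonneg summable_hcoeff)
  show "inner f f = 0 \<longleftrightarrow> f = 0"
  proof
    assume "inner f f = 0"
    then have "hcoeff f n = 0" for n
      using suminf_eq_zero_iff[OF summable_hcoeff, of f] by (simp add: inner_hardy2_def hinner_self)
    then show "f = 0"
      by (intro hardy2_eqI) (simp add: hardy2_eq_zeroI zero_hardy2.rep_eq)
  next
    assume "f = 0"
    then show "inner f f = 0"
      by (simp add: inner_hardy2_def hinner_def zero_hardy2.rep_eq)
  qed
  show "norm f = sqrt (inner f f)" by (rule norm_hardy2_def)
qed

end

section \<open>The reproducing kernel and orthogonal projections\<close>

lemma szego_sums: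
  assumes "l \<in> ball 0 1" "z \<in> ball 0 (1::real)"
  shows "(\<lambda>n. cnj l ^ n * z ^ n) sums (1 / (1 - cnj l * (z :: complex)))"
proof -
  have "cmod (cnj l * z) < 1"
    using assms mult_strict_mono[of "cmod l" 1 "cmod z" 1] by (simp add: norm_mult)
  from geometric_sums[OF this] show ?thesis by (simp add: power_mult_distrib)
qed

text \<open>
  Off the disk the point \<open>l\<close> has no kernel; there \<open>szego l\<close> is 0.
\<close>

lift_definition szego :: "complex \<Rightarrow> hardy2" is
  "\<lambda>l z. if l \<in> ball 0 1 \<and> z \<in> ball 0 1 then 1 / (1 - cnj l * z) else 0"
proof -
  fix l :: complex
  let ?k = "\<lambda>z. if l \<in> ball 0 1 \<and> z \<in> ball 0 1 then 1 / (1 - cnj l * z) else 0"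
  show "in_hardy2 ?k"
  proof (cases "l \<in> ball 0 1")
    case True
    have sums: "(\<lambda>n. cnj l ^ n * z ^ n) sums ?k z" if "z \<in> ball 0 1" for z
      using szego_sums[OF True that] True that by simp
    have "(cmod l)\<^sup>2 < 1"
      using True by (simp add: abs_square_less_1)
    then have "summable (\<lambda>n. ((cmod l)\<^sup>2) ^ n)"
      by (intro summable_geometric) simp
    then have "summable (\<lambda>n. (cmod (cnj l ^ n))\<^sup>2)"
      by (simp add: norm_power mult.commute flip: power_mult)
    moreover have "taylor ?k n = cnj l ^ n" for n
      by (rule taylor_unique(2)[OF sums])
    moreover have "?k holomorphic_on ball 0 1"
      by (rule taylor_unique(1)[OF sums])
    ultimately show ?thesis
      unfolding in_hardy2_def by presburger
  next
    case False
    then show ?thesis by (simp only: in_hardy2_zero simp_thms if_False)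
  qed
qed

lemma hinner_szego:
  assumes "l \<in> ball 0 1"
  shows "hinner f (szego l) = hfun f l"
proof -
  have "hcoeff (szego l) n = cnj l ^ n" for n
    by (rule taylor_unique(2)) (use szego_sums[OF assms] assms in \<open>simp add: szego.rep_eq\<close>)
  then show ?thesis
    using taylor_sums[OF hfun_holomorphic assms, of f] by (simp add: hinner_def sums_iff)
qed

definition proj :: "hardy2 set \<Rightarrow> hardy2 \<Rightarrow> hardy2" where
  "proj L x = (THE p. p \<in> L \<and> (\<forall>y\<in>L. hinner (x - p) y = 0))"

section \<open>$H^\infty$ and its weak-$*$ topology\<close>

text \<open>
  Elements of $H^\infty$ are represented by functions on the plane of which only the restriction
  to the disk matters. The weak-$*$ topology below does not distinguish representatives that agree
  on the disk, so a weak-$*$-closed set contains all representatives of each of its elements.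
\<close>

definition Hinf :: "(complex \<Rightarrow> complex) set" where
  "Hinf = {f. f holomorphic_on ball 0 1 \<and> bounded (f ` ball 0 1)}"

definition Hinf_norm :: "(complex \<Rightarrow> complex) \<Rightarrow> real" where
  "Hinf_norm f = (SUP z\<in>ball 0 1. cmod (f z))"

text \<open>
  For \<open>f\<close> in $H^\infty$ and \<open>g\<close> in $H^2$ the product is in $H^2$, so \<open>THE\<close> denotes it.
\<close>

definition mult_op :: "(complex \<Rightarrow> complex) \<Rightarrow> hardy2 \<Rightarrow> hardy2" where
  "mult_op f g = (THE k. \<forall>z\<in>ball 0 1. hfun k z = f z * hfun g z)"

definition bounded_operators :: "(hardy2 \<Rightarrow> hardy2) set" where
  "bounded_operators = {T. bounded_linear T \<and> (\<forall>c x. T (scaleC c x) = scaleC c (T x))}"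

text \<open>
  The predual of the bounded operators is the trace class. Its elements are the operators
  $\sum_n x_n \otimes y_n^*$ with square-summable $\|x_n\|$ and $\|y_n\|$, and such an element acts
  on $T$ as $\sum_n \langle T x_n, y_n\rangle$. The weak-$*$ topology is the coarsest one that makes
  these functionals continuous.
\<close>

definition square_summable :: "(nat \<Rightarrow> hardy2) \<Rightarrow> bool" where
  "square_summable x \<longleftrightarrow> summable (\<lambda>n. (norm (x n))\<^sup>2)"

definition weak_star_operators :: "(hardy2 \<Rightarrow> hardy2) topology" where
  "weak_star_operators = topology_generated_by
     {{T \<in> bounded_operators. (\<Sum>n. hinner (T (x n)) (y n)) \<in> U} | x y U.
        square_summable x \<and> square_summable y \<and> open U}"

definition weak_star_Hinf :: "(complex \<Rightarrow> complex) topology" where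
  "weak_star_Hinf = pullback_topology Hinf mult_op weak_star_operators"

definition unital_subalgebra :: "(complex \<Rightarrow> complex) set \<Rightarrow> bool" where
  "unital_subalgebra A \<longleftrightarrow> A \<subseteq> Hinf \<and> (\<lambda>z. 1) \<in> A \<and>
     (\<forall>f\<in>A. \<forall>g\<in>A. (\<lambda>z. f z + g z) \<in> A \<and> (\<lambda>z. f z * g z) \<in> A) \<and>
     (\<forall>c. \<forall>f\<in>A. (\<lambda>z. c * f z) \<in> A)"

definition separates :: "(complex \<Rightarrow> complex) set \<Rightarrow> complex set \<Rightarrow> bool" where
  "separates A E \<longleftrightarrow> (\<forall>l\<in>E. \<forall>m\<in>E. l \<noteq> m \<longrightarrow> (\<exists>f\<in>A. f l \<noteq> f m))"

definition cyclic_subspace :: "(complex \<Rightarrow> complex) set \<Rightarrow> hardy2 \<Rightarrow> hardy2 set" where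
  "cyclic_subspace A h = closure ((\<lambda>f. mult_op f h) ` A)"

section \<open>Outer functions and positive matrices\<close>

text \<open>
  The classical definition: up to a unimodular constant, \<open>h\<close> is the exponential of the Herglotz
  integral of \<open>ln \<phi>\<close> for a positive function \<open>\<phi>\<close> with integrable logarithm. The value \<open>\<phi> t\<close> is
  that of the boundary weight at $e^{it}$.
\<close>

definition outer :: "hardy2 \<Rightarrow> bool" where
  "outer h \<longleftrightarrow> (\<exists>c \<phi>. cmod c = 1 \<and> (\<forall>t. \<phi> t > 0) \<and>
     (\<lambda>t. ln (\<phi> t)) absolutely_integrable_on {0..2 * pi} \<and>
     (\<forall>z\<in>ball 0 1. hfun h z = c * exp (1 / (2 * pi) *
        integral {0..2 * pi} (\<lambda>t. (cis t + z) / (cis t - z) * of_real (ln (\<phi> t :: real))))))"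

definition positive_semidefinite :: "nat set \<Rightarrow> (nat \<Rightarrow> nat \<Rightarrow> complex) \<Rightarrow> bool" where
  "positive_semidefinite I a \<longleftrightarrow>
     (\<forall>v. (\<Sum>i\<in>I. \<Sum>j\<in>I. cnj (v i) * a i j * v j) \<in> \<real>\<^sub>\<ge>\<^sub>0)"

end

theory Submission
  imports Defs
begin

text \<open>
  If a contraction \<open>f\<close> in \<open>A\<close> interpolates, then the cyclic subspace \<open>L\<close> is invariant
  under multiplication by \<open>f\<close>, and the adjoint of the restriction to \<open>L\<close> multiplies each
  \<open>P_L k_i\<close> by the conjugate of \<open>w i\<close>. This adjoint is a contraction, which is what the
  matrix inequality says (\<open>Pick_matrix_positive\<close>).

  For the converse let \<open>V\<close> be the set of all interpolants in \<open>A\<close>, without a bound on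
  their size. For an outer function \<open>h\<close> the element of smallest norm in the closure of \<open>V
  h\<close> is a linear combination of the \<open>P_L k_i\<close>, and the matrix inequality for \<open>h\<close> makes
  its norm at most that of \<open>h\<close> (\<open>interpolant_of_small_norm\<close>). In terms of boundary
  values: for every weight \<open>|h|^2\<close> there are interpolants \<open>f\<close> for which the integral of
  \<open>|f|^2 |h|^2\<close> exceeds that of \<open>|h|^2\<close> by as little as desired. It remains to find one
  \<open>f\<close> for all weights, since a function which is a contraction with respect to all weights
  is bounded by 1.

  The main tool is \<open>outer_majorant\<close>: a sum of weights \<open>|X_n|^2\<close>, with square-summable
  norms, is dominated by one \<open>|h|^2\<close> with \<open>h\<close> outer, at an arbitrarily small cost in
  total mass. It has three uses. It makes the weights a convex cone, so that a separation
  argument in the plane yields, for any finite number of weights, an interpolant that serves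
  all of them (\<open>almost_contractive_two\<close>, \<open>almost_contractive_restrict\<close>). It shows that
  kernels can be used as weights, so that a cluster point \<open>g\<close> of these interpolants, which
  exists by compactness of the sets of bounded coefficient sequences, is bounded by 1 on the
  disk (\<open>almost_contractive_attained\<close>). And it bounds the sum of \<open>\<parallel>f
  x_n\<parallel>^2\<close> along the filter for each family \<open>x\<close> that occurs in a functional of
  the predual. This makes the convergence to \<open>g\<close> weak-* convergence although the
  interpolants have no common bound (\<open>weak_star_limit\<close>), and so \<open>g\<close> lies in the weak-*
  closed algebra \<open>A\<close>.
\<close>

section \<open>The inner product\<close>

lemma hfun_zero [simp]: "hfun 0 z = 0"
  by (simp add: zero_hardy2.rep_eq)

lemma hfun_add [simp]: "hfun (f + g) z = hfun f z + hfun g z"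
  by (simp add: plus_hardy2.rep_eq)

lemma hfun_scaleC [simp]: "hfun (scaleC c f) z = c * hfun f z"
  by (simp add: scaleC.rep_eq)

lemma hfun_uminus [simp]: "hfun (- f) z = - hfun f z"
  by (simp add: uminus_hardy2_def)

lemma hfun_diff [simp]: "hfun (f - g) z = hfun f z - hfun g z"
  unfolding minus_hardy2_def hfun_add hfun_uminus by simp

lemma hfun_scaleR [simp]: "hfun (r *\<^sub>R f) z = of_real r * hfun f z"
  by (simp add: scaleR_hardy2_def)

lemma hfun_sum [simp]: "hfun (\<Sum>i\<in>I. f i) z = (\<Sum>i\<in>I. hfun (f i) z)"
  by (induction I rule: infinite_finite_induct) auto

lemma hcoeff_add [simp]: "hcoeff (f + g) n = hcoeff f n + hcoeff g n"
  by (simp add: plus_hardy2.rep_eq taylor_add hfun_holomorphic)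

lemma hcoeff_diff [simp]: "hcoeff (f - g) n = hcoeff f n - hcoeff g n"
  using hcoeff_add[of "f - g" g n] by simp

lemma hcoeff_zero [simp]: "hcoeff 0 n = 0"
  by (simp add: zero_hardy2.rep_eq)

lemma scaleC_diff_right: "scaleC c (f - g) = scaleC c f - scaleC c g"
  by (rule hardy2_eqI) (simp add: algebra_simps)

lemma scaleR_eq_scaleC: "r *\<^sub>R f = scaleC (of_real r) f"
  by (simp add: scaleR_hardy2_def)

lemma hinner_add_left: "hinner (f + g) k = hinner f k + hinner g k"
  using suminf_add[OF summable_hinner summable_hinner, of f k g k]
  by (simp add: hinner_def distrib_right)

lemma hinner_zero_left [simp]: "hinner 0 k = 0"
  by (simp add: hinner_def)

lemma hinner_diff_left: "hinner (f - g) k = hinner f k - hinner g k"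
  using hinner_add_left[of "f - g" g k] by simp

lemma hinner_add_right: "hinner k (f + g) = hinner k f + hinner k g"
  by (subst (1 2 3) hinner_commute) (simp add: hinner_add_left)

lemma hinner_zero_right [simp]: "hinner k 0 = 0"
  by (subst hinner_commute) simp

lemma hinner_diff_right: "hinner k (f - g) = hinner k f - hinner k g"
  by (subst (1 2 3) hinner_commute) (simp add: hinner_diff_left)

lemma hinner_scaleC_right: "hinner f (scaleC c g) = cnj c * hinner f g"
  by (subst (1 2) hinner_commute) (simp add: hinner_scaleC_left)

lemma hinner_sum_left: "hinner (\<Sum>i\<in>I. f i) g = (\<Sum>i\<in>I. hinner (f i) g)"
  by (induction I rule: infinite_finite_induct) (auto simp: hinner_add_left)

lemma hinner_sum_right: "hinner g (\<Sum>i\<in>I. f i) = (\<Sum>i\<in>I. hinner g (f i))"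
  by (induction I rule: infinite_finite_induct) (auto simp: hinner_add_right)

lemma norm_hardy2_sq: "(norm f)\<^sup>2 = (\<Sum>n. (cmod (hcoeff f n))\<^sup>2)"
  by (simp add: norm_hardy2_def inner_hardy2_def hinner_self suminf_nonneg summable_hcoeff)

lemma hinner_same: "hinner f f = of_real ((norm f)\<^sup>2)"
  by (simp add: hinner_self norm_hardy2_sq)

lemma norm_scaleC [simp]: "norm (scaleC c f) = cmod c * norm f"
proof -
  have "complex_of_real ((norm (scaleC c f))\<^sup>2) = (c * cnj c) * hinner f f"
    unfolding hinner_same[symmetric] by (simp add: hinner_scaleC_left hinner_scaleC_right)
  also have "\<dots> = of_real ((cmod c * norm f)\<^sup>2)"
    unfolding hinner_same complex_norm_square[symmetric] by (simp add: power_mult_distrib)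
  finally have "(norm (scaleC c f))\<^sup>2 = (cmod c * norm f)\<^sup>2"
    by (simp only: of_real_eq_iff)
  then show ?thesis by (simp add: power2_eq_iff_nonneg)
qed

lemma hinner_Cauchy_Schwarz: "cmod (hinner f g) \<le> norm f * norm g"
proof -
  \<comment> \<open>Rotating f by u makes the inner product real and nonnegative.\<close>
  define u where "u = cnj (sgn (hinner f g))"
  have u: "cmod u \<le> 1" by (simp add: u_def norm_sgn)
  have "u * hinner f g = of_real (cmod (hinner f g))"
    by (cases "hinner f g = 0")
      (simp_all add: u_def sgn_eq complex_norm_square[symmetric] mult.commute power2_eq_square)
  then have "cmod (hinner f g) = inner (scaleC u f) g"
    by (simp add: inner_hardy2_def hinner_scaleC_left)
  also have "\<dots> \<le> norm (scaleC u f) * norm g" by (rule norm_cauchy_schwarz)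
  also have "\<dots> \<le> (1 * norm f) * norm g"
    unfolding norm_scaleC by (intro mult_right_mono u norm_ge_zero)
  finally show ?thesis by simp
qed

lemma tendsto_hinner_left:
  assumes "(f \<longlongrightarrow> x) F"
  shows "((\<lambda>t. hinner (f t) y) \<longlongrightarrow> hinner x y) F"
proof (rule tendsto_dist_iff[THEN iffD2])
  have lim: "((\<lambda>t. norm (f t - x) * norm y) \<longlongrightarrow> 0) F"
    using assms by (intro tendsto_mult_left_zero) (simp add: tendsto_norm_zero LIM_zero)
  show "((\<lambda>t. dist (hinner (f t) y) (hinner x y)) \<longlongrightarrow> 0) F"
    by (rule Lim_null_comparison[OF _ lim])
      (simp add: dist_norm hinner_Cauchy_Schwarz flip: hinner_diff_left)
qed

lemma cmod_hcoeff_le: "cmod (hcoeff f n) \<le> norm f"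
proof -
  have "(cmod (hcoeff f n))\<^sup>2 \<le> (\<Sum>n. (cmod (hcoeff f n))\<^sup>2)"
    using sum_le_suminf[OF summable_hcoeff, of "{n}" f] by simp
  then show ?thesis
    unfolding norm_hardy2_sq[symmetric] by (rule power2_le_imp_le) simp
qed

section \<open>Completeness and orthogonal projections\<close>

text \<open>
  The series converges absolutely in the disk, since the modulus of \<open>a n * z ^ n\<close> is at
  most the sum of the squares of its two factors. This is how elements of the Hardy space
  are produced as limits: it is enough to control coefficients.
\<close>

lemma ell2_hardy2:
  assumes a: "summable (\<lambda>n. (cmod (a n))\<^sup>2)"
  obtains f where "\<And>n. hcoeff f n = a n"
proof -
  define F where "F z = (if z \<in> ball 0 1 then (\<Sum>n. a n * z ^ n) else 0)" for z
  have sums: "(\<lambda>n. a n * z ^ n) sums F z" if z: "z \<in> ball 0 1" for z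
  proof -
    have "summable (\<lambda>n. (cmod z)\<^sup>2 ^ n)"
      using z by (intro summable_geometric) (simp add: abs_square_less_1)
    then have "summable (\<lambda>n. (cmod (a n))\<^sup>2 + (cmod z)\<^sup>2 ^ n)"
      using a by (intro summable_add)
    moreover have "norm (a n * z ^ n) \<le> (cmod (a n))\<^sup>2 + (cmod z)\<^sup>2 ^ n" for n
    proof -
      have "2 * (cmod (a n) * cmod z ^ n) \<le> (cmod (a n))\<^sup>2 + (cmod z ^ n)\<^sup>2"
        using sum_squares_bound[of "cmod (a n)" "cmod z ^ n"] by simp
      moreover have "0 \<le> cmod (a n) * cmod z ^ n" by simp
      moreover have "(cmod z)\<^sup>2 ^ n = (cmod z ^ n)\<^sup>2"
        by (simp add: power_mult[symmetric] mult.commute)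
      ultimately show ?thesis
        unfolding norm_mult norm_power by linarith
    qed
    ultimately have "summable (\<lambda>n. a n * z ^ n)"
      by (rule summable_comparison_test'[where N = 0])
    then show ?thesis using z by (simp add: F_def summable_sums)
  qed
  have "in_hardy2 F"
  proof -
    have "F z = 0" if "z \<notin> ball 0 1" for z using that by (simp add: F_def)
    then show ?thesis
      using taylor_unique[OF sums] a by (simp add: in_hardy2_def)
  qed
  then have "hcoeff (Abs_hardy2 F) n = a n" for n
    using taylor_unique(2)[OF sums] by (simp add: Abs_hardy2_inverse)
  then show thesis by (rule that)
qed

text \<open>
  The coefficients of a Cauchy sequence converge. Bounds on finitely many coefficients of
  the differences survive the passage to the limit, so the convergence is in norm.
\<close>

instance hardy2 :: complete_space
proof
  fix X :: "nat \<Rightarrow> hardy2"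
  assume X: "Cauchy X"
  have "Cauchy (\<lambda>m. hcoeff (X m) n)" for n
  proof (rule metric_CauchyI)
    fix e :: real assume "e > 0"
    then obtain M where M: "\<forall>m\<ge>M. \<forall>k\<ge>M. dist (X m) (X k) < e"
      using metric_CauchyD[OF X] by blast
    have "dist (hcoeff (X m) n) (hcoeff (X k) n) \<le> dist (X m) (X k)" for m k
      using cmod_hcoeff_le[of "X m - X k" n] by (simp add: dist_norm)
    then show "\<exists>M. \<forall>m\<ge>M. \<forall>k\<ge>M. dist (hcoeff (X m) n) (hcoeff (X k) n) < e"
      using M le_less_trans by blast
  qed
  then have "\<exists>a. (\<lambda>m. hcoeff (X m) n) \<longlonglongrightarrow> a" for n
    by (simp add: Cauchy_convergent_iff convergent_def)
  then obtain a where a: "\<And>n. (\<lambda>m. hcoeff (X m) n) \<longlonglongrightarrow> a n" by metis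
  have partial: "(\<Sum>n<K. (cmod (hcoeff (X m) n - a n))\<^sup>2) \<le> e\<^sup>2"
    if m: "\<And>k. k \<ge> m \<Longrightarrow> norm (X m - X k) \<le> e" for m K e
  proof (rule tendsto_upperbound)
    show "(\<lambda>k. \<Sum>n<K. (cmod (hcoeff (X m) n - hcoeff (X k) n))\<^sup>2)
        \<longlonglongrightarrow> (\<Sum>n<K. (cmod (hcoeff (X m) n - a n))\<^sup>2)"
      by (intro tendsto_intros a)
    have "(\<Sum>n<K. (cmod (hcoeff (X m) n - hcoeff (X k) n))\<^sup>2) \<le> e\<^sup>2" if "k \<ge> m" for k
    proof -
      have "(\<Sum>n<K. (cmod (hcoeff (X m - X k) n))\<^sup>2) \<le> (norm (X m - X k))\<^sup>2"
        unfolding norm_hardy2_sq by (rule sum_le_suminf[OF summable_hcoeff]) auto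
      also have "\<dots> \<le> e\<^sup>2" using m[OF that] by (simp add: power_mono)
      finally show ?thesis by simp
    qed
    then show "\<forall>\<^sub>F k in sequentially. (\<Sum>n<K. (cmod (hcoeff (X m) n - hcoeff (X k) n))\<^sup>2) \<le> e\<^sup>2"
      by (auto simp: eventually_sequentially)
  qed auto
  have ev: "\<exists>m0. \<forall>m\<ge>m0. \<forall>k\<ge>m. norm (X m - X k) \<le> e" if "e > 0" for e
    using metric_CauchyD[OF X that] unfolding dist_norm by (meson less_imp_le order_trans)
  have diff: "summable (\<lambda>n. (cmod (hcoeff (X m) n - a n))\<^sup>2)"
    "(\<Sum>n. (cmod (hcoeff (X m) n - a n))\<^sup>2) \<le> e\<^sup>2"
    if m: "\<And>k. k \<ge> m \<Longrightarrow> norm (X m - X k) \<le> e" for m e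
  proof -
    show s: "summable (\<lambda>n. (cmod (hcoeff (X m) n - a n))\<^sup>2)"
      by (rule summableI_nonneg_bounded[where x = "e\<^sup>2"]) (use partial[OF m] in auto)
    show "(\<Sum>n. (cmod (hcoeff (X m) n - a n))\<^sup>2) \<le> e\<^sup>2"
      by (rule suminf_le_const[OF s]) (rule partial[OF m])
  qed
  obtain m1 where m1: "\<And>k. k \<ge> m1 \<Longrightarrow> norm (X m1 - X k) \<le> 1"
    using ev[of 1] by auto
  obtain d where d: "\<And>n. hcoeff d n = hcoeff (X m1) n - a n"
    using ell2_hardy2[OF diff(1)[OF m1]] by metis
  define x where "x = X m1 - d"
  have x: "hcoeff x n = a n" for n by (simp add: x_def d)
  have "X \<longlonglongrightarrow> x"
  proof (rule LIMSEQ_I)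
    fix r :: real assume "r > 0"
    then obtain m0 where m0: "\<forall>m\<ge>m0. \<forall>k\<ge>m. norm (X m - X k) \<le> r / 2"
      using ev[of "r / 2"] by auto
    have "norm (X m - x) < r" if "m \<ge> m0" for m
    proof -
      have "(norm (X m - x))\<^sup>2 \<le> (r / 2)\<^sup>2"
        using diff(2)[of m "r / 2"] m0 that by (simp add: norm_hardy2_sq x)
      then have "norm (X m - x) \<le> r / 2" by (rule power2_le_imp_le) (use \<open>r > 0\<close> in simp)
      then show ?thesis using \<open>r > 0\<close> by linarith
    qed
    then show "\<exists>no. \<forall>m\<ge>no. norm (X m - x) < r" by blast
  qed
  then show "convergent X" by (auto simp: convergent_def)
qed

definition csubspace :: "hardy2 set \<Rightarrow> bool" where
  "csubspace L \<longleftrightarrow> 0 \<in> L \<and> (\<forall>x\<in>L. \<forall>y\<in>L. x + y \<in> L) \<and> (\<forall>c. \<forall>x\<in>L. scaleC c x \<in> L)"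

lemma csubspace_closure:
  assumes "csubspace L"
  shows "csubspace (closure L)"
  unfolding csubspace_def
proof (intro conjI ballI allI)
  show "0 \<in> closure L"
    using assms closure_subset by (auto simp: csubspace_def)
next
  fix x y assume "x \<in> closure L" "y \<in> closure L"
  then obtain f g where "\<forall>n. f n \<in> L" "f \<longlonglongrightarrow> x" "\<forall>n. g n \<in> L" "g \<longlonglongrightarrow> y"
    unfolding closure_sequential by blast
  then have "\<forall>n. f n + g n \<in> L" "(\<lambda>n. f n + g n) \<longlonglongrightarrow> x + y"
    using assms by (auto simp: csubspace_def intro: tendsto_add)
  then show "x + y \<in> closure L"
    unfolding closure_sequential by (intro exI[of _ "\<lambda>n. f n + g n"] conjI)
next
  fix c x assume "x \<in> closure L"
  then obtain f where f: "\<forall>n. f n \<in> L" "f \<longlonglongrightarrow> x"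
    unfolding closure_sequential by blast
  have "(\<lambda>n. norm (scaleC c (f n) - scaleC c x)) \<longlonglongrightarrow> cmod c * 0"
    unfolding scaleC_diff_right[symmetric] norm_scaleC
    using f(2) by (intro tendsto_mult tendsto_const) (simp add: LIM_zero tendsto_norm_zero)
  then have "(\<lambda>n. scaleC c (f n)) \<longlonglongrightarrow> scaleC c x"
    by (simp add: tendsto_norm_zero_iff LIM_zero_iff)
  moreover have "\<forall>n. scaleC c (f n) \<in> L" using assms f(1) by (auto simp: csubspace_def)
  ultimately show "scaleC c x \<in> closure L"
    unfolding closure_sequential by (intro exI[of _ "\<lambda>n. scaleC c (f n)"] conjI)
qed

lemma csubspace_diff: "csubspace L \<Longrightarrow> x \<in> L \<Longrightarrow> y \<in> L \<Longrightarrow> x - y \<in> L"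
  unfolding csubspace_def minus_hardy2_def uminus_hardy2_def by blast

lemma csubspace_scaleR: "csubspace L \<Longrightarrow> x \<in> L \<Longrightarrow> r *\<^sub>R x \<in> L"
  unfolding csubspace_def scaleR_hardy2_def by blast

lemma csubspace_sum: "csubspace L \<Longrightarrow> (\<And>i. i \<in> I \<Longrightarrow> f i \<in> L) \<Longrightarrow> sum f I \<in> L"
  by (induction I rule: infinite_finite_induct) (auto simp: csubspace_def)

lemma parallelogram: "(norm (x + y))\<^sup>2 + (norm (x - y))\<^sup>2 = 2 * (norm x)\<^sup>2 + 2 * (norm (y :: hardy2))\<^sup>2"
  by (simp add: power2_norm_eq_inner inner_add_left inner_add_right inner_diff_left inner_diff_right)

text \<open>
  A sequence in \<open>L\<close> whose distances to \<open>x\<close> tend to the infimum is Cauchy by the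
  parallelogram law, because the midpoint of two of its members is not closer to \<open>x\<close> than
  the infimum.
\<close>

lemma orthogonal_projection_exists:
  assumes L: "csubspace L" "closed L"
  shows "\<exists>p\<in>L. \<forall>y\<in>L. hinner (x - p) y = 0"
proof -
  define d where "d = (INF y\<in>L. (norm (x - y))\<^sup>2)"
  have ne: "L \<noteq> {}" using L by (auto simp: csubspace_def)
  have bdd: "bdd_below ((\<lambda>y. (norm (x - y))\<^sup>2) ` L)" by (rule bdd_belowI[where m = 0]) auto
  have d_le: "d \<le> (norm (x - y))\<^sup>2" if "y \<in> L" for y
    unfolding d_def by (rule cINF_lower[OF bdd that])
  have "\<exists>y\<in>L. (norm (x - y))\<^sup>2 < d + inverse (real (Suc n))" for n
    using cINF_less_iff[OF ne bdd, of "d + inverse (real (Suc n))"] by (simp add: d_def)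
  then obtain y where yL: "\<And>n. y n \<in> L"
    and y: "\<And>n. (norm (x - y n))\<^sup>2 < d + inverse (real (Suc n))" by metis
  have close: "(norm (y m - y n))\<^sup>2 \<le> 2 * inverse (real (Suc m)) + 2 * inverse (real (Suc n))" for m n
  proof -
    have "d \<le> (norm (x - (1/2) *\<^sub>R (y m + y n)))\<^sup>2"
      using L yL by (intro d_le csubspace_scaleR) (auto simp: csubspace_def)
    also have "x - (1/2) *\<^sub>R (y m + y n) = (1/2) *\<^sub>R ((x - y m) + (x - y n))"
      by (simp add: algebra_simps flip: scaleR_add_left)
    finally have "4 * d \<le> (norm ((x - y m) + (x - y n)))\<^sup>2"
      by (simp add: power_divide)
    then show ?thesis
      using parallelogram[of "x - y m" "x - y n"] y[of m] y[of n]
      by (simp add: norm_minus_commute)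
  qed
  have "Cauchy y"
  proof (rule metric_CauchyI)
    fix e :: real assume "e > 0"
    then obtain N where N: "inverse (real (Suc N)) < e\<^sup>2 / 4"
      using reals_Archimedean[of "e\<^sup>2 / 4"] by auto
    have "dist (y m) (y n) < e" if "m \<ge> N" "n \<ge> N" for m n
    proof -
      have "inverse (real (Suc m)) \<le> inverse (real (Suc N))"
        "inverse (real (Suc n)) \<le> inverse (real (Suc N))"
        using that by (auto intro: le_imp_inverse_le)
      then have "(norm (y m - y n))\<^sup>2 < e\<^sup>2"
        using close[of m n] N by linarith
      then show ?thesis
        using \<open>e > 0\<close> by (simp add: dist_norm power_less_imp_less_base)
    qed
    then show "\<exists>M. \<forall>m\<ge>M. \<forall>n\<ge>M. dist (y m) (y n) < e" by blast
  qed
  then obtain p where p: "y \<longlonglongrightarrow> p"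
    using Cauchy_convergent_iff convergent_def by blast
  have pL: "p \<in> L" using L(2) yL p closed_sequentially by blast
  have "(norm (x - p))\<^sup>2 \<le> d"
  proof (rule tendsto_le[OF sequentially_bot])
    show "(\<lambda>n. (norm (x - y n))\<^sup>2) \<longlonglongrightarrow> (norm (x - p))\<^sup>2" by (intro tendsto_intros p)
    show "(\<lambda>n. d + inverse (real (Suc n))) \<longlonglongrightarrow> d"
      using tendsto_add[OF tendsto_const[of d] LIMSEQ_inverse_real_of_nat] by simp
    show "\<forall>\<^sub>F n in sequentially. (norm (x - y n))\<^sup>2 \<le> d + inverse (real (Suc n))"
      using y by (intro always_eventually allI less_imp_le)
  qed
  then have min: "(norm (x - p))\<^sup>2 \<le> (norm (x - p - z))\<^sup>2" if "z \<in> L" for z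
    using order_trans[OF _ d_le[of "p + z"]] L pL that unfolding csubspace_def diff_diff_eq by blast
  have "hinner (x - p) z = 0" if z: "z \<in> L" for z
  proof (rule ccontr)
    assume ne: "hinner (x - p) z \<noteq> 0"
    define c where "c = hinner (x - p) z"
    \<comment> \<open>Moving p by the component of x - p along z would bring it closer to x.\<close>
    define s where "s = inverse ((norm z)\<^sup>2)"
    have z0: "norm z \<noteq> 0" using ne by auto
    have "(norm (x - p))\<^sup>2 \<le> (norm (x - p - scaleC (of_real s * c) z))\<^sup>2"
      using L z by (intro min) (auto simp: csubspace_def)
    moreover have "of_real ((norm (x - p - scaleC (of_real s * c) z))\<^sup>2)
        = (of_real ((norm (x - p))\<^sup>2 - s * (cmod c)\<^sup>2) :: complex)"
    proof -
      have c': "hinner z (x - p) = cnj c" unfolding c_def by (rule hinner_commute)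
      have sz: "complex_of_real s * (complex_of_real (norm z))\<^sup>2 = 1"
        using z0 by (simp add: s_def)
      have expand: "hinner (a - scaleC k z) (a - scaleC k z)
          = hinner a a - cnj k * hinner a z - k * hinner z a + k * cnj k * hinner z z" for a k
        by (simp add: hinner_diff_left hinner_diff_right hinner_scaleC_left hinner_scaleC_right
            algebra_simps)
      have "of_real ((norm (x - p - scaleC (of_real s * c) z))\<^sup>2) =
          of_real ((norm (x - p))\<^sup>2) - of_real s * cnj c * c - of_real s * c * cnj c
          + of_real s * c * (of_real s * cnj c) * (of_real (norm z))\<^sup>2"
        using expand[of "x - p" "of_real s * c"] unfolding c' c_def[symmetric] hinner_same
        by simp
      also have "of_real s * c * (of_real s * cnj c) * (of_real (norm z))\<^sup>2
          = of_real s * c * cnj c * (complex_of_real s * (complex_of_real (norm z))\<^sup>2)"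
        by (simp add: algebra_simps)
      also have "\<dots> = of_real s * c * cnj c" unfolding sz by simp
      finally show ?thesis
        unfolding of_real_diff of_real_mult complex_norm_square[of c] by (simp add: algebra_simps)
    qed
    then have "(norm (x - p - scaleC (of_real s * c) z))\<^sup>2 = (norm (x - p))\<^sup>2 - s * (cmod c)\<^sup>2"
      by (simp only: of_real_eq_iff)
    moreover have "s * (cmod c)\<^sup>2 > 0"
      using ne z0 by (simp add: s_def c_def)
    ultimately show False by linarith
  qed
  then show ?thesis using pL by blast
qed

text \<open>
  A vector with the defining property of the projection is unique, so the definite
  description in \<open>proj\<close> denotes it.
\<close>

lemma
  assumes L: "csubspace L" "closed L"
  shows proj_in: "proj L x \<in> L"
    and proj_orthogonal: "y \<in> L \<Longrightarrow> hinner (x - proj L x) y = 0"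
proof -
  obtain p where p: "p \<in> L" "\<forall>y\<in>L. hinner (x - p) y = 0"
    using orthogonal_projection_exists[OF L] by blast
  have "q = p" if q: "q \<in> L" "\<forall>y\<in>L. hinner (x - q) y = 0" for q
  proof -
    have "p - q \<in> L" using L p q csubspace_diff by blast
    then have "hinner (x - q) (p - q) - hinner (x - p) (p - q) = 0" using p q by simp
    then have "hinner (p - q) (p - q) = 0" by (simp flip: hinner_diff_left)
    then show ?thesis by (simp add: hinner_same)
  qed
  then have "proj L x = p"
    unfolding proj_def using p by (intro the_equality) blast+
  then show "proj L x \<in> L" "y \<in> L \<Longrightarrow> hinner (x - proj L x) y = 0"
    using p by auto
qed

lemma hinner_proj_right:
  assumes "csubspace L" "closed L" "y \<in> L"
  shows "hinner y (proj L x) = hinner y x"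
  using proj_orthogonal[OF assms, of x]
  by (subst (1 2) hinner_commute) (simp add: hinner_diff_left)

section \<open>Circle means and multipliers\<close>

lemma has_integral_series:
  fixes u :: "nat \<Rightarrow> real \<Rightarrow> complex"
  assumes cont: "\<And>k. continuous_on {a..b} (u k)"
    and M: "\<And>k t. t \<in> {a..b} \<Longrightarrow> cmod (u k t) \<le> M k" "summable M"
    and I: "\<And>k. (u k has_integral I k) {a..b}"
  shows "((\<lambda>t. \<Sum>k. u k t) has_integral (\<Sum>k. I k)) {a..b}" "summable I"
proof -
  have "uniform_limit {a..b} (\<lambda>n t. \<Sum>k<n. u k t) (\<lambda>t. \<Sum>k. u k t) sequentially"
    by (rule Weierstrass_m_test[OF M])
  moreover have "continuous_on {a..b} (\<lambda>t. \<Sum>k<n. u k t)" for n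
    by (intro continuous_intros cont)
  ultimately obtain IS J where
    IS: "\<And>n. ((\<lambda>t. \<Sum>k<n. u k t) has_integral IS n) {a..b}"
    and J: "((\<lambda>t. \<Sum>k. u k t) has_integral J) {a..b}" "IS \<longlonglongrightarrow> J"
    by (rule uniform_limit_integral) auto
  have "((\<lambda>t. \<Sum>k<n. u k t) has_integral (\<Sum>k<n. I k)) {a..b}" for n
    by (intro has_integral_sum I) auto
  then have "IS n = (\<Sum>k<n. I k)" for n
    using IS has_integral_unique by blast
  then have "IS = (\<lambda>n. \<Sum>k<n. I k)" by blast
  then have "I sums J" using J(2) by (simp add: sums_def)
  then show "((\<lambda>t. \<Sum>k. u k t) has_integral (\<Sum>k. I k)) {a..b}" "summable I"
    using J(1) by (auto simp: sums_iff)
qed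

lemma has_integral_cis_of_int:
  fixes m :: int
  assumes "m \<noteq> 0"
  shows "((\<lambda>t. cis (of_int m * t)) has_integral 0) {0..2 * pi}"
proof -
  have deriv: "((\<lambda>t. cis (of_int m * t) / (\<i> * of_int m)) has_vector_derivative cis (of_int m * t))
      (at t within {0..2 * pi})" for t
  proof -
    have "((\<lambda>w. exp (\<i> * (of_int m * w)) / (\<i> * of_int m)) has_field_derivative
        exp (\<i> * (of_int m * of_real t))) (at (of_real t))"
      using assms by (auto intro!: derivative_eq_intros simp: mult_ac)
    from has_vector_derivative_real_field[OF this] show ?thesis
      by (simp add: cis_conv_exp)
  qed
  have "((\<lambda>t. cis (of_int m * t)) has_integral
      cis (of_int m * (2 * pi)) / (\<i> * of_int m) - cis (of_int m * 0) / (\<i> * of_int m)) {0..2 * pi}"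
    by (rule fundamental_theorem_of_calculus) (use deriv in auto)
  moreover have "cis (of_int m * (2 * pi)) = 1"
    using cis_multiple_2pi[of "of_int m"] by (simp add: mult_ac)
  ultimately show ?thesis by simp
qed

lemma has_integral_cis_power:
  "((\<lambda>t. cis t ^ k * cnj (cis t ^ j)) has_integral (if k = j then 2 * pi else 0)) {0..2 * pi}"
proof -
  have "cis t ^ k * cnj (cis t ^ j) = cis (of_int (int k - int j) * t)" for t
    by (simp add: Complex.DeMoivre cis_cnj cis_mult algebra_simps)
  moreover have "((\<lambda>t. cis (of_int (int k - int j) * t)) has_integral
      (if k = j then 2 * pi else 0)) {0..2 * pi}"
    using has_integral_cis_of_int[of "int k - int j"] has_integral_const_real[of "1::complex" 0 "2 * pi"]
    by (auto simp: scaleR_conv_of_real)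
  ultimately show ?thesis by simp
qed

text \<open>
  The power series of \<open>f\<close> converges absolutely on the circle of radius \<open>\<rho>\<close>, which
  allows integration term by term. The radius \<open>R\<close> of the disk is kept arbitrary in order
  to include the unit circle itself when \<open>f\<close> is entire.
\<close>

lemma circle_Parseval:
  assumes f: "f holomorphic_on ball 0 R" and \<rho>: "0 \<le> \<rho>" "\<rho> < R"
  shows "summable (\<lambda>k. (cmod (taylor f k) * \<rho> ^ k)\<^sup>2)"
    and "((\<lambda>t. (cmod (f (of_real \<rho> * cis t)))\<^sup>2) has_integral
          2 * pi * (\<Sum>k. (cmod (taylor f k) * \<rho> ^ k)\<^sup>2)) {0..2 * pi}"
proof -
  define a where "a k = taylor f k * of_real \<rho> ^ k" for k
  define F where "F t = f (of_real \<rho> * cis t)" for t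
  obtain r where r: "\<rho> < r" "r < R" using \<rho>(2) dense by blast
  have "summable (\<lambda>n. taylor f n * of_real r ^ n)"
    using holomorphic_power_series[OF f, of "of_real r"] r \<rho> by (simp add: sums_iff taylor_def)
  then have abs: "summable (\<lambda>n. cmod (a n))"
    unfolding a_def using powser_insidea[of "taylor f" "of_real r" "of_real \<rho>"] r \<rho> by simp
  have in_ball: "of_real \<rho> * cis t \<in> ball 0 R" for t
    using \<rho> by (simp add: norm_mult)
  have Fsums: "(\<lambda>k. a k * cis t ^ k) sums F t" for t
    using holomorphic_power_series[OF f in_ball, of t]
    by (simp add: F_def a_def taylor_def power_mult_distrib mult_ac)
  have Fcont: "continuous_on S F" for S
    unfolding F_def
    by (rule continuous_on_compose2[OF holomorphic_on_imp_continuous_on[OF f]])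
      (use in_ball in \<open>auto intro!: continuous_intros\<close>)
  \<comment> \<open>A first termwise integration extracts one coefficient of F.\<close>
  have coeff: "((\<lambda>t. F t * cnj (cis t ^ j)) has_integral (2 * pi * a j)) {0..2 * pi}" for j
  proof -
    have "((\<lambda>t. \<Sum>k. a k * (cis t ^ k * cnj (cis t ^ j))) has_integral
        (\<Sum>k. a k * (if k = j then 2 * pi else 0))) {0..2 * pi}"
      by (rule has_integral_series(1)[where M = "\<lambda>k. cmod (a k)",
            OF _ _ _ has_integral_mult_right[OF has_integral_cis_power]])
        (use abs in \<open>auto intro!: continuous_intros simp: norm_mult norm_power\<close>)
    moreover have "(\<Sum>k. a k * (cis t ^ k * cnj (cis t ^ j))) = F t * cnj (cis t ^ j)" for t
      using sums_mult2[OF Fsums[of t], of "cnj (cis t ^ j)"] by (simp add: sums_iff mult.assoc)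
    moreover have "(\<Sum>k. a k * (if k = j then 2 * pi else 0)) = 2 * pi * a j"
      by (subst suminf_finite[of "{j}"]) auto
    ultimately show ?thesis by simp
  qed
  obtain B where B: "\<And>t. t \<in> {0..2 * pi} \<Longrightarrow> cmod (F t) \<le> B"
    using compact_continuous_image[OF Fcont compact_Icc, THEN compact_imp_bounded]
    unfolding bounded_iff by blast
  \<comment> \<open>A second one, of F times the conjugated series of F, gives the integral of the
    squared modulus.\<close>
  have int: "((\<lambda>t. cnj (a k) * (F t * cnj (cis t ^ k))) has_integral cnj (a k) * (2 * pi * a k)) {0..2 * pi}" for k
    by (intro has_integral_mult_right coeff)
  have "((\<lambda>t. \<Sum>k. cnj (a k) * (F t * cnj (cis t ^ k))) has_integral
        (\<Sum>k. cnj (a k) * (2 * pi * a k))) {0..2 * pi}"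
    and sum: "summable (\<lambda>k. cnj (a k) * (2 * pi * a k))"
    by (rule has_integral_series[where M = "\<lambda>k. cmod (a k) * B", OF _ _ _ int];
        use abs in \<open>auto intro!: continuous_intros Fcont summable_mult2 mult_left_mono B
          simp: norm_mult norm_power\<close>)+
  moreover have "(\<Sum>k. cnj (a k) * (F t * cnj (cis t ^ k))) = of_real ((cmod (F t))\<^sup>2)" for t
    using sums_mult2[OF sums_cnj[THEN iffD2, OF Fsums[of t]], of "F t"]
    unfolding complex_norm_square by (simp add: sums_iff mult_ac)
  moreover have summand: "cnj (a k) * (2 * pi * a k) = of_real (2 * pi * (cmod (taylor f k) * \<rho> ^ k)\<^sup>2)" for k
  proof -
    have "cmod (taylor f k) * \<rho> ^ k = cmod (a k)"
      using \<rho> by (simp add: a_def norm_mult norm_power)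
    then show ?thesis
      unfolding of_real_mult by (simp only: complex_norm_square of_real_numeral mult_ac)
  qed
  ultimately have int: "((\<lambda>t. complex_of_real ((cmod (F t))\<^sup>2)) has_integral
      (\<Sum>k. of_real (2 * pi * (cmod (taylor f k) * \<rho> ^ k)\<^sup>2))) {0..2 * pi}"
    by (simp only:)
  have "summable (\<lambda>k. complex_of_real (2 * pi * (cmod (taylor f k) * \<rho> ^ k)\<^sup>2))"
    using sum unfolding summand .
  then have "summable (\<lambda>k. 2 * pi * (cmod (taylor f k) * \<rho> ^ k)\<^sup>2)"
    by (simp only: summable_of_real_iff)
  then show s: "summable (\<lambda>k. (cmod (taylor f k) * \<rho> ^ k)\<^sup>2)"
    by (simp only: summable_cmult_iff) simp
  have "(\<Sum>k. complex_of_real (2 * pi * (cmod (taylor f k) * \<rho> ^ k)\<^sup>2))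
      = of_real (2 * pi * (\<Sum>k. (cmod (taylor f k) * \<rho> ^ k)\<^sup>2))"
    using s by (subst suminf_of_real[symmetric]) (auto simp: suminf_mult)
  then show "((\<lambda>t. (cmod (f (of_real \<rho> * cis t)))\<^sup>2) has_integral
          2 * pi * (\<Sum>k. (cmod (taylor f k) * \<rho> ^ k)\<^sup>2)) {0..2 * pi}"
    using has_integral_Re[OF int] by (simp add: F_def)
qed

lemma hardy2_circle_mean_le:
  assumes "0 \<le> \<rho>" "\<rho> < 1"
  shows "integral {0..2 * pi} (\<lambda>t. (cmod (hfun x (of_real \<rho> * cis t)))\<^sup>2) \<le> 2 * pi * (norm x)\<^sup>2"
proof -
  have "(\<Sum>k. (cmod (hcoeff x k) * \<rho> ^ k)\<^sup>2) \<le> (norm x)\<^sup>2"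
    unfolding norm_hardy2_sq
  proof (rule suminf_le[OF _ circle_Parseval(1)[OF hfun_holomorphic assms] summable_hcoeff])
    show "(cmod (hcoeff x k) * \<rho> ^ k)\<^sup>2 \<le> (cmod (hcoeff x k))\<^sup>2" for k
      using assms by (intro power_mono mult_left_le) (auto simp: power_le_one)
  qed
  then show ?thesis
    using circle_Parseval(2)[OF hfun_holomorphic assms, of x] by (simp add: has_integral_iff)
qed

text \<open>
  In finitely many terms of Parseval's identity the radius may tend to 1.
\<close>

lemma sum_coeffs_le_circle_means:
  assumes f: "\<And>n. n < N \<Longrightarrow> f n holomorphic_on ball 0 1"
    and B: "\<And>\<rho>. 0 < \<rho> \<Longrightarrow> \<rho> < 1 \<Longrightarrow>
      (\<Sum>n<N. integral {0..2 * pi} (\<lambda>t. (cmod (f n (of_real \<rho> * cis t)))\<^sup>2)) \<le> 2 * pi * B"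
  shows "(\<Sum>n<N. \<Sum>k<K. (cmod (taylor (f n) k))\<^sup>2) \<le> B"
proof (rule tendsto_upperbound)
  show "((\<lambda>\<rho>. \<Sum>n<N. \<Sum>k<K. (cmod (taylor (f n) k) * \<rho> ^ k)\<^sup>2)
      \<longlongrightarrow> (\<Sum>n<N. \<Sum>k<K. (cmod (taylor (f n) k))\<^sup>2)) (at_left 1)"
    by (auto intro!: tendsto_eq_intros)
  have "(\<Sum>n<N. \<Sum>k<K. (cmod (taylor (f n) k) * \<rho> ^ k)\<^sup>2) \<le> B" if \<rho>: "0 < \<rho>" "\<rho> < 1" for \<rho>
  proof -
    have "2 * pi * (\<Sum>n<N. \<Sum>k<K. (cmod (taylor (f n) k) * \<rho> ^ k)\<^sup>2)
        \<le> (\<Sum>n<N. 2 * pi * (\<Sum>k. (cmod (taylor (f n) k) * \<rho> ^ k)\<^sup>2))"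
      unfolding sum_distrib_left[symmetric]
      by (intro mult_left_mono sum_mono sum_le_suminf circle_Parseval(1)[OF f]) (use \<rho> in auto)
    also have "\<dots> = (\<Sum>n<N. integral {0..2 * pi} (\<lambda>t. (cmod (f n (of_real \<rho> * cis t)))\<^sup>2))"
      using circle_Parseval(2)[OF f, of _ \<rho>] \<rho> by (simp add: has_integral_iff)
    also have "\<dots> \<le> 2 * pi * B" using \<rho> by (rule B)
    finally show ?thesis by simp
  qed
  then show "\<forall>\<^sub>F \<rho> in at_left 1. (\<Sum>n<N. \<Sum>k<K. (cmod (taylor (f n) k) * \<rho> ^ k)\<^sup>2) \<le> B"
    by (intro eventually_at_leftI[of 0]) auto
qed auto

lemma coeffs_le_circle_means:
  assumes f: "f holomorphic_on ball 0 1"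
    and B: "\<And>\<rho>. 0 < \<rho> \<Longrightarrow> \<rho> < 1 \<Longrightarrow>
      integral {0..2 * pi} (\<lambda>t. (cmod (f (of_real \<rho> * cis t)))\<^sup>2) \<le> 2 * pi * B"
  shows "summable (\<lambda>k. (cmod (taylor f k))\<^sup>2)" "(\<Sum>k. (cmod (taylor f k))\<^sup>2) \<le> B"
proof -
  have le: "(\<Sum>k<K. (cmod (taylor f k))\<^sup>2) \<le> B" for K
    using sum_coeffs_le_circle_means[of "Suc 0" "\<lambda>_. f" B K] assms by simp
  show s: "summable (\<lambda>k. (cmod (taylor f k))\<^sup>2)"
    by (rule summableI_nonneg_bounded[OF _ le]) simp
  show "(\<Sum>k. (cmod (taylor f k))\<^sup>2) \<le> B"
    by (rule suminf_le_const[OF s le])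
qed

lemma circle_integrable:
  assumes "f holomorphic_on ball 0 1" "0 \<le> \<rho>" "\<rho> < 1"
  shows "(\<lambda>t. (cmod (f (of_real \<rho> * cis t)))\<^sup>2) integrable_on {0..2 * pi}"
  using circle_Parseval(2)[OF assms] by (rule has_integral_integrable)

text \<open>
  The substitute for a comparison of boundary values: an inequality inside the disk holds on
  every circle, so it passes to the circle means and, as the radius tends to 1, to the
  norms.
\<close>

lemma sum_norm_le_of_pointwise_le:
  fixes x :: "nat \<Rightarrow> hardy2"
  assumes le: "\<And>z. z \<in> ball 0 1 \<Longrightarrow> (\<Sum>n<N. (cmod (hfun (x n) z))\<^sup>2) \<le> (cmod (hfun y z))\<^sup>2"
  shows "(\<Sum>n<N. (norm (x n))\<^sup>2) \<le> (norm y)\<^sup>2"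
proof -
  have "(\<Sum>n<N. \<Sum>k<K. (cmod (hcoeff (x n) k))\<^sup>2) \<le> (norm y)\<^sup>2" for K
  proof (rule sum_coeffs_le_circle_means[OF hfun_holomorphic])
    fix \<rho> :: real assume \<rho>: "0 < \<rho>" "\<rho> < 1"
    have int: "(\<lambda>t. (cmod (hfun u (of_real \<rho> * cis t)))\<^sup>2) integrable_on {0..2 * pi}" for u
      using \<rho> by (intro circle_integrable hfun_holomorphic) auto
    have "(\<Sum>n<N. integral {0..2 * pi} (\<lambda>t. (cmod (hfun (x n) (of_real \<rho> * cis t)))\<^sup>2))
        = integral {0..2 * pi} (\<lambda>t. \<Sum>n<N. (cmod (hfun (x n) (of_real \<rho> * cis t)))\<^sup>2)"
      by (rule integral_sum[symmetric]) (auto intro: int)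
    also have "\<dots> \<le> integral {0..2 * pi} (\<lambda>t. (cmod (hfun y (of_real \<rho> * cis t)))\<^sup>2)"
      using \<rho> by (intro integral_le le integrable_sum int) (auto simp: norm_mult)
    also have "\<dots> \<le> 2 * pi * (norm y)\<^sup>2"
      using \<rho> by (intro hardy2_circle_mean_le) auto
    finally show "(\<Sum>n<N. integral {0..2 * pi} (\<lambda>t. (cmod (hfun (x n) (of_real \<rho> * cis t)))\<^sup>2))
        \<le> 2 * pi * (norm y)\<^sup>2" .
  qed
  moreover have "(\<lambda>K. \<Sum>n<N. \<Sum>k<K. (cmod (hcoeff (x n) k))\<^sup>2) \<longlonglongrightarrow> (\<Sum>n<N. (norm (x n))\<^sup>2)"
    unfolding norm_hardy2_sq by (intro tendsto_sum summable_LIMSEQ summable_hcoeff)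
  ultimately show ?thesis by (intro LIMSEQ_le_const2) auto
qed

lemma norm_le_of_pointwise_le:
  assumes "\<And>z. z \<in> ball 0 1 \<Longrightarrow> cmod (hfun x z) \<le> cmod (hfun y z)"
  shows "norm x \<le> norm y"
  using sum_norm_le_of_pointwise_le[where N = "Suc 0" and x = "\<lambda>_. x" and y = y] assms
  by (auto simp: power_mono intro: power2_le_imp_le)

lemma Hinf_holomorphic: "f \<in> Hinf \<Longrightarrow> f holomorphic_on ball 0 1"
  by (simp add: Hinf_def)

lemma Hinf_bound:
  assumes "f \<in> Hinf"
  obtains C where "C \<ge> 0" "\<And>z. z \<in> ball 0 1 \<Longrightarrow> cmod (f z) \<le> C"
proof -
  obtain C where C: "\<And>z. z \<in> ball 0 1 \<Longrightarrow> cmod (f z) \<le> C"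
    using assms unfolding Hinf_def bounded_iff by blast
  have "cmod (f 0) \<le> C" by (rule C) simp
  then have "C \<ge> 0" using norm_ge_zero order_trans by blast
  then show thesis using C that by blast
qed

lemma multiplier_product_exists:
  assumes f: "f \<in> Hinf"
  shows "\<exists>k. \<forall>z\<in>ball 0 1. hfun k z = f z * hfun x z"
proof -
  obtain C where C: "C \<ge> 0" "\<And>z. z \<in> ball 0 1 \<Longrightarrow> cmod (f z) \<le> C"
    using Hinf_bound[OF f] by blast
  define k where "k z = f z * hfun x z" for z
  have hol: "k holomorphic_on ball 0 1"
    unfolding k_def by (intro holomorphic_on_mult Hinf_holomorphic f hfun_holomorphic)
  have "summable (\<lambda>n. (cmod (taylor k n))\<^sup>2)"
  proof (rule coeffs_le_circle_means(1)[OF hol])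
    fix \<rho> :: real assume \<rho>: "0 < \<rho>" "\<rho> < 1"
    have "(cmod (k z))\<^sup>2 \<le> (cmod (hfun (scaleC (of_real C) x) z))\<^sup>2" if "z \<in> ball 0 1" for z
      unfolding k_def using C that by (simp add: norm_mult power_mono mult_right_mono)
    then have "integral {0..2 * pi} (\<lambda>t. (cmod (k (of_real \<rho> * cis t)))\<^sup>2)
        \<le> integral {0..2 * pi} (\<lambda>t. (cmod (hfun (scaleC (of_real C) x) (of_real \<rho> * cis t)))\<^sup>2)"
      using \<rho> by (intro integral_le circle_integrable hol hfun_holomorphic) (auto simp: norm_mult)
    also have "\<dots> \<le> 2 * pi * (norm (scaleC (of_real C) x))\<^sup>2"
      using \<rho> by (intro hardy2_circle_mean_le) auto
    finally show "integral {0..2 * pi} (\<lambda>t. (cmod (k (of_real \<rho> * cis t)))\<^sup>2)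
        \<le> 2 * pi * (norm (scaleC (of_real C) x))\<^sup>2" .
  qed
  moreover have "k z = 0" if "z \<notin> ball 0 1" for z
    using in_hardy2_hfun[of x] that unfolding in_hardy2_def k_def by simp
  ultimately have "in_hardy2 k" using hol by (simp add: in_hardy2_def)
  then have "hfun (Abs_hardy2 k) z = f z * hfun x z" for z
    by (simp add: Abs_hardy2_inverse k_def)
  then show ?thesis by blast
qed

lemma hfun_mult_op [simp]:
  assumes f: "f \<in> Hinf" and z: "z \<in> ball 0 1"
  shows "hfun (mult_op f x) z = f z * hfun x z"
proof -
  obtain k where k: "\<forall>z\<in>ball 0 1. hfun k z = f z * hfun x z"
    using multiplier_product_exists[OF f] by blast
  have "mult_op f x = k"
    unfolding mult_op_def using k by (intro the_equality) (auto intro: hardy2_eqI)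
  then show ?thesis using k z by blast
qed

lemma mult_op_eqI:
  assumes "f \<in> Hinf" "\<And>z. z \<in> ball 0 1 \<Longrightarrow> f z * hfun x z = hfun y z"
  shows "mult_op f x = y"
  using assms by (intro hardy2_eqI) simp

lemma norm_mult_op_le:
  assumes f: "f \<in> Hinf" and C: "\<And>z. z \<in> ball 0 1 \<Longrightarrow> cmod (f z) \<le> C"
  shows "norm (mult_op f x) \<le> C * norm x"
proof -
  have C0: "C \<ge> 0" using order_trans[OF norm_ge_zero C[of 0]] by simp
  have "norm (mult_op f x) \<le> norm (scaleC (of_real C) x)"
    using f C C0 by (intro norm_le_of_pointwise_le) (simp add: norm_mult mult_right_mono)
  then show ?thesis using C0 by simp
qed

lemma mult_op_add: "f \<in> Hinf \<Longrightarrow> mult_op f (x + y) = mult_op f x + mult_op f y"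
  by (rule mult_op_eqI) (auto simp: algebra_simps)

lemma mult_op_scaleC: "f \<in> Hinf \<Longrightarrow> mult_op f (scaleC c x) = scaleC c (mult_op f x)"
  by (rule mult_op_eqI) (auto simp: algebra_simps)

lemma mult_op_bounded_operator:
  assumes f: "f \<in> Hinf"
  shows "mult_op f \<in> bounded_operators"
proof -
  obtain C where "\<And>z. z \<in> ball 0 1 \<Longrightarrow> cmod (f z) \<le> C"
    using Hinf_bound[OF f] by blast
  then have "norm (mult_op f x) \<le> norm x * C" for x
    using norm_mult_op_le[OF f] by (simp add: mult.commute)
  then have "bounded_linear (mult_op f)"
    using f by (intro bounded_linear_intro) (auto simp: mult_op_add mult_op_scaleC scaleR_eq_scaleC)
  then show ?thesis
    using f by (simp add: bounded_operators_def mult_op_scaleC)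
qed

lemma tendsto_mult_op:
  assumes "f \<in> Hinf" "(X \<longlongrightarrow> x) F"
  shows "((\<lambda>n. mult_op f (X n)) \<longlongrightarrow> mult_op f x) F"
  using mult_op_bounded_operator[OF assms(1)] assms(2)
  by (auto simp: bounded_operators_def intro: bounded_linear.tendsto)

section \<open>Integrals over the unit circle\<close>

text \<open>
  The increasing limit has a finite integral, hence is finite almost everywhere and
  integrable there. By monotonicity the convergence of the integrals is convergence in mean.
  On the null set where the sequence is unbounded, the value of \<open>v\<close> has no meaning.
\<close>

lemma monotone_convergence_in_mean:
  fixes u :: "nat \<Rightarrow> real \<Rightarrow> real"
  assumes cont: "\<And>n. continuous_on {a..b} (u n)"
    and mono: "\<And>n t. t \<in> {a..b} \<Longrightarrow> u n t \<le> u (Suc n) t"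
    and bound: "\<And>n. integral {a..b} (u n) \<le> B"
  obtains v where "v absolutely_integrable_on {a..b}"
    "(\<lambda>n. integral {a..b} (\<lambda>t. \<bar>v t - u n t\<bar>)) \<longlonglongrightarrow> 0"
proof -
  define M where "M = lebesgue_on {a..b}"
  have int: "integrable M (u n)" for n
    unfolding M_def by (rule continuous_imp_integrable_real) (rule cont)
  note int' = int[unfolded M_def]
  have LI: "integral\<^sup>L M (u n) = integral {a..b} (u n)" for n
    unfolding M_def using int' by (intro lebesgue_integral_eq_integral) auto
  have inc: "incseq (\<lambda>n. u n t)" if "t \<in> {a..b}" for t
    using mono[OF that] by (rule incseq_SucI)
  have space: "space M = {a..b}" by (simp add: M_def)
  have incI: "incseq (\<lambda>n. integral\<^sup>L M (u n))"
    by (intro incseq_SucI integral_mono int) (use mono space in auto)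
  have "convergent (\<lambda>n. integral\<^sup>L M (u n))"
    using incseq_convergent[OF incI, of B] bound LI by (metis convergent_def)
  then obtain I where I: "(\<lambda>n. integral\<^sup>L M (u n)) \<longlonglongrightarrow> I" by (auto simp: convergent_def)
  define f where "f n t = ennreal (u n t - u 0 t)" for n t
  have meas[measurable]: "u n \<in> borel_measurable M" for n using int by auto
  have u0: "u 0 t \<le> u n t" if "t \<in> {a..b}" for n t
    using incseqD[OF inc[OF that], of 0 n] by simp
  have "(\<integral>\<^sup>+t. (SUP n. f n t) \<partial>M) = (SUP n. \<integral>\<^sup>+t. f n t \<partial>M)"
  proof (rule nn_integral_monotone_convergence_SUP_AE)
    show "AE t in M. f n t \<le> f (Suc n) t" for n
      using mono by (intro AE_I2) (auto simp: f_def space intro!: ennreal_leI)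
  qed (simp add: f_def)
  also have "\<dots> \<le> ennreal (B - integral\<^sup>L M (u 0))"
  proof (rule SUP_least)
    fix n
    have "(\<integral>\<^sup>+t. f n t \<partial>M) = ennreal (integral\<^sup>L M (\<lambda>t. u n t - u 0 t))"
      unfolding f_def using u0 int by (intro nn_integral_eq_integral AE_I2) (auto simp: space)
    also have "\<dots> \<le> ennreal (B - integral\<^sup>L M (u 0))"
      using int bound[of n] LI by (intro ennreal_leI) simp
    finally show "(\<integral>\<^sup>+t. f n t \<partial>M) \<le> ennreal (B - integral\<^sup>L M (u 0))" .
  qed
  finally have "(\<integral>\<^sup>+t. (SUP n. f n t) \<partial>M) \<noteq> \<infinity>"
    by (auto simp: top_unique)
  then have AE_fin: "AE t in M. (SUP n. f n t) \<noteq> \<infinity>"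
    by (intro nn_integral_PInf_AE) (auto simp: f_def)
  have conv_at: "convergent (\<lambda>n. u n t)" if t: "t \<in> {a..b}" and fin: "(SUP n. f n t) \<noteq> \<infinity>" for t
  proof -
    have le: "u n t \<le> u 0 t + enn2real (SUP n. f n t)" for n
    proof -
      have "f n t \<le> (SUP n. f n t)" by (rule SUP_upper) simp
      then have "enn2real (f n t) \<le> enn2real (SUP n. f n t)"
        by (intro enn2real_mono) (use fin in \<open>simp_all only: less_top[symmetric] infinity_ennreal_def not_False_eq_True simp_thms\<close>)
      then show ?thesis using u0[OF t] by (simp add: f_def)
    qed
    show ?thesis
      using incseq_convergent[OF inc[OF t]] le by (metis convergent_def)
  qed
  have conv: "AE t in M. convergent (\<lambda>n. u n t)"
    using AE_fin AE_space by eventually_elim (use conv_at space in blast)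
  define v where "v t = lim (\<lambda>n. u n t)" for t
  have lim: "AE t in M. (\<lambda>n. u n t) \<longlonglongrightarrow> v t"
    using conv by eventually_elim (simp add: v_def convergent_LIMSEQ_iff)
  have [measurable]: "v \<in> borel_measurable M" unfolding v_def by measurable
  have AE_inc: "AE t in M. mono (\<lambda>n. u n t)"
    using inc by (intro AE_I2) (auto simp: space)
  have v: "integrable M v" "integral\<^sup>L M v = I"
    using integrable_monotone_convergence[OF int AE_inc lim I]
      integral_monotone_convergence[OF int AE_inc lim I] by auto
  have "integral\<^sup>L M (\<lambda>t. \<bar>v t - u n t\<bar>) = I - integral\<^sup>L M (u n)" for n
  proof -
    have "AE t in M. \<bar>v t - u n t\<bar> = v t - u n t"
      using lim AE_inc by eventually_elim (use incseq_le in \<open>force simp: abs_of_nonneg\<close>)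
    then have "integral\<^sup>L M (\<lambda>t. \<bar>v t - u n t\<bar>) = integral\<^sup>L M (\<lambda>t. v t - u n t)"
      by (intro integral_cong_AE) auto
    then show ?thesis using v int by simp
  qed
  moreover have "integral\<^sup>L M (\<lambda>t. \<bar>v t - u n t\<bar>) = integral {a..b} (\<lambda>t. \<bar>v t - u n t\<bar>)" for n
    using v(1) int[of n] unfolding M_def by (intro lebesgue_integral_eq_integral) auto
  moreover have "(\<lambda>n. I - integral\<^sup>L M (u n)) \<longlonglongrightarrow> I - I"
    by (intro tendsto_intros I)
  ultimately have "(\<lambda>n. integral {a..b} (\<lambda>t. \<bar>v t - u n t\<bar>)) \<longlonglongrightarrow> 0" by simp
  moreover have "v absolutely_integrable_on {a..b}"
    using v(1) unfolding M_def set_integrable_def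
    by (subst (asm) integrable_restrict_space) auto
  ultimately show thesis using that by blast
qed

text \<open>
  As \<open>z * cnj z = 1\<close> on the circle, common powers of \<open>z\<close> cancel in the product. What
  remains is a sum of powers of \<open>z\<close> and of \<open>cnj z\<close>, and the real part does not
  distinguish a term from its conjugate.
\<close>

lemma Re_poly_times_cnj_poly_on_circle:
  "\<exists>s. \<forall>z. cmod z = 1 \<longrightarrow> Re (poly p z * cnj (poly q z)) = Re (poly s z)"
proof (induction p arbitrary: q)
  case 0
  show ?case by (rule exI[of _ 0]) simp
next
  case (pCons a p)
  show ?case
  proof (cases q)
    case (pCons b q')
    obtain s where s: "\<And>z. cmod z = 1 \<Longrightarrow> Re (poly p z * cnj (poly q' z)) = Re (poly s z)"
      using pCons.IH by blast
    show ?thesis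
    proof (intro exI allI impI)
      fix z :: complex assume z: "cmod z = 1"
      have "z * cnj z = 1" using z by (simp add: complex_norm_square[symmetric])
      then have "poly (pCons a p) z * cnj (poly q z)
          = a * cnj (poly q z) + cnj b * (z * poly p z) + poly p z * cnj (poly q' z)"
        unfolding pCons by (simp add: algebra_simps)
      then have "Re (poly (pCons a p) z * cnj (poly q z))
          = Re (a * cnj (poly q z)) + Re (cnj b * (z * poly p z)) + Re (poly s z)"
        using s[OF z] by simp
      also have "Re (a * cnj (poly q z)) = Re (cnj a * poly q z)" by simp
      finally show "Re (poly (pCons a p) z * cnj (poly q z))
          = Re (poly (smult (cnj a) q + smult (cnj b) (pCons 0 p) + s) z)"
        by (simp add: algebra_simps)
    qed
  qed
qed

text \<open>
  A polynomial in the real and the imaginary part of \<open>z\<close> restricts to a trigonometric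
  polynomial on the circle, which is the real part of a holomorphic polynomial.
\<close>

lemma real_polynomial_on_circle:
  assumes "real_polynomial_function (f :: complex \<Rightarrow> real)"
  shows "\<exists>p. \<forall>z. cmod z = 1 \<longrightarrow> f z = Re (poly p z)"
  using assms
proof (induction f)
  case (linear f)
  then have "f z = Re z * f 1 + Im z * f \<i>" for z
  proof -
    have "f z = f (Re z *\<^sub>R 1 + Im z *\<^sub>R \<i>)"
      by (rule arg_cong[of _ _ f]) (simp add: complex_eq_iff)
    also have "\<dots> = Re z * f 1 + Im z * f \<i>"
      using bounded_linear.linear[OF linear] by (simp only: linear_add linear_scale real_scaleR_def)
    finally show ?thesis .
  qed
  then obtain c d where "\<And>z. f z = Re z * c + Im z * d" by blast
  then show ?case
    by (intro exI[of _ "[:0, Complex c (- d):]"]) simp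
next
  case (const c)
  show ?case by (rule exI[of _ "[:of_real c:]"]) simp
next
  case (add f g)
  then obtain p q where "\<And>z. cmod z = 1 \<Longrightarrow> f z = Re (poly p z)" "\<And>z. cmod z = 1 \<Longrightarrow> g z = Re (poly q z)"
    by blast
  then show ?case by (intro exI[of _ "p + q"]) simp
next
  case (mult f g)
  then obtain p q where pq: "\<And>z. cmod z = 1 \<Longrightarrow> f z = Re (poly p z)"
    "\<And>z. cmod z = 1 \<Longrightarrow> g z = Re (poly q z)"
    by blast
  obtain s where s: "\<And>z. cmod z = 1 \<Longrightarrow> Re (poly p z * cnj (poly q z)) = Re (poly s z)"
    using Re_poly_times_cnj_poly_on_circle by blast
  \<comment> \<open>The first product is a polynomial, the second is one up to its imaginary part on the
    circle.\<close>
  have "Re a * Re b = (Re (a * b) + Re (a * cnj b)) / 2" for a b by simp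
  then show ?case
    by (intro exI[of _ "smult (1/2) (p * q + s)"]) (simp add: pq flip: s)
qed

text \<open>
  The normalisation at 0 makes \<open>p\<close> the Herglotz integral of its own real part.
\<close>

lemma trigonometric_approximation:
  fixes f :: "complex \<Rightarrow> real"
  assumes "continuous_on (sphere 0 1) f" "e > 0"
  obtains p where "Im (poly p 0) = 0" "\<And>z. cmod z = 1 \<Longrightarrow> \<bar>f z - Re (poly p z)\<bar> < e"
proof -
  obtain g where g: "real_polynomial_function g" "\<And>z. z \<in> sphere 0 1 \<Longrightarrow> \<bar>f z - g z\<bar> < e"
    using Stone_Weierstrass_real_polynomial_function[OF compact_sphere assms] by metis
  obtain q where "\<And>z. cmod z = 1 \<Longrightarrow> g z = Re (poly q z)"
    using real_polynomial_on_circle[OF g(1)] by blast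
  then show thesis
    using g(2) by (intro that[of "q - [:\<i> * of_real (Im (poly q 0)):]"]) auto
qed

lemma Cauchy_formula_unit_circle:
  fixes G :: "complex \<Rightarrow> complex"
  assumes "G holomorphic_on UNIV" "cmod z < 1"
  shows "((\<lambda>t. cis t / (cis t - z) * G (cis t)) has_integral 2 * pi * G z) {0..2 * pi}"
proof -
  have "((\<lambda>u. G u / (u - z)) has_contour_integral 2 * of_real pi * \<i> * G z) (circlepath 0 1)"
    using assms by (intro Cauchy_integral_circlepath_simple) (auto intro: holomorphic_on_subset)
  then have "((\<lambda>t. G (cis t) / (cis t - z) * \<i> * cis t) has_integral 2 * pi * \<i> * G z) {0..2 * pi}"
    unfolding circlepath_def by (subst (asm) has_contour_integral_part_circlepath_iff) auto
  from has_integral_mult_right[OF this, of "- \<i>"] show ?thesis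
    by (simp add: mult_ac)
qed

text \<open>
  The real part is half the sum of \<open>G\<close> and its conjugate. For \<open>G\<close> the integral is given
  by Cauchy's formula, for the conjugate it is the conjugate of a mean value over the
  circle.
\<close>

lemma Herglotz_integral_Re:
  fixes G :: "complex \<Rightarrow> complex"
  assumes G: "G holomorphic_on UNIV" and z: "cmod z < 1"
  shows "((\<lambda>t. (cis t + z) / (cis t - z) * of_real (Re (G (cis t)))) has_integral
          2 * pi * (G z - \<i> * of_real (Im (G 0)))) {0..2 * pi}"
proof -
  have ne: "cis t - z \<noteq> 0" for t using z by auto
  have mean: "((\<lambda>t. F (cis t)) has_integral 2 * pi * F 0) {0..2 * pi}" if "F holomorphic_on UNIV"
    for F :: "complex \<Rightarrow> complex"
    using Cauchy_formula_unit_circle[OF that, of 0] by simp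
  have ne': "1 - cnj z * w \<noteq> 0" if "cmod w \<le> 1" for w
  proof -
    have "cmod (cnj z * w) < 1"
      using z that mult_right_mono[OF that, of "cmod z"]
      by (simp add: norm_mult mult.commute)
    then show ?thesis by auto
  qed
  have 1: "((\<lambda>t. (cis t + z) / (cis t - z) * G (cis t)) has_integral 2 * pi * (2 * G z - G 0)) {0..2 * pi}"
  proof -
    have "(cis t + z) / (cis t - z) * G (cis t) = 2 * (cis t / (cis t - z) * G (cis t)) - G (cis t)" for t
      using ne[of t] by (simp add: field_simps)
    moreover have "((\<lambda>t. 2 * (cis t / (cis t - z) * G (cis t)) - G (cis t)) has_integral
        2 * (2 * pi * G z) - 2 * pi * G 0) {0..2 * pi}"
      by (intro has_integral_diff has_integral_mult_right Cauchy_formula_unit_circle mean assms)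
    moreover have "2 * (2 * pi * G z) - 2 * pi * G 0 = 2 * pi * (2 * G z - G 0)"
      by (simp add: algebra_simps)
    ultimately show ?thesis by (simp only:)
  qed
  have 2: "((\<lambda>t. (cis t + z) / (cis t - z) * cnj (G (cis t))) has_integral 2 * pi * cnj (G 0)) {0..2 * pi}"
  proof -
    \<comment> \<open>On the circle the conjugate of the kernel is (1 + cnj z w) / (1 - cnj z w), which
      is holomorphic on the closed disk and equals 1 at 0.\<close>
    define K where "K w = (1 + cnj z * w) / (1 - cnj z * w) * G w" for w
    have holK: "K holomorphic_on cball 0 1"
      unfolding K_def using ne' by (auto intro!: holomorphic_intros holomorphic_on_subset[OF G])
    have "((\<lambda>u. K u / (u - 0)) has_contour_integral 2 * of_real pi * \<i> * K 0) (circlepath 0 1)"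
      using holK by (intro Cauchy_integral_circlepath_simple) auto
    then have "((\<lambda>t. K (cis t) / cis t * \<i> * cis t) has_integral 2 * pi * \<i> * K 0) {0..2 * pi}"
      unfolding circlepath_def by (subst (asm) has_contour_integral_part_circlepath_iff) auto
    from has_integral_mult_right[OF this, of "- \<i>"]
    have "((\<lambda>t. K (cis t)) has_integral 2 * pi * K 0) {0..2 * pi}" by (simp add: mult_ac)
    then have "((\<lambda>t. cnj (K (cis t))) has_integral cnj (2 * pi * K 0)) {0..2 * pi}"
      by (rule has_integral_linear[OF _ bounded_linear_cnj, unfolded o_def])
    moreover have "cnj (K (cis t)) = (cis t + z) / (cis t - z) * cnj (G (cis t))" for t
    proof -
      have c: "cnj (cis t) = inverse (cis t)" by (simp only: cis_cnj cis_inverse)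
      have "(1 + z * inverse w) / (1 - z * inverse w) = (w + z) / (w - z)" if "w \<noteq> 0" for w
      proof -
        have "(w + z) / (w - z) = (w * (1 + z * inverse w)) / (w * (1 - z * inverse w))"
          using that by (simp add: distrib_left right_diff_distrib mult.left_commute[of w z])
        then show ?thesis using that by (simp only: mult_divide_mult_cancel_left simp_thms)
      qed
      from this[of "cis t"]
      have "(1 + z * cnj (cis t)) / (1 - z * cnj (cis t)) = (cis t + z) / (cis t - z)"
        unfolding c by simp
      then show ?thesis
        by (simp only: K_def complex_cnj_mult complex_cnj_divide complex_cnj_add complex_cnj_diff
            complex_cnj_one complex_cnj_cnj)
    qed
    ultimately show ?thesis by (simp add: K_def)
  qed
  have Re_eq: "of_real (Re w) = (1/2) * (w + cnj w)" for w by (simp add: complex_add_cnj)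
  have "(cis t + z) / (cis t - z) * of_real (Re (G (cis t)))
      = (1/2) * ((cis t + z) / (cis t - z) * G (cis t) + (cis t + z) / (cis t - z) * cnj (G (cis t)))" for t
    by (simp only: Re_eq distrib_left mult.left_commute)
  moreover have "(1/2) * (2 * pi * (2 * G z - G 0) + 2 * pi * cnj (G 0))
      = 2 * pi * (G z - \<i> * of_real (Im (G 0)))"
    by (simp add: complex_eq_iff algebra_simps)
  ultimately show ?thesis
    using has_integral_mult_right[OF has_integral_add[OF 1 2], of "1/2"] by (simp only:)
qed

section \<open>Outer majorants\<close>

text \<open>
  The exponent of the outer function whose modulus on the circle is \<open>exp \<circ> v\<close>.
\<close>

definition Herglotz :: "(real \<Rightarrow> real) \<Rightarrow> complex \<Rightarrow> complex" where
  "Herglotz v z = 1 / (2 * pi) * integral {0..2 * pi} (\<lambda>t. (cis t + z) / (cis t - z) * of_real (v t))"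

lemma holomorphic_on_poly: "poly p holomorphic_on S" for p :: "complex poly"
  unfolding holomorphic_on_def field_differentiable_def
  using poly_DERIV has_field_derivative_at_within by blast

text \<open>
  The polynomial is the Herglotz integral of its real part, and the kernel is at most \<open>2 /
  (1 - cmod z)\<close> in modulus. Closeness in mean on the circle therefore gives locally uniform
  closeness in the disk.
\<close>

lemma Herglotz_minus_poly_le:
  assumes v: "v absolutely_integrable_on {0..2 * pi}"
    and p: "Im (poly p 0) = 0" and z: "cmod z < 1"
  shows "cmod (Herglotz v z - poly p z)
    \<le> integral {0..2 * pi} (\<lambda>t. \<bar>v t - Re (poly p (cis t))\<bar>) / (pi * (1 - cmod z))"
proof -
  define K where "K t = (cis t + z) / (cis t - z)" for t
  define I where "I = {0..2 * pi}"
  have dist: "1 - cmod z \<le> cmod (cis t - z)" for t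
    using norm_triangle_ineq2[of "cis t" z] by simp
  then have ne: "cis t - z \<noteq> 0" for t using z by (metis diff_gt_0_iff_gt norm_zero not_less)
  have K_le: "cmod (K t) \<le> 2 / (1 - cmod z)" for t
    unfolding K_def norm_divide
    using norm_triangle_ineq[of "cis t" z] dist[of t] z by (intro frac_le) auto
  have K_cont: "continuous_on S K" for S
    unfolding K_def using ne by (auto intro!: continuous_intros)
  have bil: "bilinear (\<lambda>(k::complex) r. k * complex_of_real r)"
    by (auto simp: bilinear_def linear_iff algebra_simps scaleR_conv_of_real)
  have Kv: "(\<lambda>t. K t * of_real (v t)) integrable_on I"
  proof -
    have "(\<lambda>t. K t * of_real (v t)) absolutely_integrable_on I"
      unfolding I_def
    proof (rule absolutely_integrable_bounded_measurable_product[OF bil _ _ _ v])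
      show "K \<in> borel_measurable (lebesgue_on {0..2 * pi})"
        by (rule continuous_imp_measurable_on_sets_lebesgue[OF K_cont]) auto
      show "bounded (K ` {0..2 * pi})" unfolding bounded_iff using K_le by auto
    qed auto
    then show ?thesis by (simp add: absolutely_integrable_on_def)
  qed
  have Kp: "((\<lambda>t. K t * of_real (Re (poly p (cis t)))) has_integral 2 * pi * poly p z) I"
    using Herglotz_integral_Re[OF holomorphic_on_poly z, of p] p by (simp add: K_def I_def)
  have "2 * pi * (Herglotz v z - poly p z) = integral I (\<lambda>t. K t * of_real (v t - Re (poly p (cis t))))"
  proof -
    have "integral I (\<lambda>t. K t * of_real (v t) - K t * of_real (Re (poly p (cis t))))
        = integral I (\<lambda>t. K t * of_real (v t)) - 2 * pi * poly p z"
      using Kp by (subst integral_diff[OF Kv]) (auto simp: has_integral_iff)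
    also have "integral I (\<lambda>t. K t * of_real (v t)) = 2 * pi * Herglotz v z"
      by (simp add: Herglotz_def K_def I_def)
    finally show ?thesis by (simp add: right_diff_distrib)
  qed
  moreover have "cmod (integral I (\<lambda>t. K t * of_real (v t - Re (poly p (cis t)))))
      \<le> integral I (\<lambda>t. 2 / (1 - cmod z) * \<bar>v t - Re (poly p (cis t))\<bar>)"
  proof (rule integral_norm_bound_integral)
    show "(\<lambda>t. K t * of_real (v t - Re (poly p (cis t)))) integrable_on I"
      using integrable_diff[OF Kv has_integral_integrable[OF Kp]] by (simp add: right_diff_distrib)
    have "(\<lambda>t. v t - Re (poly p (cis t))) absolutely_integrable_on I"
      unfolding I_def
      by (intro set_integral_diff(1) v absolutely_integrable_continuous_real continuous_intros)
    then show "(\<lambda>t. 2 / (1 - cmod z) * \<bar>v t - Re (poly p (cis t))\<bar>) integrable_on I"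
      by (intro integrable_on_mult_right) (simp add: absolutely_integrable_on_def)
    show "cmod (K t * of_real (v t - Re (poly p (cis t))))
        \<le> 2 / (1 - cmod z) * \<bar>v t - Re (poly p (cis t))\<bar>" for t
      unfolding norm_mult norm_of_real by (intro mult_right_mono K_le) simp
  qed
  ultimately have "2 * pi * cmod (Herglotz v z - poly p z)
      \<le> 2 / (1 - cmod z) * integral I (\<lambda>t. \<bar>v t - Re (poly p (cis t))\<bar>)"
  proof -
    assume a: "2 * pi * (Herglotz v z - poly p z)
        = integral I (\<lambda>t. K t * of_real (v t - Re (poly p (cis t))))"
      and b: "cmod (integral I (\<lambda>t. K t * of_real (v t - Re (poly p (cis t)))))
        \<le> integral I (\<lambda>t. 2 / (1 - cmod z) * \<bar>v t - Re (poly p (cis t))\<bar>)"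
    have "2 * pi * cmod (Herglotz v z - poly p z) = cmod (2 * pi * (Herglotz v z - poly p z))"
      by (simp add: norm_mult)
    then show ?thesis using b unfolding a by (simp only: integral_mult_right)
  qed
  then show ?thesis using z unfolding I_def by (simp add: field_simps)
qed

text \<open>
  The maximum principle for a vector of holomorphic functions, divided by the zero-free
  function \<open>exp (poly p z)\<close>.
\<close>

lemma sum_squares_le_on_disk:
  fixes Y :: "nat \<Rightarrow> complex \<Rightarrow> complex" and p :: "complex poly"
  assumes Y: "\<And>n. n < M \<Longrightarrow> Y n holomorphic_on UNIV" and C: "C \<ge> 0"
    and le: "\<And>z. cmod z = 1 \<Longrightarrow> (\<Sum>n<M. (cmod (Y n z))\<^sup>2) \<le> (C * cmod (exp (poly p z)))\<^sup>2"
    and z0: "cmod z0 < 1"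
  shows "(\<Sum>n<M. (cmod (Y n z0))\<^sup>2) \<le> (C * cmod (exp (poly p z0)))\<^sup>2"
proof -
  define s where "s = sqrt (\<Sum>n<M. (cmod (Y n z0))\<^sup>2)"
  have s0: "s \<ge> 0" unfolding s_def by (intro real_sqrt_ge_zero sum_nonneg) auto
  have s2: "s\<^sup>2 = (\<Sum>n<M. (cmod (Y n z0))\<^sup>2)" unfolding s_def by (simp add: sum_nonneg)
  \<comment> \<open>Pairing with the value at z0 turns the sum of squares into one holomorphic function.\<close>
  define F where "F z = (\<Sum>n<M. cnj (Y n z0) * Y n z) * exp (- poly p z)" for z
  have F_hol: "F holomorphic_on UNIV"
    unfolding F_def using Y by (auto intro!: holomorphic_intros)
  have "cmod (F z0) \<le> s * C"
  proof (rule maximum_modulus_frontier[where S = "ball 0 1" and f = F and \<xi> = z0])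
    show "F holomorphic_on interior (ball 0 1)" using F_hol by (rule holomorphic_on_subset) auto
    show "continuous_on (closure (ball 0 1)) F"
      using F_hol by (intro holomorphic_on_imp_continuous_on) (auto intro: holomorphic_on_subset)
    show "z0 \<in> ball 0 1" using z0 by simp
    fix z assume "z \<in> frontier (ball (0::complex) 1)"
    then have z: "cmod z = 1" by (simp add: frontier_ball)
    have "cmod (\<Sum>n<M. cnj (Y n z0) * Y n z) \<le> (\<Sum>n<M. cmod (Y n z0) * cmod (Y n z))"
      by (rule order_trans[OF norm_sum]) (simp add: norm_mult)
    also have "\<dots> \<le> s * sqrt (\<Sum>n<M. (cmod (Y n z))\<^sup>2)"
      unfolding s_def real_sqrt_mult[symmetric]
      by (rule real_le_rsqrt) (rule Cauchy_Schwarz_ineq_sum)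
    also have "\<dots> \<le> s * (C * cmod (exp (poly p z)))"
      using le[OF z] C s0 by (intro mult_left_mono real_le_lsqrt) auto
    finally have "cmod (F z) \<le> s * (C * cmod (exp (poly p z))) * cmod (exp (- poly p z))"
      unfolding F_def norm_mult by (rule mult_right_mono) simp
    also have "\<dots> = s * C * cmod (exp (poly p z) * exp (- poly p z))"
      by (simp only: norm_mult mult.assoc)
    finally show "cmod (F z) \<le> s * C" by (simp add: exp_minus)
  qed simp
  moreover have "F z0 = of_real (s\<^sup>2) * exp (- poly p z0)"
  proof -
    have "(\<Sum>n<M. cnj (Y n z0) * Y n z0) = of_real (s\<^sup>2)"
      unfolding s2 of_real_sum complex_norm_square by (simp add: mult.commute)
    then show ?thesis by (simp add: F_def)
  qed
  ultimately have "s\<^sup>2 * cmod (exp (- poly p z0)) \<le> s * C"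
    by (metis abs_power2 norm_mult norm_of_real)
  then have "s\<^sup>2 * cmod (exp (- poly p z0)) * cmod (exp (poly p z0)) \<le> s * C * cmod (exp (poly p z0))"
    by (rule mult_right_mono) simp
  moreover have "cmod (exp (- poly p z0)) * cmod (exp (poly p z0)) = 1"
    by (simp only: norm_mult[symmetric] mult_exp_exp) simp
  ultimately have le2: "s * s \<le> s * (C * cmod (exp (poly p z0)))"
    by (simp add: power2_eq_square mult.assoc)
  have "s \<le> C * cmod (exp (poly p z0))"
  proof (cases "s = 0")
    case True then show ?thesis using C by simp
  next
    case False
    then show ?thesis using le2 s0 by (metis mult_le_cancel_left_pos order_le_less)
  qed
  then show ?thesis unfolding s2[symmetric] using s0 by (intro power_mono)
qed

lemma poly_circle_mean:
  fixes c :: "nat \<Rightarrow> complex"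
  shows "((\<lambda>t. (cmod (\<Sum>k<K. c k * cis t ^ k))\<^sup>2) has_integral 2 * pi * (\<Sum>k<K. (cmod (c k))\<^sup>2)) {0..2 * pi}"
proof -
  define f where "f z = (\<Sum>k<K. c k * z ^ k)" for z
  have sums: "(\<lambda>n. (if n < K then c n else 0) * z ^ n) sums f z" for z
    using sums_finite[of "{..<K}" "\<lambda>n. (if n < K then c n else 0) * z ^ n"] by (simp add: f_def)
  have tay: "taylor f n = (if n < K then c n else 0)" for n
    by (rule taylor_unique(2)) (rule sums)
  have "f holomorphic_on ball 0 2" unfolding f_def by (intro holomorphic_intros)
  from circle_Parseval(2)[OF this, of 1]
  have "((\<lambda>t. (cmod (f (cis t)))\<^sup>2) has_integral 2 * pi * (\<Sum>k. (cmod (taylor f k))\<^sup>2)) {0..2 * pi}"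
    by simp
  also have "(\<Sum>k. (cmod (taylor f k))\<^sup>2) = (\<Sum>k<K. (cmod (c k))\<^sup>2)"
    by (subst suminf_finite[of "{..<K}"]) (auto simp: tay)
  finally show ?thesis by (simp add: f_def)
qed

text \<open>
  By Parseval's identity the circle means of a squared modulus increase with the radius.
\<close>

lemma exp_poly_circle_mean_le:
  fixes p :: "complex poly"
  assumes \<rho>: "0 \<le> \<rho>" "\<rho> < 1"
  shows "integral {0..2 * pi} (\<lambda>t. (cmod (exp (poly p (of_real \<rho> * cis t))))\<^sup>2)
    \<le> integral {0..2 * pi} (\<lambda>t. (cmod (exp (poly p (cis t))))\<^sup>2)"
proof -
  define f where "f z = exp (poly p z)" for z
  have hol: "f holomorphic_on ball 0 2" unfolding f_def by (intro holomorphic_intros)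
  have "(\<Sum>k. (cmod (taylor f k) * \<rho> ^ k)\<^sup>2) \<le> (\<Sum>k. (cmod (taylor f k) * 1 ^ k)\<^sup>2)"
    using \<rho> circle_Parseval(1)[OF hol, of \<rho>] circle_Parseval(1)[OF hol, of 1]
    by (intro suminf_le power_mono mult_left_mono) (auto simp: power_le_one)
  then show ?thesis
    using circle_Parseval(2)[OF hol, of \<rho>] circle_Parseval(2)[OF hol, of 1] \<rho>
    by (simp add: has_integral_iff f_def)
qed

lemma norm_add_sq_le:
  assumes "e > 0"
  shows "(cmod (x + y))\<^sup>2 \<le> (1 + e) * (cmod x)\<^sup>2 + (1 + 1 / e) * (cmod y)\<^sup>2"
proof -
  have "0 \<le> (e * cmod x - cmod y)\<^sup>2 / e" using assms by simp
  also have "\<dots> = e * (cmod x)\<^sup>2 + (cmod y)\<^sup>2 / e - 2 * cmod x * cmod y"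
    using assms by (simp add: power2_eq_square field_simps)
  finally have "2 * cmod x * cmod y \<le> e * (cmod x)\<^sup>2 + (cmod y)\<^sup>2 / e" by simp
  moreover have "(cmod (x + y))\<^sup>2 \<le> (cmod x + cmod y)\<^sup>2"
    by (intro power_mono norm_triangle_ineq) auto
  ultimately show ?thesis by (simp add: power2_sum algebra_simps)
qed

text \<open>
  The truncated square sums need not increase with the order \<open>N J\<close> of the truncation. They
  are replaced by weights that do: by the inequality \<open>norm_add_sq_le\<close>, the old weight
  times \<open>1 + \<epsilon>\<close> plus the square sum of the new part times \<open>1 + 1 / \<epsilon>\<close>
  dominates the new square sum. With \<open>\<epsilon>\<close> summable along the steps, and the
  truncations chosen so late that the new parts are tiny even after this amplification, the
  means exceed the total square sum \<open>S\<close> by at most \<open>\<delta>\<close>.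
\<close>

lemma increasing_weights:
  fixes a :: "nat \<Rightarrow> nat \<Rightarrow> complex"
  assumes bound: "\<And>N. (\<Sum>n<N. \<Sum>k<N. (cmod (a n k))\<^sup>2) \<le> S" and \<delta>: "\<delta> > 0"
  obtains N :: "nat \<Rightarrow> nat" and W :: "nat \<Rightarrow> complex \<Rightarrow> real"
  where "strict_mono N" "\<And>J. continuous_on UNIV (W J)" "\<And>J z. \<delta> / 2 \<le> W J z"
    "\<And>J z. W J z \<le> W (Suc J) z"
    "\<And>J. integral {0..2 * pi} (\<lambda>t. W J (cis t)) \<le> 2 * pi * (S + \<delta>)"
    "\<And>J z. (\<Sum>n<N J. (cmod (\<Sum>k<N J. a n k * z ^ k))\<^sup>2) \<le> W J z"
proof -
  define T where "T N = (\<Sum>n<N. \<Sum>k<N. (cmod (a n k))\<^sup>2)" for N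
  have S0: "0 \<le> S" using bound[of 0] by simp
  \<comment> \<open>Step J may raise the mean by \<open>\<delta> / 2 ^ (J + 2)\<close>: one half of this pays for
    the factor \<open>1 + \<epsilon> J\<close> on the old weight, whose mean is at most \<open>S +
    \<delta>\<close>, the other half for the new coefficients, whose square sum is at most
    \<open>\<theta> J\<close>.\<close>
  define \<epsilon> where "\<epsilon> J = (\<delta> / 2 ^ (J + 3)) / (S + \<delta>)" for J
  have \<epsilon>: "\<epsilon> J > 0" for J unfolding \<epsilon>_def using \<delta> S0 by simp
  define \<theta> where "\<theta> J = (\<delta> / 2 ^ (J + 3)) / (1 + 1 / \<epsilon> J)" for J
  have \<theta>: "\<theta> J > 0" for J
    unfolding \<theta>_def using \<delta> \<epsilon>[of J] by (intro divide_pos_pos) (auto intro: add_pos_pos)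
  have T_mono: "T M \<le> T N" if "M \<le> N" for M N
  proof -
    have "T M \<le> (\<Sum>n<M. \<Sum>k<N. (cmod (a n k))\<^sup>2)"
      unfolding T_def using that by (intro sum_mono sum_mono2) auto
    also have "\<dots> \<le> T N" unfolding T_def using that by (intro sum_mono2 sum_nonneg) auto
    finally show ?thesis .
  qed
  obtain L where L: "T \<longlonglongrightarrow> L" "\<And>N. T N \<le> L"
    using incseq_convergent[of T S] T_mono bound by (metis T_def incseq_def)
  have "\<exists>M. \<forall>N\<ge>M. L - \<theta> J < T N" for J
    using order_tendstoD(1)[OF L(1), of "L - \<theta> J"] \<theta>[of J] by (simp add: eventually_sequentially)
  then obtain M where M: "\<And>J N. N \<ge> M J \<Longrightarrow> L - \<theta> J < T N" by metis
  \<comment> \<open>Beyond \<open>M J\<close> less than \<open>\<theta> J\<close> of the total square sum is left; the sum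
    makes N increasing.\<close>
  define N where "N J = J + (\<Sum>i\<le>J. M i)" for J
  have N_mono: "strict_mono N" by (rule strict_mono_Suc_iff[THEN iffD2]) (simp add: N_def)
  have NS: "N J \<le> N (Suc J)" for J by (simp add: N_def)
  have MN: "M J \<le> N J" for J
    unfolding N_def using member_le_sum[of J "{..J}" M] by simp
  have d: "T (N (Suc J)) - T (N J) \<le> \<theta> J" for J
    using L(2)[of "N (Suc J)"] M[OF MN, of J] by linarith
  \<comment> \<open>Masking makes the coefficients of stage J + 1 the old ones plus terms with disjoint
    support.\<close>
  define c where "c J n k = (if n < N J \<and> k < N J then a n k else 0)" for J n k
  define q where "q J z = (\<Sum>n<N J. (cmod (\<Sum>k<N J. a n k * z ^ k))\<^sup>2)" for J z
  define D where "D J z = (\<Sum>n<N (Suc J). (cmod (\<Sum>k<N (Suc J). (c (Suc J) n k - c J n k) * z ^ k))\<^sup>2)" for J z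
  define W where "W = rec_nat (\<lambda>z. \<delta> / 2 + q 0 z) (\<lambda>J w z. (1 + \<epsilon> J) * w z + (1 + 1 / \<epsilon> J) * D J z)"
  have W0: "W 0 z = \<delta> / 2 + q 0 z" for z by (simp add: W_def)
  have WS: "W (Suc J) z = (1 + \<epsilon> J) * W J z + (1 + 1 / \<epsilon> J) * D J z" for J z by (simp add: W_def)
  have q0: "q J z \<ge> 0" and D0: "D J z \<ge> 0" for J z
    by (auto simp: q_def D_def intro!: sum_nonneg)
  have inner: "(\<Sum>k<N (Suc J). c J n k * z ^ k) = (if n < N J then \<Sum>k<N J. a n k * z ^ k else 0)" for J n z
  proof -
    have "(\<Sum>k<N (Suc J). c J n k * z ^ k) = (\<Sum>k<N J. c J n k * z ^ k)"
      using NS[of J] by (intro sum.mono_neutral_right) (auto simp: c_def)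
    then show ?thesis by (simp add: c_def)
  qed
  have q_step: "q (Suc J) z \<le> (1 + \<epsilon> J) * q J z + (1 + 1 / \<epsilon> J) * D J z" for J z
  proof -
    have "q (Suc J) z = (\<Sum>n<N (Suc J). (cmod ((\<Sum>k<N (Suc J). c J n k * z ^ k)
        + (\<Sum>k<N (Suc J). (c (Suc J) n k - c J n k) * z ^ k)))\<^sup>2)"
      unfolding q_def sum.distrib[symmetric] by (simp add: c_def algebra_simps)
    also have "\<dots> \<le> (\<Sum>n<N (Suc J). (1 + \<epsilon> J) * (cmod (\<Sum>k<N (Suc J). c J n k * z ^ k))\<^sup>2
        + (1 + 1 / \<epsilon> J) * (cmod (\<Sum>k<N (Suc J). (c (Suc J) n k - c J n k) * z ^ k))\<^sup>2)"
      by (intro sum_mono norm_add_sq_le \<epsilon>)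
    also have "\<dots> = (1 + \<epsilon> J) * (\<Sum>n<N (Suc J). (cmod (\<Sum>k<N (Suc J). c J n k * z ^ k))\<^sup>2)
        + (1 + 1 / \<epsilon> J) * D J z"
      by (simp add: sum.distrib sum_distrib_left D_def)
    also have "(\<Sum>n<N (Suc J). (cmod (\<Sum>k<N (Suc J). c J n k * z ^ k))\<^sup>2) = q J z"
      unfolding inner q_def using NS[of J] by (intro sum.mono_neutral_cong_right) auto
    finally show ?thesis .
  qed
  have qW: "q J z \<le> W J z" for J z
  proof (induction J)
    case 0 show ?case using \<delta> by (simp add: W0)
  next
    case (Suc J)
    have "(1 + \<epsilon> J) * q J z \<le> (1 + \<epsilon> J) * W J z"
      using Suc \<epsilon>[of J] by (intro mult_left_mono) auto
    then show ?case using q_step[of J z] by (simp add: WS)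
  qed
  have W_step: "W J z \<le> W (Suc J) z" if "\<delta> / 2 \<le> W J z" for J z
  proof -
    have "0 \<le> \<epsilon> J * W J z" "0 \<le> (1 + 1 / \<epsilon> J) * D J z"
      using \<epsilon>[of J] D0[of J z] \<delta> that by (auto intro!: mult_nonneg_nonneg add_nonneg_nonneg)
    then show ?thesis unfolding WS distrib_right[of 1 "\<epsilon> J"] by linarith
  qed
  have W_ge: "\<delta> / 2 \<le> W J z" for J z
  proof (induction J)
    case 0 show ?case using q0[of 0 z] by (simp add: W0)
  next
    case (Suc J) then show ?case using W_step[of J z] by linarith
  qed
  have D_int: "((\<lambda>t. D J (cis t)) has_integral 2 * pi * (T (N (Suc J)) - T (N J))) {0..2 * pi}" for J
  proof -
    have "((\<lambda>t. D J (cis t)) has_integral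
        (\<Sum>n<N (Suc J). 2 * pi * (\<Sum>k<N (Suc J). (cmod (c (Suc J) n k - c J n k))\<^sup>2))) {0..2 * pi}"
      unfolding D_def by (intro has_integral_sum poly_circle_mean) auto
    also have "(\<Sum>n<N (Suc J). 2 * pi * (\<Sum>k<N (Suc J). (cmod (c (Suc J) n k - c J n k))\<^sup>2))
        = 2 * pi * ((\<Sum>n<N (Suc J). \<Sum>k<N (Suc J). (cmod (c (Suc J) n k))\<^sup>2)
            - (\<Sum>n<N (Suc J). \<Sum>k<N (Suc J). (cmod (c J n k))\<^sup>2))"
    proof -
      have "(cmod (c (Suc J) n k - c J n k))\<^sup>2 = (cmod (c (Suc J) n k))\<^sup>2 - (cmod (c J n k))\<^sup>2" for n k
        using NS[of J] by (auto simp: c_def)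
      then show ?thesis by (simp only: sum_subtractf sum_distrib_left[symmetric])
    qed
    also have "(\<Sum>n<N (Suc J). \<Sum>k<N (Suc J). (cmod (c (Suc J) n k))\<^sup>2) = T (N (Suc J))"
      unfolding T_def by (simp add: c_def)
    also have "(\<Sum>n<N (Suc J). \<Sum>k<N (Suc J). (cmod (c J n k))\<^sup>2) = T (N J)"
    proof -
      have "(\<Sum>k<N (Suc J). (cmod (c J n k))\<^sup>2) = (if n < N J then \<Sum>k<N J. (cmod (a n k))\<^sup>2 else 0)" for n
      proof -
        have "(\<Sum>k<N (Suc J). (cmod (c J n k))\<^sup>2) = (\<Sum>k<N J. (cmod (c J n k))\<^sup>2)"
          using NS[of J] by (intro sum.mono_neutral_right) (auto simp: c_def)
        then show ?thesis by (simp add: c_def)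
      qed
      then show ?thesis
        unfolding T_def using NS[of J]
        by (auto intro!: sum.mono_neutral_cong_right split: if_splits)
    qed
    finally show ?thesis .
  qed
  have q_int: "((\<lambda>t. q 0 (cis t)) has_integral 2 * pi * T (N 0)) {0..2 * pi}"
    unfolding q_def T_def sum_distrib_left[of "2 * pi"]
    by (intro has_integral_sum) (use poly_circle_mean in \<open>auto simp: sum_distrib_left\<close>)
  have W_int: "\<exists>I. ((\<lambda>t. W J (cis t)) has_integral 2 * pi * I) {0..2 * pi} \<and> I \<le> S + \<delta> - \<delta> / 2 ^ (J + 1)" for J
  proof (induction J)
    case 0
    have "((\<lambda>t. \<delta> / 2 + q 0 (cis t)) has_integral (2 * pi - 0) *\<^sub>R (\<delta> / 2) + 2 * pi * T (N 0)) {0..2 * pi}"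
      by (intro has_integral_add q_int) (use has_integral_const_real[of "\<delta> / 2" 0 "2 * pi"] in simp)
    then have "((\<lambda>t. W 0 (cis t)) has_integral 2 * pi * (\<delta> / 2 + T (N 0))) {0..2 * pi}"
      by (simp add: W0 algebra_simps)
    moreover have "\<delta> / 2 + T (N 0) \<le> S + \<delta> - \<delta> / 2 ^ (0 + 1)"
      using bound[of "N 0"] by (simp add: T_def)
    ultimately show ?case by blast
  next
    case (Suc J)
    then obtain I where I: "((\<lambda>t. W J (cis t)) has_integral 2 * pi * I) {0..2 * pi}"
      "I \<le> S + \<delta> - \<delta> / 2 ^ (J + 1)" by blast
    define I' where "I' = (1 + \<epsilon> J) * I + (1 + 1 / \<epsilon> J) * (T (N (Suc J)) - T (N J))"
    have "((\<lambda>t. W (Suc J) (cis t)) has_integral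
        (1 + \<epsilon> J) * (2 * pi * I) + (1 + 1 / \<epsilon> J) * (2 * pi * (T (N (Suc J)) - T (N J)))) {0..2 * pi}"
      unfolding WS by (intro has_integral_add has_integral_mult_right I D_int)
    also have "(1 + \<epsilon> J) * (2 * pi * I) + (1 + 1 / \<epsilon> J) * (2 * pi * (T (N (Suc J)) - T (N J))) = 2 * pi * I'"
      by (simp add: I'_def algebra_simps)
    finally have int: "((\<lambda>t. W (Suc J) (cis t)) has_integral 2 * pi * I') {0..2 * pi}" .
    have "\<epsilon> J * I \<le> \<epsilon> J * (S + \<delta>)"
      using I(2) \<epsilon>[of J] \<delta> by (intro mult_left_mono) (auto intro: order_trans)
    also have "\<dots> = \<delta> / 2 ^ (J + 3)" using \<delta> S0 by (simp add: \<epsilon>_def)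
    finally have 1: "\<epsilon> J * I \<le> \<delta> / 2 ^ (J + 3)" .
    have pos: "1 + 1 / \<epsilon> J > 0" using \<epsilon>[of J] by (simp add: add_pos_pos)
    have "(1 + 1 / \<epsilon> J) * (T (N (Suc J)) - T (N J)) \<le> (1 + 1 / \<epsilon> J) * \<theta> J"
      using pos d[of J] by (intro mult_left_mono) auto
    also have "\<dots> = \<delta> / 2 ^ (J + 3)" using pos by (simp add: \<theta>_def)
    finally have "I' \<le> I + \<delta> / 2 ^ (J + 3) + \<delta> / 2 ^ (J + 3)"
      using 1 by (simp add: I'_def distrib_right)
    also have "\<dots> \<le> S + \<delta> - \<delta> / 2 ^ (Suc J + 1)"
    proof -
      define x where "x = \<delta> / 2 ^ J"
      have x: "\<delta> / 2 ^ (J + 1) = x / 2" "\<delta> / 2 ^ (J + 3) = x / 8"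
        "\<delta> / 2 ^ (Suc J + 1) = x / 4"
        by (simp_all add: x_def power_add)
      show ?thesis using I(2) unfolding x by linarith
    qed
    finally show ?case using int by blast
  qed
  show thesis
  proof (rule that[OF N_mono])
    show "continuous_on UNIV (W J)" for J
    proof (induction J)
      case 0
      show ?case unfolding W0[abs_def] q_def by (intro continuous_intros)
    next
      case (Suc J)
      then show ?case unfolding WS[abs_def] D_def by (intro continuous_intros)
    qed
    show "integral {0..2 * pi} (\<lambda>t. W J (cis t)) \<le> 2 * pi * (S + \<delta>)" for J
    proof -
      obtain I where I: "((\<lambda>t. W J (cis t)) has_integral 2 * pi * I) {0..2 * pi}"
        "I \<le> S + \<delta> - \<delta> / 2 ^ (J + 1)" using W_int by blast
      then have "I \<le> S + \<delta>" using \<delta> by (smt (verit) zero_less_divide_iff zero_less_power)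
      then show ?thesis using I(1) by (simp add: has_integral_iff)
    qed
    show "\<delta> / 2 \<le> W J z" for J z by (rule W_ge)
    show "W J z \<le> W (Suc J) z" for J z by (rule W_step[OF W_ge])
    show "(\<Sum>n<N J. (cmod (\<Sum>k<N J. a n k * z ^ k))\<^sup>2) \<le> W J z" for J z
      using qW[of J z] by (simp only: q_def)
  qed
qed

text \<open>
  The weight with the density \<open>\<Sum>n. (cmod (X n))\<^sup>2\<close> on the circle is dominated
  by that of a single outer function \<open>h\<close>, at an arbitrarily small cost in total mass. The
  modulus of \<open>h\<close> on the circle is the square root of the limit of the weights from
  \<open>increasing_weights\<close>, which exists almost everywhere. Boundary values are avoided: half
  the logarithm of each weight is uniformly close to the real part of a polynomial \<open>p J\<close>,
  so that \<open>exp (p J)\<close> has both required properties up to a factor tending to 1. The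
  domination holds by the maximum principle, the norm estimate by Parseval's identity, and
  both are inherited by \<open>h\<close>, to which \<open>exp (p J)\<close> converges since the logarithms
  converge in mean.
\<close>

theorem outer_majorant:
  fixes X :: "nat \<Rightarrow> hardy2"
  assumes X: "square_summable X" and \<delta>: "\<delta> > 0"
  obtains h where "outer h"
    "\<And>z N. z \<in> ball 0 1 \<Longrightarrow> (\<Sum>n<N. (cmod (hfun (X n) z))\<^sup>2) \<le> (cmod (hfun h z))\<^sup>2"
    "(norm h)\<^sup>2 \<le> (\<Sum>n. (norm (X n))\<^sup>2) + \<delta>"
proof -
  define S where "S = (\<Sum>n. (norm (X n))\<^sup>2)"
  define a where "a n k = hcoeff (X n) k" for n k
  have bound: "(\<Sum>n<N. \<Sum>k<N. (cmod (a n k))\<^sup>2) \<le> S" for N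
  proof -
    have "(\<Sum>n<N. \<Sum>k<N. (cmod (a n k))\<^sup>2) \<le> (\<Sum>n<N. (norm (X n))\<^sup>2)"
      unfolding norm_hardy2_sq a_def by (intro sum_mono sum_le_suminf summable_hcoeff) auto
    also have "\<dots> \<le> S"
      using X unfolding S_def square_summable_def by (intro sum_le_suminf) auto
    finally show ?thesis .
  qed
  obtain N W where N: "strict_mono (N :: nat \<Rightarrow> nat)"
    and W_cont: "\<And>J. continuous_on UNIV (W J :: complex \<Rightarrow> real)"
    and W_ge: "\<And>J z. \<delta> / 2 \<le> W J z" and W_mono: "\<And>J z. W J z \<le> W (Suc J) z"
    and W_int: "\<And>J. integral {0..2 * pi} (\<lambda>t. W J (cis t)) \<le> 2 * pi * (S + \<delta>)"
    and W_dom: "\<And>J z. (\<Sum>n<N J. (cmod (\<Sum>k<N J. a n k * z ^ k))\<^sup>2) \<le> W J z"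
    using increasing_weights[OF bound \<delta>] by blast
  have W_pos: "W J z > 0" for J z using W_ge[of J z] \<delta> by linarith
  \<comment> \<open>On the circle the modulus of h is to be the limit of the square roots of the
    weights.\<close>
  define l where "l J z = ln (W J z) / 2" for J z
  have l_cont: "continuous_on A (l J)" for A J
    unfolding l_def using W_pos
    by (intro continuous_intros continuous_on_subset[OF W_cont]) (auto simp: less_imp_neq[symmetric])
  have W_cis: "(\<lambda>t. W J (cis t)) integrable_on {0..2 * pi}" for J
    by (intro integrable_continuous_interval continuous_on_compose2[OF W_cont] continuous_intros) auto
  have l_cis_cont: "continuous_on A (\<lambda>t. l J (cis t))" for A J
    by (rule continuous_on_compose2[OF l_cont[of UNIV]]) (auto intro!: continuous_intros)
  \<comment> \<open>The logarithms increase and their integrals are bounded, because ln x is at most x.\<close>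
  obtain v where v: "v absolutely_integrable_on {0..2 * pi}"
    and v_lim: "(\<lambda>J. integral {0..2 * pi} (\<lambda>t. \<bar>v t - l J (cis t)\<bar>)) \<longlonglongrightarrow> 0"
  proof (rule monotone_convergence_in_mean[where a = 0 and b = "2 * pi" and u = "\<lambda>J t. l J (cis t)"])
    show "continuous_on {0..2 * pi} (\<lambda>t. l J (cis t))" for J by (rule l_cis_cont)
    show "l J (cis t) \<le> l (Suc J) (cis t)" for J t
      unfolding l_def using W_mono W_pos by (simp add: ln_mono)
    show "integral {0..2 * pi} (\<lambda>t. l J (cis t)) \<le> 2 * pi * (S + \<delta>)" for J
    proof (rule order_trans[OF integral_le W_int])
      show "l J (cis t) \<le> W J (cis t)" for t
        using ln_less_self[OF W_pos, of J "cis t"] W_pos[of J "cis t"] unfolding l_def by linarith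
    qed (intro integrable_continuous_interval l_cis_cont W_cis)+
  qed blast
  define e where "e J = 1 / real (Suc J)" for J
  have e: "e J > 0" and e_lim: "e \<longlonglongrightarrow> 0" for J
    unfolding e_def using LIMSEQ_inverse_real_of_nat by (simp_all add: inverse_eq_divide)
  have "\<exists>p. Im (poly p 0) = 0 \<and> (\<forall>z. cmod z = 1 \<longrightarrow> \<bar>l J z - Re (poly p z)\<bar> < e J)" for J
    using trigonometric_approximation[OF l_cont e, of J J] by metis
  then obtain p where p0: "\<And>J. Im (poly (p J) 0) = 0"
    and p: "\<And>J z. cmod z = 1 \<Longrightarrow> \<bar>l J z - Re (poly (p J) z)\<bar> < e J" by metis
  define E where "E J = integral {0..2 * pi} (\<lambda>t. \<bar>v t - Re (poly (p J) (cis t))\<bar>)" for J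
  have abs_int: "(\<lambda>t. \<bar>v t - f t\<bar>) integrable_on {0..2 * pi}" if "continuous_on {0..2 * pi} f" for f
  proof -
    have "(\<lambda>t. v t - f t) absolutely_integrable_on {0..2 * pi}"
      by (intro set_integral_diff(1) v absolutely_integrable_continuous_real that)
    then show ?thesis by (simp add: absolutely_integrable_on_def)
  qed
  have E_le: "E J \<le> integral {0..2 * pi} (\<lambda>t. \<bar>v t - l J (cis t)\<bar>) + 2 * pi * e J" for J
  proof -
    have "E J \<le> integral {0..2 * pi} (\<lambda>t. \<bar>v t - l J (cis t)\<bar> + e J)"
      unfolding E_def
    proof (rule integral_le)
      show "(\<lambda>t. \<bar>v t - Re (poly (p J) (cis t))\<bar>) integrable_on {0..2 * pi}"
        by (intro abs_int continuous_intros)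
      show "(\<lambda>t. \<bar>v t - l J (cis t)\<bar> + e J) integrable_on {0..2 * pi}"
        by (intro integrable_add abs_int l_cis_cont integrable_const_ivl)
      show "\<bar>v t - Re (poly (p J) (cis t))\<bar> \<le> \<bar>v t - l J (cis t)\<bar> + e J" for t
        using p[of "cis t" J] by simp
    qed
    also have "\<dots> = integral {0..2 * pi} (\<lambda>t. \<bar>v t - l J (cis t)\<bar>) + 2 * pi * e J"
      by (subst integral_add) (auto intro!: abs_int l_cis_cont)
    finally show ?thesis .
  qed
  have E0: "E J \<ge> 0" for J
    unfolding E_def by (intro integral_nonneg abs_int continuous_intros) auto
  have E_lim: "E \<longlonglongrightarrow> 0"
  proof (rule tendsto_sandwich[OF _ _ tendsto_const])
    show "(\<lambda>J. integral {0..2 * pi} (\<lambda>t. \<bar>v t - l J (cis t)\<bar>) + 2 * pi * e J) \<longlonglongrightarrow> 0"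
      using tendsto_add[OF v_lim tendsto_mult_right_zero[OF e_lim, of "2 * pi"]] by simp
  qed (use E0 E_le in auto)
  define g where "g = Herglotz v"
  have g_p: "cmod (g z - poly (p J) z) \<le> E J / (pi * (1 - cmod z))" if "cmod z < 1" for z J
    unfolding g_def E_def by (rule Herglotz_minus_poly_le[OF v p0 that])
  have unif: "uniform_limit (cball 0 r) (\<lambda>J z. poly (p J) z) g sequentially" if r: "r < 1" for r
  proof (rule uniform_limitI)
    fix \<epsilon> :: real assume "\<epsilon> > 0"
    have "(\<lambda>J. E J / (pi * (1 - r))) \<longlonglongrightarrow> 0"
      using tendsto_divide[OF E_lim tendsto_const, of "pi * (1 - r)"] r by simp
    then have "\<forall>\<^sub>F J in sequentially. E J / (pi * (1 - r)) < \<epsilon>"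
      using \<open>\<epsilon> > 0\<close> by (rule order_tendstoD)
    then show "\<forall>\<^sub>F J in sequentially. \<forall>z\<in>cball 0 r. dist (poly (p J) z) (g z) < \<epsilon>"
    proof eventually_elim
      case (elim J)
      have "dist (poly (p J) z) (g z) < \<epsilon>" if z: "z \<in> cball 0 r" for z
      proof -
        have "dist (poly (p J) z) (g z) \<le> E J / (pi * (1 - cmod z))"
          using g_p[of z J] z r by (simp add: dist_norm norm_minus_commute)
        also have "\<dots> \<le> E J / (pi * (1 - r))"
          using z r E0[of J] by (intro divide_left_mono mult_left_mono mult_pos_pos) auto
        finally show ?thesis using elim by linarith
      qed
      then show ?case by blast
    qed
  qed
  have g_hol: "g holomorphic_on ball 0 1"
  proof (rule holomorphic_uniform_sequence[where f = "\<lambda>J z. poly (p J) z"])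
    fix x :: complex assume x: "x \<in> ball 0 1"
    define d where "d = (1 - cmod x) / 2"
    have sub: "cball x d \<subseteq> cball 0 (cmod x + d)" unfolding cball_subset_cball_iff by auto
    have "cmod x + d < 1" using x by (simp add: d_def field_simps)
    then have "uniform_limit (cball x d) (\<lambda>J z. poly (p J) z) g sequentially" "cball x d \<subseteq> ball 0 1"
      using uniform_limit_on_subset[OF unif sub] sub by auto
    moreover have "d > 0" using x by (simp add: d_def)
    ultimately show "\<exists>d>0. cball x d \<subseteq> ball 0 1 \<and> uniform_limit (cball x d) (\<lambda>J z. poly (p J) z) g sequentially"
      by blast
  qed (auto intro: holomorphic_on_poly)
  define H where "H z = (if z \<in> ball 0 1 then exp (g z) else 0)" for z
  have H_hol: "H holomorphic_on ball 0 1"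
    by (rule holomorphic_transform[where f = "\<lambda>z. exp (g z)"])
      (auto simp: H_def intro!: holomorphic_intros g_hol)
  \<comment> \<open>On the circle the squared modulus of exp (p J) is W J up to a factor tending to 1.\<close>
  have exp_p: "(cmod (exp (poly (p J) z)))\<^sup>2 \<le> exp (2 * e J) * W J z"
    "W J z \<le> exp (2 * e J) * (cmod (exp (poly (p J) z)))\<^sup>2" if z: "cmod z = 1" for J z
  proof -
    have W_exp: "W J z = exp (2 * l J z)" using W_pos[of J z] by (simp add: l_def)
    have sq: "(cmod (exp (poly (p J) z)))\<^sup>2 = exp (2 * Re (poly (p J) z))"
      by (simp add: exp_double)
    show "(cmod (exp (poly (p J) z)))\<^sup>2 \<le> exp (2 * e J) * W J z"
      "W J z \<le> exp (2 * e J) * (cmod (exp (poly (p J) z)))\<^sup>2"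
      unfolding W_exp sq exp_add[symmetric] using p[OF z, of J] by auto
  qed
  \<comment> \<open>The bound on the means of W J passes to exp (p J) on the unit circle, from there to
    smaller circles, and then to the limit H.\<close>
  have H_means: "integral {0..2 * pi} (\<lambda>t. (cmod (H (of_real \<rho> * cis t)))\<^sup>2) \<le> 2 * pi * (S + \<delta>)"
    if \<rho>: "0 < \<rho>" "\<rho> < 1" for \<rho>
  proof (rule tendsto_lowerbound)
    define c where "c J = E J / (pi * (1 - \<rho>))" for J
    show "(\<lambda>J. exp (2 * c J) * (exp (2 * e J) * (2 * pi * (S + \<delta>)))) \<longlonglongrightarrow> 2 * pi * (S + \<delta>)"
    proof -
      have "c \<longlonglongrightarrow> 0" unfolding c_def
        using tendsto_divide[OF E_lim tendsto_const, of "pi * (1 - \<rho>)"] \<rho> by simp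
      then show ?thesis using e_lim by (auto intro!: tendsto_eq_intros)
    qed
    have "integral {0..2 * pi} (\<lambda>t. (cmod (H (of_real \<rho> * cis t)))\<^sup>2)
        \<le> exp (2 * c J) * (exp (2 * e J) * (2 * pi * (S + \<delta>)))" for J
    proof -
      have "integral {0..2 * pi} (\<lambda>t. (cmod (H (of_real \<rho> * cis t)))\<^sup>2)
          \<le> integral {0..2 * pi} (\<lambda>t. exp (2 * c J) * (cmod (exp (poly (p J) (of_real \<rho> * cis t))))\<^sup>2)"
      proof (rule integral_le)
        show "(\<lambda>t. (cmod (H (of_real \<rho> * cis t)))\<^sup>2) integrable_on {0..2 * pi}"
          using \<rho> by (intro circle_integrable H_hol) auto
        show "(\<lambda>t. exp (2 * c J) * (cmod (exp (poly (p J) (of_real \<rho> * cis t))))\<^sup>2) integrable_on {0..2 * pi}"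
          by (intro integrable_continuous_interval continuous_intros)
        fix t
        define z where "z = of_real \<rho> * cis t"
        have z: "cmod z = \<rho>" using \<rho> by (simp add: z_def norm_mult)
        have "Re (g z) - Re (poly (p J) z) \<le> c J"
          using g_p[of z J] complex_Re_le_cmod[of "g z - poly (p J) z"] z \<rho> by (simp add: c_def)
        then have "exp (2 * Re (g z)) \<le> exp (2 * c J + 2 * Re (poly (p J) z))" by simp
        then show "(cmod (H (of_real \<rho> * cis t)))\<^sup>2 \<le> exp (2 * c J) * (cmod (exp (poly (p J) (of_real \<rho> * cis t))))\<^sup>2"
          unfolding z_def[symmetric] using z \<rho> by (simp add: H_def exp_double exp_add)
      qed
      also have "\<dots> = exp (2 * c J) * integral {0..2 * pi} (\<lambda>t. (cmod (exp (poly (p J) (of_real \<rho> * cis t))))\<^sup>2)"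
        by (rule integral_mult_right)
      also have "integral {0..2 * pi} (\<lambda>t. (cmod (exp (poly (p J) (of_real \<rho> * cis t))))\<^sup>2)
          \<le> integral {0..2 * pi} (\<lambda>t. (cmod (exp (poly (p J) (cis t))))\<^sup>2)"
        using \<rho> by (intro exp_poly_circle_mean_le) auto
      also have "\<dots> \<le> integral {0..2 * pi} (\<lambda>t. exp (2 * e J) * W J (cis t))"
        by (intro integral_le integrable_on_mult_right W_cis exp_p(1) integrable_continuous_interval
            continuous_intros) auto
      also have "\<dots> = exp (2 * e J) * integral {0..2 * pi} (\<lambda>t. W J (cis t))"
        by (rule integral_mult_right)
      also have "integral {0..2 * pi} (\<lambda>t. W J (cis t)) \<le> 2 * pi * (S + \<delta>)" by (rule W_int)
      finally show ?thesis by simp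
    qed
    then show "\<forall>\<^sub>F J in sequentially. integral {0..2 * pi} (\<lambda>t. (cmod (H (of_real \<rho> * cis t)))\<^sup>2)
        \<le> exp (2 * c J) * (exp (2 * e J) * (2 * pi * (S + \<delta>)))" by simp
  qed simp
  note coeffs = coeffs_le_circle_means[OF H_hol H_means]
  have "in_hardy2 H"
    using H_hol coeffs(1) by (simp add: in_hardy2_def) (simp add: H_def)
  then have h: "hfun (Abs_hardy2 H) = H" by (simp add: Abs_hardy2_inverse)
  show thesis
  proof (rule that[of "Abs_hardy2 H"])
    show "outer (Abs_hardy2 H)"
      unfolding outer_def h
      by (intro exI[of _ 1] exI[of _ "\<lambda>t. exp (v t)"]) (use v in \<open>simp add: H_def g_def Herglotz_def\<close>)
    show "(norm (Abs_hardy2 H))\<^sup>2 \<le> (\<Sum>n. (norm (X n))\<^sup>2) + \<delta>"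
      unfolding norm_hardy2_sq[of "Abs_hardy2 H"] h S_def[symmetric] by (rule coeffs(2))
    fix z :: complex and M assume z: "z \<in> ball 0 1"
    show "(\<Sum>n<M. (cmod (hfun (X n) z))\<^sup>2) \<le> (cmod (hfun (Abs_hardy2 H) z))\<^sup>2"
      unfolding h
    proof (rule tendsto_le[OF sequentially_bot])
      have N_lim: "filterlim N at_top sequentially" by (rule filterlim_subseq[OF N])
      have "(\<lambda>J. \<Sum>k<N J. a n k * z ^ k) \<longlonglongrightarrow> hfun (X n) z" for n
        using filterlim_compose[OF taylor_sums[OF hfun_holomorphic z, unfolded sums_def] N_lim]
        by (simp add: a_def)
      then show "(\<lambda>J. \<Sum>n<M. (cmod (\<Sum>k<N J. a n k * z ^ k))\<^sup>2) \<longlonglongrightarrow> (\<Sum>n<M. (cmod (hfun (X n) z))\<^sup>2)"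
        by (intro tendsto_intros)
      have "(\<lambda>J. poly (p J) z) \<longlonglongrightarrow> g z"
        using tendsto_uniform_limitI[OF unif, of "cmod z" z] z by simp
      then have "(\<lambda>J. (exp (e J) * cmod (exp (poly (p J) z)))\<^sup>2) \<longlonglongrightarrow> (exp 0 * cmod (exp (g z)))\<^sup>2"
        by (intro tendsto_intros e_lim)
      then show "(\<lambda>J. (exp (e J) * cmod (exp (poly (p J) z)))\<^sup>2) \<longlonglongrightarrow> (cmod (H z))\<^sup>2"
        using z by (simp add: H_def)
      have "(\<Sum>n<M. (cmod (\<Sum>k<N J. a n k * z ^ k))\<^sup>2) \<le> (exp (e J) * cmod (exp (poly (p J) z)))\<^sup>2"
        if "M \<le> J" for J
      proof -
        have "M \<le> N J" using that seq_suble[OF N, of J] by linarith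
        then have "(\<Sum>n<M. (cmod (\<Sum>k<N J. a n k * z ^ k))\<^sup>2)
            \<le> (\<Sum>n<N J. (cmod (\<Sum>k<N J. a n k * z ^ k))\<^sup>2)" by (intro sum_mono2) auto
        also have "\<dots> \<le> (exp (e J) * cmod (exp (poly (p J) z)))\<^sup>2"
        proof (rule sum_squares_le_on_disk)
          fix \<zeta> :: complex assume \<zeta>: "cmod \<zeta> = 1"
          show "(\<Sum>n<N J. (cmod (\<Sum>k<N J. a n k * \<zeta> ^ k))\<^sup>2) \<le> (exp (e J) * cmod (exp (poly (p J) \<zeta>)))\<^sup>2"
            using order_trans[OF W_dom exp_p(2)[OF \<zeta>]] by (simp add: power_mult_distrib exp_double)
        qed (use z in \<open>auto intro!: holomorphic_intros\<close>)
        finally show ?thesis .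
      qed
      then show "\<forall>\<^sub>F J in sequentially. (\<Sum>n<M. (cmod (\<Sum>k<N J. a n k * z ^ k))\<^sup>2)
          \<le> (exp (e J) * cmod (exp (poly (p J) z)))\<^sup>2"
        by (auto simp: eventually_sequentially)
    qed
  qed
qed

section \<open>Pick matrices and cyclic subspaces\<close>

lemma unital_subalgebraD:
  assumes "unital_subalgebra A"
  shows "f \<in> A \<Longrightarrow> f \<in> Hinf" "(\<lambda>z. 1) \<in> A"
    "f \<in> A \<Longrightarrow> g \<in> A \<Longrightarrow> (\<lambda>z. f z + g z) \<in> A"
    "f \<in> A \<Longrightarrow> g \<in> A \<Longrightarrow> (\<lambda>z. f z * g z) \<in> A"
    "f \<in> A \<Longrightarrow> (\<lambda>z. c * f z) \<in> A"
  using assms unfolding unital_subalgebra_def by auto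

lemma unital_subalgebra_sum:
  assumes A: "unital_subalgebra A" and "finite I" "\<And>i. i \<in> I \<Longrightarrow> f i \<in> A"
  shows "(\<lambda>z. \<Sum>i\<in>I. f i z) \<in> A"
  using assms(2,3)
proof (induction I rule: finite_induct)
  case empty
  show ?case using unital_subalgebraD(5)[OF A unital_subalgebraD(2)[OF A], of 0] by simp
next
  case (insert i I)
  then show ?case using unital_subalgebraD(3)[OF A, of "f i" "\<lambda>z. \<Sum>i\<in>I. f i z"] by simp
qed

lemma unital_subalgebra_prod:
  assumes A: "unital_subalgebra A" and "finite I" "\<And>i. i \<in> I \<Longrightarrow> f i \<in> A"
  shows "(\<lambda>z. \<Prod>i\<in>I. f i z) \<in> A"
  using assms(2,3)
proof (induction I rule: finite_induct)
  case empty
  show ?case using unital_subalgebraD(2)[OF A] by simp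
next
  case (insert i I)
  then show ?case using unital_subalgebraD(4)[OF A, of "f i" "\<lambda>z. \<Prod>i\<in>I. f i z"] by simp
qed

lemma unital_subalgebra_diff:
  assumes A: "unital_subalgebra A" and "f \<in> A" "g \<in> A"
  shows "(\<lambda>z. f z - g z) \<in> A"
  using unital_subalgebraD(3)[OF A assms(2) unital_subalgebraD(5)[OF A assms(3), of "-1"]] by simp

lemma unital_subalgebra_const:
  assumes A: "unital_subalgebra A"
  shows "(\<lambda>z. c) \<in> A"
  using unital_subalgebraD(5)[OF A unital_subalgebraD(2)[OF A], of c] by simp

text \<open>
  Lagrange interpolation, with a function of the algebra separating the two points in the
  place of each linear factor.
\<close>

lemma separating_algebra_interpolates:
  fixes lam :: "nat \<Rightarrow> complex"
  assumes A: "unital_subalgebra A" and I: "finite I" "inj_on lam I"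
    and sep: "separates A (lam ` I)"
  obtains e where "\<And>i. i \<in> I \<Longrightarrow> e i \<in> A"
    "\<And>i j. i \<in> I \<Longrightarrow> j \<in> I \<Longrightarrow> e i (lam j) = (if i = j then 1 else 0)"
proof -
  have "\<exists>f\<in>A. f (lam i) \<noteq> f (lam j)" if "i \<in> I" "j \<in> I" "i \<noteq> j" for i j
  proof -
    have "lam i \<noteq> lam j" using that I(2) by (auto dest: inj_onD)
    then show ?thesis using sep that unfolding separates_def by blast
  qed
  then obtain f where fA: "\<And>i j. i \<in> I \<Longrightarrow> j \<in> I \<Longrightarrow> i \<noteq> j \<Longrightarrow> f i j \<in> A"
    and f: "\<And>i j. i \<in> I \<Longrightarrow> j \<in> I \<Longrightarrow> i \<noteq> j \<Longrightarrow> f i j (lam i) \<noteq> f i j (lam j)" by metis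
  define e where "e i z = (\<Prod>j\<in>I - {i}. inverse (f i j (lam i) - f i j (lam j)) * (f i j z - f i j (lam j)))" for i z
  show thesis
  proof (rule that[of e])
    show "e i \<in> A" if "i \<in> I" for i
      unfolding e_def using I(1) that fA
      by (intro unital_subalgebra_prod[OF A] unital_subalgebraD(5)[OF A]
          unital_subalgebra_diff[OF A] unital_subalgebra_const[OF A]) auto
    show "e i (lam j) = (if i = j then 1 else 0)" if "i \<in> I" "j \<in> I" for i j
    proof (cases "i = j")
      case True
      then show ?thesis unfolding e_def using f that by (auto intro!: prod.neutral)
    next
      case False
      then show ?thesis unfolding e_def using I(1) that by (auto intro!: prod_zero bexI[of _ j])
    qed
  qed
qed

lemma mult_op_add_left:
  assumes "f \<in> Hinf" "g \<in> Hinf" "(\<lambda>z. f z + g z) \<in> Hinf"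
  shows "mult_op (\<lambda>z. f z + g z) x = mult_op f x + mult_op g x"
  using assms by (intro mult_op_eqI) (auto simp: algebra_simps)

lemma mult_op_cmult_left:
  assumes "f \<in> Hinf" "(\<lambda>z. c * f z) \<in> Hinf"
  shows "mult_op (\<lambda>z. c * f z) x = scaleC c (mult_op f x)"
  using assms by (intro mult_op_eqI) (auto simp: algebra_simps)

lemma mult_op_mult_left:
  assumes "f \<in> Hinf" "g \<in> Hinf" "(\<lambda>z. f z * g z) \<in> Hinf"
  shows "mult_op (\<lambda>z. f z * g z) x = mult_op f (mult_op g x)"
  using assms by (intro mult_op_eqI) (auto simp: algebra_simps)

lemma csubspace_orbit:
  assumes J: "J \<subseteq> Hinf" "(\<lambda>z. 0) \<in> J" "\<And>f g. f \<in> J \<Longrightarrow> g \<in> J \<Longrightarrow> (\<lambda>z. f z + g z) \<in> J"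
    "\<And>c f. f \<in> J \<Longrightarrow> (\<lambda>z. c * f z) \<in> J"
  shows "csubspace ((\<lambda>f. mult_op f h) ` J)"
  unfolding csubspace_def
proof (intro conjI ballI allI)
  have "mult_op (\<lambda>z. 0) h = 0" using J by (intro mult_op_eqI) auto
  then show "0 \<in> (\<lambda>f. mult_op f h) ` J" using J(2) by (metis imageI)
next
  fix x y assume "x \<in> (\<lambda>f. mult_op f h) ` J" "y \<in> (\<lambda>f. mult_op f h) ` J"
  then obtain f g where fg: "f \<in> J" "g \<in> J" "x = mult_op f h" "y = mult_op g h" by blast
  then have "x + y = mult_op (\<lambda>z. f z + g z) h"
    using J(1) J(3)[OF fg(1,2)] by (subst mult_op_add_left) auto
  then show "x + y \<in> (\<lambda>f. mult_op f h) ` J" using J(3)[OF fg(1,2)] by blast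
next
  fix c x assume "x \<in> (\<lambda>f. mult_op f h) ` J"
  then obtain f where f: "f \<in> J" "x = mult_op f h" by blast
  then have "scaleC c x = mult_op (\<lambda>z. c * f z) h"
    using J(1) J(4)[OF f(1), of c] by (subst mult_op_cmult_left) auto
  then show "scaleC c x \<in> (\<lambda>f. mult_op f h) ` J" using J(4)[OF f(1)] by blast
qed

lemma csubspace_cyclic_subspace:
  assumes A: "unital_subalgebra A"
  shows "csubspace (cyclic_subspace A h)"
  unfolding cyclic_subspace_def
  using unital_subalgebraD[OF A] unital_subalgebra_const[OF A]
  by (intro csubspace_closure csubspace_orbit) auto

lemma closed_cyclic_subspace [simp]: "closed (cyclic_subspace A h)"
  by (simp add: cyclic_subspace_def)

lemma mult_op_in_cyclic_subspace: "f \<in> A \<Longrightarrow> mult_op f h \<in> cyclic_subspace A h"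
  unfolding cyclic_subspace_def by (rule subsetD[OF closure_subset]) (rule imageI)

lemma cyclic_subspace_invariant:
  assumes A: "unital_subalgebra A" and f: "f \<in> A" and x: "x \<in> cyclic_subspace A h"
  shows "mult_op f x \<in> cyclic_subspace A h"
proof -
  obtain y where y: "\<forall>n. y n \<in> (\<lambda>f. mult_op f h) ` A" "y \<longlonglongrightarrow> x"
    using x unfolding cyclic_subspace_def closure_sequential by blast
  have "mult_op f (y n) \<in> (\<lambda>f. mult_op f h) ` A" for n
  proof -
    obtain g where g: "g \<in> A" "y n = mult_op g h" using y(1) by blast
    have fg: "(\<lambda>z. f z * g z) \<in> A" using unital_subalgebraD(4)[OF A f g(1)] .
    then have "mult_op f (y n) = mult_op (\<lambda>z. f z * g z) h"
      unfolding g(2) using f g unital_subalgebraD(1)[OF A] by (subst mult_op_mult_left) auto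
    then show ?thesis using fg by blast
  qed
  moreover have "(\<lambda>n. mult_op f (y n)) \<longlonglongrightarrow> mult_op f x"
    using tendsto_mult_op[OF unital_subalgebraD(1)[OF A f] y(2)] .
  ultimately show ?thesis
    unfolding cyclic_subspace_def closure_sequential by (intro exI[of _ "\<lambda>n. mult_op f (y n)"]) auto
qed

text \<open>
  Inside \<open>L\<close> the projected kernel reproduces values.
\<close>

lemma hinner_proj_szego:
  assumes "csubspace L" "closed L" "x \<in> L" "l \<in> ball 0 1"
  shows "hinner x (proj L (szego l)) = hfun x l"
  using hinner_proj_right[OF assms(1-3)] hinner_szego[OF assms(4)] by simp

lemma Pick_form_eq_norms:
  fixes u :: "nat \<Rightarrow> hardy2"
  shows "(\<Sum>i\<in>I. \<Sum>j\<in>I. cnj (v i) * ((1 - w i * cnj (w j)) * hinner (u j) (u i)) * v j)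
    = of_real ((norm (\<Sum>j\<in>I. scaleC (v j) (u j)))\<^sup>2 - (norm (\<Sum>j\<in>I. scaleC (cnj (w j) * v j) (u j)))\<^sup>2)"
proof -
  have expand: "hinner (\<Sum>j\<in>I. scaleC (a j) (u j)) (\<Sum>j\<in>I. scaleC (a j) (u j))
      = (\<Sum>i\<in>I. \<Sum>j\<in>I. cnj (a i) * hinner (u j) (u i) * a j)" for a
    unfolding hinner_sum_right
    by (simp add: hinner_scaleC_right hinner_sum_left hinner_scaleC_left sum_distrib_left mult_ac)
  show ?thesis
    unfolding of_real_diff hinner_same[symmetric] expand sum_subtractf[symmetric]
    by (intro sum.cong refl) (simp add: algebra_simps)
qed

text \<open>
  Positivity of the Pick matrix says that the diagonal map which multiplies the projected
  kernel at \<open>lam j\<close> by \<open>cnj (w j)\<close> is a contraction on the span of these kernels.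
\<close>

lemma Pick_positive_iff:
  assumes L: "csubspace L" "closed L" and lam: "lam ` I \<subseteq> ball 0 1"
  shows "positive_semidefinite I (\<lambda>i j. (1 - w i * cnj (w j)) * hinner (proj L (szego (lam j))) (szego (lam i)))
    \<longleftrightarrow> (\<forall>v. norm (\<Sum>j\<in>I. scaleC (cnj (w j) * v j) (proj L (szego (lam j))))
           \<le> norm (\<Sum>j\<in>I. scaleC (v j) (proj L (szego (lam j)))))"
proof -
  define u where "u j = proj L (szego (lam j))" for j
  have "hinner (u j) (szego (lam i)) = hinner (u j) (u i)" if "i \<in> I" for i j
    unfolding u_def using hinner_proj_right[OF L proj_in[OF L]] by simp
  then have "(\<Sum>i\<in>I. \<Sum>j\<in>I. cnj (v i) * ((1 - w i * cnj (w j)) * hinner (u j) (szego (lam i))) * v j)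
      = of_real ((norm (\<Sum>j\<in>I. scaleC (v j) (u j)))\<^sup>2 - (norm (\<Sum>j\<in>I. scaleC (cnj (w j) * v j) (u j)))\<^sup>2)" for v
    unfolding Pick_form_eq_norms[symmetric] by (intro sum.cong refl) simp
  then show ?thesis
    unfolding positive_semidefinite_def u_def[symmetric]
    by (simp only: nonneg_Reals_of_real_iff) (simp add: power2_le_iff_abs_le power_mono_iff)
qed

text \<open>
  Multiplication by \<open>f\<close> maps \<open>L\<close> into itself, and the adjoint of its restriction
  multiplies the projected kernel at \<open>lam i\<close> by \<open>cnj (w i)\<close>. It is a contraction because
  \<open>f\<close> is bounded by 1.
\<close>

lemma Pick_matrix_positive:
  assumes A: "unital_subalgebra A" and f: "f \<in> A" "\<And>z. z \<in> ball 0 1 \<Longrightarrow> cmod (f z) \<le> 1"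
    and I: "lam ` I \<subseteq> ball 0 1" "\<And>i. i \<in> I \<Longrightarrow> f (lam i) = w i"
  shows "positive_semidefinite I (\<lambda>i j. (1 - w i * cnj (w j)) *
      hinner (proj (cyclic_subspace A h) (szego (lam j))) (szego (lam i)))"
proof -
  define L where "L = cyclic_subspace A h"
  have L: "csubspace L" "closed L" using csubspace_cyclic_subspace[OF A] by (auto simp: L_def)
  define u where "u j = proj L (szego (lam j))" for j
  have uL: "u j \<in> L" for j unfolding u_def by (rule proj_in[OF L])
  have fH: "f \<in> Hinf" using unital_subalgebraD(1)[OF A f(1)] .
  have "norm (\<Sum>j\<in>I. scaleC (cnj (w j) * v j) (u j)) \<le> norm (\<Sum>j\<in>I. scaleC (v j) (u j))" for v
  proof -
    define x where "x = (\<Sum>j\<in>I. scaleC (v j) (u j))"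
    define y where "y = (\<Sum>j\<in>I. scaleC (cnj (w j) * v j) (u j))"
    have yL: "y \<in> L" unfolding y_def using L(1) uL by (intro csubspace_sum) (auto simp: csubspace_def)
    have fy: "mult_op f y \<in> L" using cyclic_subspace_invariant[OF A f(1)] yL by (simp add: L_def)
    have "hinner (mult_op f y) x = (\<Sum>j\<in>I. cnj (v j) * hfun (mult_op f y) (lam j))"
      unfolding x_def hinner_sum_right hinner_scaleC_right u_def using I(1)
      by (intro sum.cong refl) (subst hinner_proj_szego[OF L fy], auto)
    also have "\<dots> = (\<Sum>j\<in>I. w j * cnj (v j) * hfun y (lam j))"
      using I fH by (intro sum.cong refl) (auto simp: image_subset_iff)
    also have "\<dots> = hinner y y"
      unfolding y_def[symmetric] 
      by (subst (2) y_def, unfold hinner_sum_right hinner_scaleC_right u_def)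
        (use I(1) in \<open>intro sum.cong refl; subst hinner_proj_szego[OF L yL]; auto\<close>)
    finally have "(norm y)\<^sup>2 = cmod (hinner (mult_op f y) x)"
      by (simp add: hinner_same norm_power)
    also have "\<dots> \<le> norm (mult_op f y) * norm x" by (rule hinner_Cauchy_Schwarz)
    also have "\<dots> \<le> norm y * norm x"
      using norm_mult_op_le[OF fH f(2), of y] by (intro mult_right_mono) auto
    finally have "norm y * norm y \<le> norm y * norm x" by (simp add: power2_eq_square)
    then show ?thesis unfolding x_def[symmetric] y_def[symmetric]
      by (cases "norm y = 0") auto
  qed
  then show ?thesis
    using Pick_positive_iff[OF L I(1), of w] by (simp add: L_def u_def)
qed

text \<open>
  Let \<open>x\<close> have smallest norm in the closure of all \<open>mult_op f h\<close> with \<open>f\<close> an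
  interpolant. Being orthogonal to \<open>mult_op f h\<close> for all \<open>f\<close> vanishing at the nodes,
  \<open>x\<close> is a linear combination of the projected kernels; this uses that \<open>h\<close> has no zero
  at a node. Replacing each coefficient \<open>v j\<close> of \<open>x\<close> by \<open>cnj (w j) * v j\<close> gives a
  vector \<open>y\<close> with \<open>hinner x x = hinner h y\<close>, and the positivity of the Pick matrix says
  that \<open>y\<close> is not longer than \<open>x\<close>. Hence \<open>x\<close> is not longer than \<open>h\<close>.
\<close>

lemma interpolant_of_small_norm:
  assumes A: "unital_subalgebra A" and I: "finite I" "inj_on lam I" "lam ` I \<subseteq> ball 0 1"
    and sep: "separates A (lam ` I)"
    and h: "\<And>i. i \<in> I \<Longrightarrow> hfun h (lam i) \<noteq> 0"
    and psd: "positive_semidefinite I (\<lambda>i j. (1 - w i * cnj (w j)) *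
      hinner (proj (cyclic_subspace A h) (szego (lam j))) (szego (lam i)))"
    and \<epsilon>: "\<epsilon> > 0"
  obtains f where "f \<in> A" "\<And>i. i \<in> I \<Longrightarrow> f (lam i) = w i" "norm (mult_op f h) < norm h + \<epsilon>"
proof -
  note AD = unital_subalgebraD[OF A]
  obtain e where eA: "\<And>i. i \<in> I \<Longrightarrow> e i \<in> A"
    and e: "\<And>i j. i \<in> I \<Longrightarrow> j \<in> I \<Longrightarrow> e i (lam j) = (if i = j then 1 else 0)"
    using separating_algebra_interpolates[OF A I(1,2) sep] by blast
  define L where "L = cyclic_subspace A h"
  have L: "csubspace L" "closed L" using csubspace_cyclic_subspace[OF A] by (auto simp: L_def)
  have AL: "mult_op f h \<in> L" if "f \<in> A" for f
    unfolding L_def using that by (rule mult_op_in_cyclic_subspace)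
  \<comment> \<open>The interpolants in A are the translates of one of them, p, by the ideal J.\<close>
  define J where "J = {f \<in> A. \<forall>i\<in>I. f (lam i) = 0}"
  define M where "M = closure ((\<lambda>f. mult_op f h) ` J)"
  have M: "csubspace M" "closed M"
    unfolding M_def using AD(1,3,5) unital_subalgebra_const[OF A, of 0]
    by (auto intro!: csubspace_closure csubspace_orbit simp: J_def)
  have M_sub: "M \<subseteq> L"
    unfolding M_def L_def cyclic_subspace_def by (intro closure_mono) (auto simp: J_def)
  define p where "p z = (\<Sum>i\<in>I. w i * e i z)" for z
  have pA: "p \<in> A"
    unfolding p_def using I(1) eA AD(5) by (intro unital_subalgebra_sum[OF A]) auto
  have p: "p (lam j) = w j" if "j \<in> I" for j
    unfolding p_def using that I(1) e by (simp add: if_distrib[of "\<lambda>x. _ * x"] sum.delta cong: if_cong)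
  define m where "m = proj M (mult_op p h)"
  \<comment> \<open>The element of smallest norm in the closure of the interpolants applied to h.\<close>
  define x where "x = mult_op p h - m"
  have mM: "m \<in> M" unfolding m_def by (rule proj_in[OF M])
  have x_orth: "hinner x y = 0" if "y \<in> M" for y
    unfolding x_def m_def by (rule proj_orthogonal[OF M that])
  have xL: "x \<in> L" unfolding x_def using L(1) AL[OF pA] mM M_sub by (intro csubspace_diff) auto
  define u where "u j = proj L (szego (lam j))" for j
  have u: "hinner y (u j) = hfun y (lam j)" if "y \<in> L" "j \<in> I" for y j
    unfolding u_def using I(3) that by (intro hinner_proj_szego L) auto
  have uL: "u j \<in> L" for j unfolding u_def by (rule proj_in[OF L])
  \<comment> \<open>Since x is orthogonal to J h, pairing g h with x only sees the values of g at the
    nodes. These are the pairings of g h with the projected kernels, divided by the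
    values of h.\<close>
  define v where "v i = cnj (hinner (mult_op (e i) h) x / hfun h (lam i))" for i
  have x_eq: "x = (\<Sum>j\<in>I. scaleC (v j) (u j))"
  proof -
    define x' where "x' = (\<Sum>j\<in>I. scaleC (v j) (u j))"
    have "x' \<in> L" unfolding x'_def using L(1) uL by (intro csubspace_sum) (auto simp: csubspace_def)
    then have dL: "x - x' \<in> L" using csubspace_diff[OF L(1) xL] by blast
    have orth: "hinner (mult_op g h) (x - x') = 0" if g: "g \<in> A" for g
    proof -
      \<comment> \<open>Subtracting the combination of the e i with the same values at the nodes leaves
        an element of the ideal.\<close>
      define r where "r z = g z + - 1 * (\<Sum>i\<in>I. g (lam i) * e i z)" for z
      have rA: "r \<in> A"
        unfolding r_def using I(1) eA g by (intro AD(3,5) unital_subalgebra_sum[OF A]) auto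
      have "r (lam j) = 0" if "j \<in> I" for j
        unfolding r_def using that I(1) e
        by (simp add: if_distrib[of "\<lambda>x. _ * x"] sum.delta cong: if_cong)
      then have "mult_op r h \<in> M"
        unfolding M_def J_def using rA by (intro subsetD[OF closure_subset] imageI) auto
      then have r0: "hinner (mult_op r h) x = 0"
        using x_orth hinner_commute[of "mult_op r h" x] by simp
      have "mult_op g h = mult_op r h + (\<Sum>i\<in>I. scaleC (g (lam i)) (mult_op (e i) h))"
      proof (rule hardy2_eqI)
        fix z :: complex assume z: "z \<in> ball 0 1"
        have "hfun (\<Sum>i\<in>I. scaleC (g (lam i)) (mult_op (e i) h)) z = (\<Sum>i\<in>I. g (lam i) * e i z) * hfun h z"
          unfolding hfun_sum sum_distrib_right using z eA AD(1) by (intro sum.cong refl) simp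
        then show "hfun (mult_op g h) z = hfun (mult_op r h + (\<Sum>i\<in>I. scaleC (g (lam i)) (mult_op (e i) h))) z"
          using z g rA AD(1) by (simp add: r_def algebra_simps)
      qed
      then have "hinner (mult_op g h) x = (\<Sum>i\<in>I. g (lam i) * hinner (mult_op (e i) h) x)"
        using r0 by (simp add: hinner_add_left hinner_sum_left hinner_scaleC_left)
      also have "\<dots> = (\<Sum>i\<in>I. cnj (v i) * (g (lam i) * hfun h (lam i)))"
        using h by (intro sum.cong refl) (simp add: v_def)
      also have "\<dots> = (\<Sum>i\<in>I. cnj (v i) * hinner (mult_op g h) (u i))"
        using u[OF AL[OF g]] I(3) g AD(1) by (intro sum.cong refl) (auto simp: image_subset_iff)
      also have "\<dots> = hinner (mult_op g h) x'"
        by (simp add: x'_def hinner_sum_right hinner_scaleC_right)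
      finally show ?thesis by (simp add: hinner_diff_right)
    qed
    obtain y where y: "\<forall>n. y n \<in> (\<lambda>f. mult_op f h) ` A" "y \<longlonglongrightarrow> x - x'"
      using dL unfolding L_def cyclic_subspace_def closure_sequential by blast
    have "hinner (y n) (x - x') = 0" for n
      using spec[OF y(1), of n] by (rule imageE) (simp only: orth)
    then have "hinner (x - x') (x - x') = 0"
      using tendsto_hinner_left[OF y(2), of "x - x'"] by (simp add: LIMSEQ_const_iff)
    then show ?thesis by (simp add: hinner_same x'_def)
  qed
  define y where "y = (\<Sum>j\<in>I. scaleC (cnj (w j) * v j) (u j))"
  have y_le: "norm y \<le> norm x"
    using psd Pick_positive_iff[OF L I(3), of w] unfolding L_def[symmetric]
    unfolding x_eq y_def u_def by blast
  have hL: "h \<in> L"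
  proof -
    have "mult_op (\<lambda>z. 1) h = h" using AD(1,2) by (intro mult_op_eqI) auto
    then show ?thesis using AL[OF AD(2)] by simp
  qed
  have "hinner x x = hinner (mult_op p h) x - hinner m x"
    by (simp add: x_def hinner_diff_left)
  also have "hinner m x = 0" using x_orth[OF mM] hinner_commute[of m x] by simp
  also have "hinner (mult_op p h) x - 0 = (\<Sum>j\<in>I. cnj (v j) * hinner (mult_op p h) (u j))"
    by (subst x_eq) (simp add: hinner_sum_right hinner_scaleC_right)
  also have "\<dots> = (\<Sum>j\<in>I. w j * cnj (v j) * hinner h (u j))"
    using u[OF AL[OF pA]] u[OF hL] p I(3) pA AD(1)
    by (intro sum.cong refl) (auto simp: image_subset_iff)
  also have "\<dots> = hinner h y" by (simp add: y_def hinner_sum_right hinner_scaleC_right)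
  finally have "(norm x)\<^sup>2 = cmod (hinner h y)"
    by (simp add: hinner_same flip: of_real_power) (metis abs_power2 norm_of_real of_real_power)
  also have "\<dots> \<le> norm h * norm y" by (rule hinner_Cauchy_Schwarz)
  also have "\<dots> \<le> norm h * norm x" using y_le by (intro mult_left_mono) auto
  finally have "norm x * norm x \<le> norm h * norm x" by (simp add: power2_eq_square)
  then have x_le: "norm x \<le> norm h" by (cases "norm x = 0") auto
  obtain g where g: "g \<in> J" "dist (mult_op g h) m < \<epsilon>"
    using mM \<epsilon> unfolding M_def closure_approachable by blast
  define f where "f z = p z + - 1 * g z" for z
  have gA: "g \<in> A" using g(1) by (simp add: J_def)
  have fA: "f \<in> A" unfolding f_def by (intro AD(3,5) pA gA)
  show thesis
  proof (rule that[OF fA])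
    show "f (lam i) = w i" if "i \<in> I" for i using that p g(1) by (simp add: f_def J_def)
    have "mult_op f h = x + (m - mult_op g h)"
      using fA pA gA AD(1) by (intro mult_op_eqI) (auto simp: x_def f_def algebra_simps)
    then have "norm (mult_op f h) \<le> norm x + norm (m - mult_op g h)"
      by (simp add: norm_triangle_ineq)
    then show "norm (mult_op f h) < norm h + \<epsilon>"
      using x_le g(2) by (simp add: dist_norm norm_minus_commute)
  qed
qed

lemma outer_nonzero: "outer h \<Longrightarrow> z \<in> ball 0 1 \<Longrightarrow> hfun h z \<noteq> 0"
  unfolding outer_def by force

section \<open>One function for several weights\<close>

text \<open>
  A convex set which contains, for every single weight given by an outer function, a
  function that is almost a contraction in the mean square with respect to this weight. The
  function may depend on the weight. The interpolants form such a set if the Pick matrices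
  are positive.
\<close>

definition almost_contractive :: "(complex \<Rightarrow> complex) set \<Rightarrow> bool" where
  "almost_contractive V \<longleftrightarrow> V \<subseteq> Hinf \<and>
     (\<forall>f\<in>V. \<forall>g\<in>V. \<forall>t\<in>{0..1}. (\<lambda>z. of_real t * f z + of_real (1 - t) * g z) \<in> V) \<and>
     (\<forall>h. outer h \<longrightarrow> (\<forall>\<epsilon>>0. \<exists>f\<in>V. (norm (mult_op f h))\<^sup>2 < (norm h)\<^sup>2 + \<epsilon>))"

lemma almost_contractiveD:
  assumes "almost_contractive V"
  shows "f \<in> V \<Longrightarrow> f \<in> Hinf"
    and "outer h \<Longrightarrow> \<epsilon> > 0 \<Longrightarrow> \<exists>f\<in>V. (norm (mult_op f h))\<^sup>2 < (norm h)\<^sup>2 + \<epsilon>"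
  using assms unfolding almost_contractive_def by blast+

lemma outer_majorant_mult:
  fixes X :: "nat \<Rightarrow> hardy2"
  assumes f: "f \<in> Hinf"
    and le: "\<And>z N. z \<in> ball 0 1 \<Longrightarrow> (\<Sum>n<N. (cmod (hfun (X n) z))\<^sup>2) \<le> (cmod (hfun h z))\<^sup>2"
  shows "(\<Sum>n<N. (norm (mult_op f (X n)))\<^sup>2) \<le> (norm (mult_op f h))\<^sup>2"
proof (rule sum_norm_le_of_pointwise_le)
  fix z :: complex assume z: "z \<in> ball 0 1"
  have "(\<Sum>n<N. (cmod (f z * hfun (X n) z))\<^sup>2) = (cmod (f z))\<^sup>2 * (\<Sum>n<N. (cmod (hfun (X n) z))\<^sup>2)"
    by (simp add: norm_mult power_mult_distrib sum_distrib_left)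
  also have "\<dots> \<le> (cmod (f z))\<^sup>2 * (cmod (hfun h z))\<^sup>2"
    using le[OF z] by (intro mult_left_mono) auto
  finally show "(\<Sum>n<N. (cmod (hfun (mult_op f (X n)) z))\<^sup>2) \<le> (cmod (hfun (mult_op f h) z))\<^sup>2"
    using f z by (simp add: norm_mult power_mult_distrib)
qed

lemma square_summable_finite: "(\<And>n. n \<ge> N \<Longrightarrow> X n = 0) \<Longrightarrow> square_summable X"
  unfolding square_summable_def by (rule summable_finite[of "{..<N}"]) auto

text \<open>
  Up to an arbitrarily small error, the weights given by outer functions form a convex cone.
\<close>

lemma outer_majorant_two:
  assumes "a \<ge> 0" "b \<ge> 0" "\<delta> > 0"
  obtains h where "outer h" "(norm h)\<^sup>2 \<le> a * (norm x)\<^sup>2 + b * (norm y)\<^sup>2 + \<delta>"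
    "\<And>f. f \<in> Hinf \<Longrightarrow> a * (norm (mult_op f x))\<^sup>2 + b * (norm (mult_op f y))\<^sup>2 \<le> (norm (mult_op f h))\<^sup>2"
proof -
  define X where "X n = (if n = 0 then scaleC (of_real (sqrt a)) x
    else if n = 1 then scaleC (of_real (sqrt b)) y else 0)" for n :: nat
  have "square_summable X" by (rule square_summable_finite[of 2]) (simp add: X_def)
  then obtain h where h: "outer h"
    "\<And>z N. z \<in> ball 0 1 \<Longrightarrow> (\<Sum>n<N. (cmod (hfun (X n) z))\<^sup>2) \<le> (cmod (hfun h z))\<^sup>2"
    "(norm h)\<^sup>2 \<le> (\<Sum>n. (norm (X n))\<^sup>2) + \<delta>"
    using outer_majorant[OF _ assms(3)] by blast
  have two: "{..<2} = {0, 1 :: nat}" by auto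
  have "(\<Sum>n. (norm (X n))\<^sup>2) = (\<Sum>n<2. (norm (X n))\<^sup>2)"
    by (rule suminf_finite) (auto simp: X_def)
  also have "\<dots> = a * (norm x)\<^sup>2 + b * (norm y)\<^sup>2"
    using assms by (simp add: two X_def power_mult_distrib)
  finally have norm: "(norm h)\<^sup>2 \<le> a * (norm x)\<^sup>2 + b * (norm y)\<^sup>2 + \<delta>" using h(3) by simp
  have "a * (norm (mult_op f x))\<^sup>2 + b * (norm (mult_op f y))\<^sup>2 \<le> (norm (mult_op f h))\<^sup>2" if "f \<in> Hinf" for f
    using outer_majorant_mult[OF that h(2), of 2] assms that
    by (simp add: two X_def power_mult_distrib mult_op_scaleC)
  then show thesis using h(1) norm that by blast
qed

lemma norm_sq_convex:
  assumes "0 \<le> t" "t \<le> 1"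
  shows "(norm (t *\<^sub>R x + (1 - t) *\<^sub>R (y :: hardy2)))\<^sup>2 \<le> t * (norm x)\<^sup>2 + (1 - t) * (norm y)\<^sup>2"
proof -
  have "t * (norm x)\<^sup>2 + (1 - t) * (norm y)\<^sup>2 - (norm (t *\<^sub>R x + (1 - t) *\<^sub>R y))\<^sup>2
      = t * (1 - t) * (norm (x - y))\<^sup>2"
    by (simp add: power2_norm_eq_inner inner_add_left inner_add_right inner_diff_left
        inner_diff_right inner_commute algebra_simps)
  moreover have "\<dots> \<ge> 0" using assms by simp
  ultimately show ?thesis by linarith
qed

lemma norm_mult_op_convex:
  assumes f: "f \<in> Hinf" "g \<in> Hinf" and t: "0 \<le> t" "t \<le> 1"
    and fg: "(\<lambda>z. of_real t * f z + of_real (1 - t) * g z) \<in> Hinf"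
  shows "(norm (mult_op (\<lambda>z. of_real t * f z + of_real (1 - t) * g z) h))\<^sup>2
    \<le> t * (norm (mult_op f h))\<^sup>2 + (1 - t) * (norm (mult_op g h))\<^sup>2"
proof -
  have "mult_op (\<lambda>z. of_real t * f z + of_real (1 - t) * g z) h
      = t *\<^sub>R mult_op f h + (1 - t) *\<^sub>R mult_op g h"
    using assms by (intro mult_op_eqI) (auto simp: algebra_simps)
  then show ?thesis using norm_sq_convex[OF t] by simp
qed

text \<open>
  A minimax argument. If no element of \<open>V\<close> serves both weights, then a line separates the
  pairs of squared norms which elements of \<open>V\<close> attain from the quadrant of the pairs that
  would be small enough. Its normal vector \<open>(a, b)\<close> has nonnegative entries, and combining
  the two weights with these coefficients gives a weight for which \<open>V\<close> has no almost
  contraction. By \<open>outer_majorant_two\<close> this weight comes from an outer function, up to a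
  small error.
\<close>

lemma almost_contractive_two:
  assumes V: "almost_contractive V" and h: "outer h1" "outer h2" and \<epsilon>: "\<epsilon>1 > 0" "\<epsilon>2 > 0"
  shows "\<exists>f\<in>V. (norm (mult_op f h1))\<^sup>2 < (norm h1)\<^sup>2 + \<epsilon>1 \<and> (norm (mult_op f h2))\<^sup>2 < (norm h2)\<^sup>2 + \<epsilon>2"
proof (rule ccontr)
  assume none: "\<not> ?thesis"
  define q1 where "q1 f = (norm (mult_op f h1))\<^sup>2" for f
  define q2 where "q2 f = (norm (mult_op f h2))\<^sup>2" for f
  define m1 where "m1 = (norm h1)\<^sup>2 + \<epsilon>1"
  define m2 where "m2 = (norm h2)\<^sup>2 + \<epsilon>2"
  have VH: "f \<in> V \<Longrightarrow> f \<in> Hinf" for f using V by (auto simp: almost_contractive_def)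
  \<comment> \<open>C is made upward closed in order to be convex: q1 and q2 are only convex functions
    of f.\<close>
  define C where "C = {(a, b). \<exists>f\<in>V. q1 f \<le> a \<and> q2 f \<le> b}"
  define D where "D = {..<m1} \<times> {..<m2}"
  have C_conv: "convex C"
  proof (rule convexI, clarify)
    fix a b a' b' s t :: real
    assume ab: "(a, b) \<in> C" "(a', b') \<in> C" and st: "0 \<le> s" "0 \<le> t" "s + t = 1"
    obtain f g where f: "f \<in> V" "q1 f \<le> a" "q2 f \<le> b" and g: "g \<in> V" "q1 g \<le> a'" "q2 g \<le> b'"
      using ab by (auto simp: C_def)
    define k where "k z = of_real s * f z + of_real (1 - s) * g z" for z
    have kV: "k \<in> V" unfolding k_def using V f(1) g(1) st by (auto simp: almost_contractive_def)
    have t: "t = 1 - s" using st by simp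
    have s: "0 \<le> s" "s \<le> 1" using st by auto
    note conv = norm_mult_op_convex[OF VH[OF f(1)] VH[OF g(1)] s VH[OF kV[unfolded k_def[abs_def]]],
        folded k_def[abs_def]]
    have "q1 k \<le> s * q1 f + t * q1 g" "q2 k \<le> s * q2 f + t * q2 g"
      unfolding q1_def q2_def t by (rule conv)+
    moreover have "s * q1 f \<le> s * a" "t * q1 g \<le> t * a'" "s * q2 f \<le> s * b" "t * q2 g \<le> t * b'"
      using f g st by (auto intro: mult_left_mono)
    ultimately have "q1 k \<le> s * a + t * a'" "q2 k \<le> s * b + t * b'" by linarith+
    then show "s *\<^sub>R (a, b) + t *\<^sub>R (a', b') \<in> C" using kV by (auto simp: C_def)
  qed
  have D_conv: "convex D" unfolding D_def by (intro convex_Times convex_real_interval)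
  have D_ne: "D \<noteq> {}" unfolding D_def by auto
  obtain f0 where "f0 \<in> V" using almost_contractiveD(2)[OF V h(1) \<epsilon>(1)] by blast
  then have C_ne: "C \<noteq> {}" by (auto simp: C_def)
  have disj: "D \<inter> C = {}" using none by (force simp: C_def D_def q1_def q2_def m1_def m2_def)
  obtain \<alpha> \<beta> where \<alpha>: "\<alpha> \<noteq> 0" "\<And>x. x \<in> D \<Longrightarrow> inner \<alpha> x \<le> \<beta>" "\<And>x. x \<in> C \<Longrightarrow> \<beta> \<le> inner \<alpha> x"
    using separating_hyperplane_sets[OF D_conv C_conv D_ne C_ne disj] by blast
  obtain a b where ab: "\<alpha> = (a, b)" by (cases \<alpha>)
  have corner: "a * (m1 - s) + b * (m2 - t) \<le> \<beta>" if "s > 0" "t > 0" for s t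
    using \<alpha>(2)[of "(m1 - s, m2 - t)"] that by (simp add: D_def ab)
  \<comment> \<open>The quadrant is unbounded below in each coordinate, so no entry of the normal vector
    is negative.\<close>
  have a0: "a \<ge> 0"
  proof (rule ccontr)
    assume neg: "\<not> a \<ge> 0"
    define s where "s = max 1 ((\<beta> - a * m1 - b * (m2 - 1) + 1) / (- a))"
    have "(\<beta> - a * m1 - b * (m2 - 1) + 1) / (- a) \<le> s" "s > 0" by (auto simp: s_def)
    then have "\<beta> - a * m1 - b * (m2 - 1) + 1 \<le> s * (- a)" using neg by (subst (asm) pos_divide_le_eq) auto
    then show False using corner[of s 1] \<open>s > 0\<close> by (simp add: algebra_simps)
  qed
  have b0: "b \<ge> 0"
  proof (rule ccontr)
    assume neg: "\<not> b \<ge> 0"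
    define s where "s = max 1 ((\<beta> - b * m2 - a * (m1 - 1) + 1) / (- b))"
    have "(\<beta> - b * m2 - a * (m1 - 1) + 1) / (- b) \<le> s" "s > 0" by (auto simp: s_def)
    then have "\<beta> - b * m2 - a * (m1 - 1) + 1 \<le> s * (- b)" using neg by (subst (asm) pos_divide_le_eq) auto
    then show False using corner[of 1 s] \<open>s > 0\<close> by (simp add: algebra_simps)
  qed
  have ab_pos: "a + b > 0" using a0 b0 \<alpha>(1) by (auto simp: ab zero_prod_def)
  have lim: "a * m1 + b * m2 \<le> \<beta>"
  proof (rule field_le_epsilon)
    fix e :: real assume "e > 0"
    define s where "s = e / (a + b)"
    have s: "s > 0" "s * (a + b) = e" using ab_pos \<open>e > 0\<close> by (auto simp: s_def)
    then show "a * m1 + b * m2 \<le> \<beta> + e"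
      using corner[OF s(1) s(1)] by (simp add: algebra_simps)
  qed
  define \<delta> where "\<delta> = (a * \<epsilon>1 + b * \<epsilon>2) / 4"
  have \<delta>: "\<delta> > 0" unfolding \<delta>_def using a0 b0 ab_pos \<epsilon>
    by (cases "a = 0") (auto intro!: add_pos_nonneg mult_pos_pos)
  obtain h where h: "outer h" "(norm h)\<^sup>2 \<le> a * (norm h1)\<^sup>2 + b * (norm h2)\<^sup>2 + \<delta>"
    "\<And>f. f \<in> Hinf \<Longrightarrow> a * (norm (mult_op f h1))\<^sup>2 + b * (norm (mult_op f h2))\<^sup>2 \<le> (norm (mult_op f h))\<^sup>2"
    using outer_majorant_two[OF a0 b0 \<delta>] by blast
  obtain f where f: "f \<in> V" "(norm (mult_op f h))\<^sup>2 < (norm h)\<^sup>2 + \<delta>"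
    using almost_contractiveD(2)[OF V h(1) \<delta>] by blast
  have "a * q1 f + b * q2 f < a * (norm h1)\<^sup>2 + b * (norm h2)\<^sup>2 + 2 * \<delta>"
    using h(2) h(3)[OF VH[OF f(1)]] f(2) by (simp add: q1_def q2_def)
  also have "\<dots> < a * m1 + b * m2" using \<delta> by (simp add: \<delta>_def m1_def m2_def algebra_simps)
  also have "\<dots> \<le> \<beta>" by (rule lim)
  also have "\<beta> \<le> a * q1 f + b * q2 f"
    using \<alpha>(3)[of "(q1 f, q2 f)"] f(1) by (auto simp: C_def ab)
  finally show False by simp
qed

text \<open>
  Imposing the bound for one weight on the elements of \<open>V\<close> leaves a set of the same kind,
  so that any finite number of weights can be treated one after the other.
\<close>

lemma almost_contractive_restrict:
  assumes V: "almost_contractive V" and h: "outer h" and \<epsilon>: "\<epsilon> > 0"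
  shows "almost_contractive (V \<inter> {f. (norm (mult_op f h))\<^sup>2 < (norm h)\<^sup>2 + \<epsilon>})"
  unfolding almost_contractive_def
proof (intro conjI ballI allI impI)
  show "V \<inter> {f. (norm (mult_op f h))\<^sup>2 < (norm h)\<^sup>2 + \<epsilon>} \<subseteq> Hinf"
    using V by (auto simp: almost_contractive_def)
next
  fix f g and t :: real
  assume f: "f \<in> V \<inter> {f. (norm (mult_op f h))\<^sup>2 < (norm h)\<^sup>2 + \<epsilon>}"
    and g: "g \<in> V \<inter> {f. (norm (mult_op f h))\<^sup>2 < (norm h)\<^sup>2 + \<epsilon>}" and t: "t \<in> {0..1}"
  define k where "k z = of_real t * f z + of_real (1 - t) * g z" for z
  have kV: "k \<in> V" unfolding k_def using V f g t by (auto simp: almost_contractive_def)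
  have "f \<in> Hinf" "g \<in> Hinf" "k \<in> Hinf" using V f g kV by (auto simp: almost_contractive_def)
  then have "(norm (mult_op k h))\<^sup>2 \<le> t * (norm (mult_op f h))\<^sup>2 + (1 - t) * (norm (mult_op g h))\<^sup>2"
    using t unfolding k_def by (intro norm_mult_op_convex) auto
  also have "\<dots> < (norm h)\<^sup>2 + \<epsilon>"
    using f g t by (intro convex_bound_lt) auto
  finally show "(\<lambda>z. of_real t * f z + of_real (1 - t) * g z) \<in> V \<inter> {f. (norm (mult_op f h))\<^sup>2 < (norm h)\<^sup>2 + \<epsilon>}"
    using kV unfolding k_def by simp
next
  fix h' and \<epsilon>' :: real assume "outer h'" "\<epsilon>' > 0"
  then show "\<exists>f\<in>V \<inter> {f. (norm (mult_op f h))\<^sup>2 < (norm h)\<^sup>2 + \<epsilon>}. (norm (mult_op f h'))\<^sup>2 < (norm h')\<^sup>2 + \<epsilon>'"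
    using almost_contractive_two[OF V h _ \<epsilon>] by blast
qed

lemma almost_contractive_finite:
  assumes V: "almost_contractive V" and Y: "finite Y" "\<And>h \<epsilon>. (h, \<epsilon>) \<in> Y \<Longrightarrow> outer h \<and> \<epsilon> > 0"
  shows "almost_contractive (V \<inter> (\<Inter>(h, \<epsilon>)\<in>Y. {f. (norm (mult_op f h))\<^sup>2 < (norm h)\<^sup>2 + \<epsilon>}))"
  using Y
proof (induction Y rule: finite_induct)
  case empty
  show ?case using V by simp
next
  case (insert b Y)
  obtain h \<epsilon> where b: "b = (h, \<epsilon>)" by (cases b)
  have "almost_contractive (V \<inter> (\<Inter>(h, \<epsilon>)\<in>Y. {f. (norm (mult_op f h))\<^sup>2 < (norm h)\<^sup>2 + \<epsilon>})
      \<inter> {f. (norm (mult_op f h))\<^sup>2 < (norm h)\<^sup>2 + \<epsilon>})"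
    using insert.IH insert.prems by (intro almost_contractive_restrict) (auto simp: b)
  then show ?case by (simp add: b Int_ac)
qed

lemma outer_exists: "\<exists>h. outer h"
  using outer_majorant_two[of 0 0 1] by (metis order_refl zero_less_one)

text \<open>
  The bounds for finitely many weights can be met together, so the sets on which a single
  one holds generate a proper filter.
\<close>

lemma contraction_filter_exists:
  assumes V: "almost_contractive V"
  obtains F where "F \<noteq> bot"
    "\<And>h \<epsilon>. outer h \<Longrightarrow> \<epsilon> > 0 \<Longrightarrow> eventually (\<lambda>f. f \<in> V \<and> (norm (mult_op f h))\<^sup>2 < (norm h)\<^sup>2 + \<epsilon>) F"
proof -
  define B where "B = {(h, \<epsilon>). outer h \<and> \<epsilon> > (0::real)}"
  define R where "R b = (case b of (h, \<epsilon>) \<Rightarrow> {f \<in> V. (norm (mult_op f h))\<^sup>2 < (norm h)\<^sup>2 + \<epsilon>})" for b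
  define F where "F = (INF b\<in>B. principal (R b))"
  have "F \<noteq> bot"
    unfolding F_def
  proof (rule INF_filter_not_bot)
    fix Y assume Y: "Y \<subseteq> B" "finite Y"
    define U where "U = V \<inter> (\<Inter>(h, \<epsilon>)\<in>Y. {f. (norm (mult_op f h))\<^sup>2 < (norm h)\<^sup>2 + \<epsilon>})"
    have "almost_contractive U"
      unfolding U_def using Y by (intro almost_contractive_finite V) (auto simp: B_def)
    then obtain f where "f \<in> U"
      using almost_contractiveD(2)[OF _ _ zero_less_one] outer_exists by blast
    then have "f \<in> (\<Inter>b\<in>Y. R b)" by (auto simp: U_def R_def)
    then show "(INF b\<in>Y. principal (R b)) \<noteq> bot"
      unfolding INF_principal_finite[OF Y(2)] principal_eq_bot_iff by blast
  qed
  moreover have "eventually (\<lambda>f. f \<in> V \<and> (norm (mult_op f h))\<^sup>2 < (norm h)\<^sup>2 + \<epsilon>) F"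
    if "outer h" "\<epsilon> > 0" for h \<epsilon>
  proof -
    have "F \<le> principal (R (h, \<epsilon>))" unfolding F_def by (rule INF_lower) (use that in \<open>simp add: B_def\<close>)
    then show ?thesis by (simp add: le_principal R_def)
  qed
  ultimately show thesis using that by blast
qed

section \<open>Weak limits\<close>

text \<open>
  The bound \<open>\<eta> * C\<close> does not depend on \<open>t\<close>, and the other summand tends to 0 as
  \<open>N\<close> grows. This is the Cauchy-Schwarz inequality in the form that a product is at most
  \<open>\<eta>\<close> times one square plus \<open>1 / \<eta>\<close> times the other.
\<close>

lemma suminf_tail_bound:
  fixes t :: "nat \<Rightarrow> complex" and \<alpha> \<beta> :: "nat \<Rightarrow> real"
  assumes t: "\<And>n. cmod (t n) \<le> \<alpha> n * \<beta> n"
    and \<alpha>: "summable (\<lambda>n. (\<alpha> n)\<^sup>2)" "(\<Sum>n. (\<alpha> n)\<^sup>2) \<le> C"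
    and \<beta>: "summable (\<lambda>n. (\<beta> n)\<^sup>2)" and \<eta>: "\<eta> > 0"
  shows "summable t" "cmod (suminf t - (\<Sum>n<N. t n)) \<le> \<eta> * C + (\<Sum>n. (\<beta> (n + N))\<^sup>2) / \<eta>"
proof -
  have term_le: "cmod (t n) \<le> \<eta> * (\<alpha> n)\<^sup>2 + (\<beta> n)\<^sup>2 / \<eta>" for n
  proof -
    have "0 \<le> ((\<eta> * \<alpha> n - \<beta> n)\<^sup>2 + (\<eta> * \<alpha> n)\<^sup>2 + (\<beta> n)\<^sup>2) / (2 * \<eta>)"
      using \<eta> by (intro divide_nonneg_pos add_nonneg_nonneg) auto
    also have "\<dots> = \<eta> * (\<alpha> n)\<^sup>2 + (\<beta> n)\<^sup>2 / \<eta> - \<alpha> n * \<beta> n"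
      using \<eta> by (simp add: power2_eq_square field_simps)
    finally show ?thesis using t[of n] by linarith
  qed
  have sum: "summable (\<lambda>n. \<eta> * (\<alpha> n)\<^sup>2 + (\<beta> n)\<^sup>2 / \<eta>)"
    using \<alpha>(1) \<beta> by (intro summable_add summable_mult summable_divide)
  show st: "summable t"
    by (rule summable_comparison_test'[OF sum, of 0]) (use term_le in simp)
  have sum': "summable (\<lambda>n. \<eta> * (\<alpha> (n + N))\<^sup>2 + (\<beta> (n + N))\<^sup>2 / \<eta>)"
    using summable_ignore_initial_segment[OF sum] .
  have \<alpha>N: "summable (\<lambda>n. (\<alpha> (n + N))\<^sup>2)" and \<beta>N: "summable (\<lambda>n. (\<beta> (n + N))\<^sup>2)"
    using summable_ignore_initial_segment[OF \<alpha>(1)] summable_ignore_initial_segment[OF \<beta>] by auto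
  have "suminf t - (\<Sum>n<N. t n) = (\<Sum>n. t (n + N))"
    using suminf_split_initial_segment[OF st, of N] by simp
  also have "cmod \<dots> \<le> (\<Sum>n. \<eta> * (\<alpha> (n + N))\<^sup>2 + (\<beta> (n + N))\<^sup>2 / \<eta>)"
    using norm_suminf_le[OF term_le sum'] by simp
  also have "\<dots> = \<eta> * (\<Sum>n. (\<alpha> (n + N))\<^sup>2) + (\<Sum>n. (\<beta> (n + N))\<^sup>2) / \<eta>"
    using \<alpha>N \<beta>N by (subst suminf_add[symmetric]) (auto simp: suminf_mult suminf_divide summable_mult summable_divide)
  also have "(\<Sum>n. (\<alpha> (n + N))\<^sup>2) \<le> C"
    using \<alpha>(2) suminf_split_initial_segment[OF \<alpha>(1), of N] sum_nonneg[of "{..<N}" "\<lambda>n. (\<alpha> n)\<^sup>2"] by simp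
  finally show "cmod (suminf t - (\<Sum>n<N. t n)) \<le> \<eta> * C + (\<Sum>n. (\<beta> (n + N))\<^sup>2) / \<eta>"
    using \<eta> by simp
qed

text \<open>
  Termwise convergence implies convergence of the sums, as the tails are uniformly small. It
  serves for weak convergence in the Hardy space, where the terms are products of
  coefficients, and for trace class functionals, where they are inner products.
\<close>

lemma tendsto_suminf_bounded:
  fixes t :: "'a \<Rightarrow> nat \<Rightarrow> complex"
  assumes lim: "\<And>n. ((\<lambda>f. t f n) \<longlongrightarrow> s n) G"
    and ev: "eventually (\<lambda>f. \<exists>\<alpha>. (\<forall>n. cmod (t f n) \<le> \<alpha> n * \<beta> n) \<and> summable (\<lambda>n. (\<alpha> n)\<^sup>2) \<and> (\<Sum>n. (\<alpha> n)\<^sup>2) \<le> C) G"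
    and s: "\<And>n. cmod (s n) \<le> \<gamma> n * \<beta> n" "summable (\<lambda>n. (\<gamma> n)\<^sup>2)"
    and \<beta>: "summable (\<lambda>n. (\<beta> n)\<^sup>2)"
  shows "((\<lambda>f. suminf (t f)) \<longlongrightarrow> suminf s) G"
proof (rule tendstoI)
  fix e :: real assume e: "e > 0"
  define D where "D = max 0 C + (\<Sum>n. (\<gamma> n)\<^sup>2)"
  have D: "D \<ge> 0" "C \<le> D" "(\<Sum>n. (\<gamma> n)\<^sup>2) \<le> D"
    using suminf_nonneg[OF s(2)] by (auto simp: D_def)
  define \<eta> where "\<eta> = e / (8 * (D + 1))"
  have \<eta>: "\<eta> > 0" "\<eta> * D \<le> e / 8" using e D(1) by (auto simp: \<eta>_def field_simps)
  have "(\<lambda>N. \<Sum>n. (\<beta> (n + N))\<^sup>2) \<longlonglongrightarrow> 0"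
    using suminf_exist_split2[OF \<beta>] by simp
  then have "\<forall>\<^sub>F N in sequentially. (\<Sum>n. (\<beta> (n + N))\<^sup>2) < \<eta> * (e / 8)"
    using \<eta>(1) e by (intro order_tendstoD(2)) auto
  then obtain N where N: "(\<Sum>n. (\<beta> (n + N))\<^sup>2) < \<eta> * (e / 8)"
    by (auto simp: eventually_sequentially)
  have small: "\<eta> * D + (\<Sum>n. (\<beta> (n + N))\<^sup>2) / \<eta> < e / 4"
  proof -
    have "(\<Sum>n. (\<beta> (n + N))\<^sup>2) / \<eta> < e / 8" using N \<eta>(1) by (simp add: pos_divide_less_eq mult.commute)
    then show ?thesis using \<eta>(2) by linarith
  qed
  have s_tail: "cmod (suminf s - (\<Sum>n<N. s n)) < e / 4"
    using suminf_tail_bound(2)[OF s D(3) \<beta> \<eta>(1), of N] small by linarith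
  have "((\<lambda>f. \<Sum>n<N. t f n) \<longlongrightarrow> (\<Sum>n<N. s n)) G" by (intro tendsto_sum lim)
  then have "\<forall>\<^sub>F f in G. dist (\<Sum>n<N. t f n) (\<Sum>n<N. s n) < e / 2"
    using e by (intro tendstoD) auto
  with ev show "\<forall>\<^sub>F f in G. dist (suminf (t f)) (suminf s) < e"
  proof eventually_elim
    case (elim f)
    then obtain \<alpha> where \<alpha>: "\<And>n. cmod (t f n) \<le> \<alpha> n * \<beta> n" "summable (\<lambda>n. (\<alpha> n)\<^sup>2)" "(\<Sum>n. (\<alpha> n)\<^sup>2) \<le> D"
      using D(2) by fastforce
    have "cmod (suminf (t f) - (\<Sum>n<N. t f n)) < e / 4"
      using suminf_tail_bound(2)[OF \<alpha> \<beta> \<eta>(1), of N] small by linarith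
    moreover have "cmod (suminf (t f) - suminf s) \<le> cmod (suminf (t f) - (\<Sum>n<N. t f n))
        + cmod ((\<Sum>n<N. t f n) - (\<Sum>n<N. s n)) + cmod (suminf s - (\<Sum>n<N. s n))"
      using norm_triangle_ineq4[of "suminf (t f) - (\<Sum>n<N. s n)" "suminf s - (\<Sum>n<N. s n)"]
        norm_triangle_ineq[of "suminf (t f) - (\<Sum>n<N. t f n)" "(\<Sum>n<N. t f n) - (\<Sum>n<N. s n)"]
      by simp
    ultimately show ?case using elim(2) s_tail unfolding dist_norm by linarith
  qed
qed

lemma hardy2_weak_limit:
  assumes lim: "\<And>n. ((\<lambda>f. hcoeff (x f) n) \<longlongrightarrow> hcoeff y n) G"
    and bound: "eventually (\<lambda>f. norm (x f) \<le> R) G"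
  shows "((\<lambda>f. hinner (x f) k) \<longlongrightarrow> hinner y k) G"
  unfolding hinner_def
proof (rule tendsto_suminf_bounded[where C = "R\<^sup>2" and \<beta> = "\<lambda>n. cmod (hcoeff k n)" and \<gamma> = "\<lambda>n. cmod (hcoeff y n)"])
  show "((\<lambda>f. hcoeff (x f) n * cnj (hcoeff k n)) \<longlongrightarrow> hcoeff y n * cnj (hcoeff k n)) G" for n
    by (intro tendsto_intros lim)
  show "eventually (\<lambda>f. \<exists>\<alpha>. (\<forall>n. cmod (hcoeff (x f) n * cnj (hcoeff k n)) \<le> \<alpha> n * cmod (hcoeff k n))
      \<and> summable (\<lambda>n. (\<alpha> n)\<^sup>2) \<and> (\<Sum>n. (\<alpha> n)\<^sup>2) \<le> R\<^sup>2) G"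
    using bound
  proof eventually_elim
    case (elim f)
    then show ?case
      by (intro exI[of _ "\<lambda>n. cmod (hcoeff (x f) n)"])
        (auto simp: norm_mult summable_hcoeff norm_hardy2_sq[symmetric] intro!: power_mono)
  qed
qed (auto simp: norm_mult summable_hcoeff)

lemma taylor_mult:
  assumes "f holomorphic_on ball 0 1" "g holomorphic_on ball 0 1"
  shows "taylor (\<lambda>z. f z * g z) n = (\<Sum>i = 0..n. taylor f i * taylor g (n - i))"
proof -
  have "(deriv ^^ n) (\<lambda>w. f w * g w) 0 = (\<Sum>i = 0..n. of_nat (n choose i) * (deriv ^^ i) f 0 * (deriv ^^ (n - i)) g 0)"
    by (rule higher_deriv_mult[OF assms]) auto
  then show ?thesis
    by (auto simp: taylor_def sum_divide_distrib binomial_fact intro!: sum.cong)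
qed

lemma hfun_outside: "z \<notin> ball 0 1 \<Longrightarrow> hfun x z = 0"
  using in_hardy2_hfun[of x] unfolding in_hardy2_def by blast

text \<open>
  The kernel at 0 is the constant 1, so this is \<open>f\<close> itself as an element of the Hardy
  space.
\<close>

definition h2_of :: "(complex \<Rightarrow> complex) \<Rightarrow> hardy2" where
  "h2_of f = mult_op f (szego 0)"

lemma hfun_h2_of [simp]: "f \<in> Hinf \<Longrightarrow> z \<in> ball 0 1 \<Longrightarrow> hfun (h2_of f) z = f z"
  by (simp add: h2_of_def szego.rep_eq)

text \<open>
  Each coefficient of a product depends on finitely many coefficients of \<open>f\<close>, so
  coefficientwise convergence of \<open>f\<close> carries over to the product with a fixed \<open>x\<close>.
\<close>

lemma hcoeff_mult_op:
  assumes f: "f \<in> Hinf"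
  shows "hcoeff (mult_op f x) n = (\<Sum>i = 0..n. hcoeff (h2_of f) i * hcoeff x (n - i))"
proof -
  have "hfun (mult_op f x) = (\<lambda>z. hfun (h2_of f) z * hfun x z)"
  proof
    show "hfun (mult_op f x) z = hfun (h2_of f) z * hfun x z" for z
      using f by (cases "z \<in> ball 0 1") (auto simp: hfun_outside)
  qed
  then show ?thesis by (simp add: taylor_mult hfun_holomorphic)
qed

lemma limitin_generated:
  assumes l: "l \<in> \<Union>S" and ev: "\<And>U. U \<in> S \<Longrightarrow> l \<in> U \<Longrightarrow> eventually (\<lambda>x. f x \<in> U) F"
  shows "limitin (topology_generated_by S) f l F"
  unfolding limitin_def
proof (intro conjI allI impI)
  show "l \<in> topspace (topology_generated_by S)" using l by (simp add: topology_generated_by_topspace)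
  fix U assume U: "openin (topology_generated_by S) U \<and> l \<in> U"
  then have "generate_topology_on S U" "l \<in> U" by (auto simp: openin_topology_generated_by)
  then show "eventually (\<lambda>x. f x \<in> U) F"
  proof (induction U rule: generate_topology_on.induct)
    case (Int a b)
    then have "eventually (\<lambda>x. f x \<in> a) F" "eventually (\<lambda>x. f x \<in> b) F" by auto
    then show ?case by eventually_elim auto
  next
    case (UN K)
    then obtain k where "k \<in> K" "l \<in> k" by blast
    then have "eventually (\<lambda>x. f x \<in> k) F" using UN.IH by blast
    then show ?case by eventually_elim (use \<open>k \<in> K\<close> in blast)
  qed (auto intro: ev)
qed

lemma limitin_pullback:
  assumes "limitin T (\<lambda>x. m (f x)) (m l) F" "l \<in> H" "eventually (\<lambda>x. f x \<in> H) F"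
  shows "limitin (pullback_topology H m T) f l F"
  unfolding limitin_def
proof (intro conjI allI impI)
  show "l \<in> topspace (pullback_topology H m T)"
    using assms by (auto simp: topspace_pullback_topology limitin_def)
  fix U assume U: "openin (pullback_topology H m T) U \<and> l \<in> U"
  then obtain W where W: "openin T W" "U = m -` W \<inter> H" by (auto simp: openin_pullback_topology)
  then have "eventually (\<lambda>x. m (f x) \<in> W) F"
    using assms(1) U by (auto simp: limitin_def)
  with assms(3) show "eventually (\<lambda>x. f x \<in> U) F"
    by eventually_elim (simp add: W(2))
qed

text \<open>
  The functions along \<open>G\<close> need not be uniformly bounded on the disk, so weak-* convergence
  does not follow from pointwise convergence in the usual way. For a square-summable family
  \<open>x\<close>, however, an outer majorant gives an eventual bound on the sum of the squared norms
  of the \<open>mult_op f (x n)\<close>, and a functional of the predual involves only one such family.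
\<close>

lemma weak_star_limit:
  assumes G_Hinf: "eventually (\<lambda>f. f \<in> Hinf) G" and g: "g \<in> Hinf"
    and coeffs: "\<And>n. ((\<lambda>f. hcoeff (h2_of f) n) \<longlongrightarrow> hcoeff (h2_of g) n) G"
    and bounded: "\<And>h. outer h \<Longrightarrow> eventually (\<lambda>f. (norm (mult_op f h))\<^sup>2 < (norm h)\<^sup>2 + 1) G"
  shows "limitin weak_star_Hinf (\<lambda>f. f) g G"
proof -
  have coeff_lim: "((\<lambda>f. hcoeff (mult_op f x) n) \<longlongrightarrow> hcoeff (mult_op g x) n) G" for x n
  proof -
    have "((\<lambda>f. \<Sum>i = 0..n. hcoeff (h2_of f) i * hcoeff x (n - i)) \<longlongrightarrow>
        (\<Sum>i = 0..n. hcoeff (h2_of g) i * hcoeff x (n - i))) G"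
      by (intro tendsto_intros coeffs)
    moreover have "eventually (\<lambda>f. (\<Sum>i = 0..n. hcoeff (h2_of f) i * hcoeff x (n - i)) = hcoeff (mult_op f x) n) G"
      using G_Hinf by eventually_elim (simp add: hcoeff_mult_op)
    ultimately show ?thesis
      using g by (simp add: hcoeff_mult_op filterlim_cong[OF refl refl] tendsto_cong)
  qed
  \<comment> \<open>An outer majorant of the family bounds its images under all f at once.\<close>
  have family_bound: "\<exists>C. eventually (\<lambda>f. summable (\<lambda>n. (norm (mult_op f (x n)))\<^sup>2)
      \<and> (\<Sum>n. (norm (mult_op f (x n)))\<^sup>2) \<le> C) G" if x: "square_summable x" for x
  proof -
    obtain h where h: "outer h"
      "\<And>z N. z \<in> ball 0 1 \<Longrightarrow> (\<Sum>n<N. (cmod (hfun (x n) z))\<^sup>2) \<le> (cmod (hfun h z))\<^sup>2"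
      "(norm h)\<^sup>2 \<le> (\<Sum>n. (norm (x n))\<^sup>2) + 1"
      using outer_majorant[OF x zero_less_one] by blast
    have "eventually (\<lambda>f. summable (\<lambda>n. (norm (mult_op f (x n)))\<^sup>2)
      \<and> (\<Sum>n. (norm (mult_op f (x n)))\<^sup>2) \<le> (norm h)\<^sup>2 + 1) G"
      using G_Hinf bounded[OF h(1)]
    proof eventually_elim
      case (elim f)
      have le: "(\<Sum>n<N. (norm (mult_op f (x n)))\<^sup>2) \<le> (norm h)\<^sup>2 + 1" for N
        using outer_majorant_mult[OF elim(1) h(2), of N] elim(2) by linarith
      have s: "summable (\<lambda>n. (norm (mult_op f (x n)))\<^sup>2)"
        by (rule summableI_nonneg_bounded[OF _ le]) simp
      then show ?case using suminf_le_const[OF s le] by blast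
    qed
    then show ?thesis by blast
  qed
  have g_family: "summable (\<lambda>n. (norm (mult_op g (x n)))\<^sup>2)" if x: "square_summable x" for x
  proof -
    obtain C where C: "\<And>z. z \<in> ball 0 1 \<Longrightarrow> cmod (g z) \<le> C" using Hinf_bound[OF g] by blast
    have "summable (\<lambda>n. C\<^sup>2 * (norm (x n))\<^sup>2)"
      using x unfolding square_summable_def by (rule summable_mult)
    then show ?thesis
      by (rule summable_comparison_test'[where N = 0])
        (use norm_mult_op_le[OF g C] in \<open>auto simp flip: power_mult_distrib intro!: power_mono\<close>)
  qed
  have functional: "((\<lambda>f. \<Sum>n. hinner (mult_op f (x n)) (y n)) \<longlongrightarrow> (\<Sum>n. hinner (mult_op g (x n)) (y n))) G"
    if x: "square_summable x" and y: "square_summable y" for x y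
  proof -
    obtain C where C: "eventually (\<lambda>f. summable (\<lambda>n. (norm (mult_op f (x n)))\<^sup>2)
      \<and> (\<Sum>n. (norm (mult_op f (x n)))\<^sup>2) \<le> C) G" using family_bound[OF x] by blast
    show ?thesis
    proof (rule tendsto_suminf_bounded[where C = C and \<beta> = "\<lambda>n. norm (y n)" and \<gamma> = "\<lambda>n. norm (mult_op g (x n))"])
      show "eventually (\<lambda>f. \<exists>\<alpha>. (\<forall>n. cmod (hinner (mult_op f (x n)) (y n)) \<le> \<alpha> n * norm (y n))
          \<and> summable (\<lambda>n. (\<alpha> n)\<^sup>2) \<and> (\<Sum>n. (\<alpha> n)\<^sup>2) \<le> C) G"
        using C
        by eventually_elim (intro exI[of _ "\<lambda>n. norm (mult_op _ (x n))"], auto simp: hinner_Cauchy_Schwarz)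
      show "((\<lambda>f. hinner (mult_op f (x n)) (y n)) \<longlongrightarrow> hinner (mult_op g (x n)) (y n)) G" for n
      proof (rule hardy2_weak_limit[OF coeff_lim])
        show "eventually (\<lambda>f. norm (mult_op f (x n)) \<le> sqrt C) G"
          using C
        proof eventually_elim
          case (elim f)
          have "(norm (mult_op f (x n)))\<^sup>2 \<le> (\<Sum>n. (norm (mult_op f (x n)))\<^sup>2)"
            using sum_le_suminf[of "\<lambda>n. (norm (mult_op f (x n)))\<^sup>2" "{n}"] elim by simp
          then show ?case using elim by (intro real_le_rsqrt) linarith
        qed
      qed
    qed (use y g_family[OF x] in \<open>auto simp: hinner_Cauchy_Schwarz square_summable_def\<close>)
  qed
  show ?thesis
    unfolding weak_star_Hinf_def
  proof (rule limitin_pullback[OF _ g G_Hinf])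
    show "limitin weak_star_operators mult_op (mult_op g) G"
      unfolding weak_star_operators_def
    proof (rule limitin_generated)
      have "square_summable (\<lambda>n. 0)" by (simp add: square_summable_def)
      then have "{T \<in> bounded_operators. (\<Sum>n. hinner (T 0) 0) \<in> UNIV} \<in>
          {{T \<in> bounded_operators. (\<Sum>n. hinner (T (x n)) (y n)) \<in> U} | x y U.
            square_summable x \<and> square_summable y \<and> open U}"
        by (intro CollectI exI[of _ "\<lambda>n. 0"] exI[of _ UNIV]) auto
      moreover have "mult_op g \<in> {T \<in> bounded_operators. (\<Sum>n. hinner (T 0) 0) \<in> UNIV}"
        using mult_op_bounded_operator[OF g] by simp
      ultimately show "mult_op g \<in> \<Union> {{T \<in> bounded_operators. (\<Sum>n. hinner (T (x n)) (y n)) \<in> U} | x y U.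
            square_summable x \<and> square_summable y \<and> open U}"
        by (rule UnionI)
    next
      fix W assume "W \<in> {{T \<in> bounded_operators. (\<Sum>n. hinner (T (x n)) (y n)) \<in> U} | x y U.
            square_summable x \<and> square_summable y \<and> open U}" and gW: "mult_op g \<in> W"
      then obtain x y U where W: "W = {T \<in> bounded_operators. (\<Sum>n. hinner (T (x n)) (y n)) \<in> U}"
        and xy: "square_summable x" "square_summable y" and U: "open U" by blast
      have "eventually (\<lambda>f. (\<Sum>n. hinner (mult_op f (x n)) (y n)) \<in> U) G"
        using topological_tendstoD[OF functional[OF xy] U] gW by (simp add: W)
      with G_Hinf show "eventually (\<lambda>f. mult_op f \<in> W) G"
        by eventually_elim (simp add: W mult_op_bounded_operator)
    qed
  qed
qed

lemma compact_sequences: "compact {a :: nat \<Rightarrow> complex. \<forall>n. cmod (a n) \<le> R}"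
proof -
  have "compactin (product_topology (\<lambda>i::nat. euclidean) UNIV) (PiE UNIV (\<lambda>i. cball (0::complex) R))"
    by (simp add: compactin_PiE)
  moreover have "PiE UNIV (\<lambda>i::nat. cball (0::complex) R) = {a. \<forall>n. cmod (a n) \<le> R}"
    by (auto simp: PiE_def)
  ultimately show ?thesis by (simp add: euclidean_product_topology)
qed

text \<open>
  The analogue of passing to a convergent subsequence.
\<close>

lemma cluster_filter:
  fixes \<tau> :: "'a \<Rightarrow> 'b::topological_space"
  assumes K: "compact K" and F: "F \<noteq> bot" and ev: "eventually (\<lambda>f. \<tau> f \<in> K) F"
  obtains G a where "G \<noteq> bot" "G \<le> F" "(\<tau> \<longlongrightarrow> a) G"
proof -
  have "filtermap \<tau> F \<noteq> bot" using F by (simp add: filtermap_bot_iff)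
  moreover have "eventually (\<lambda>x. x \<in> K) (filtermap \<tau> F)" using ev by (simp add: eventually_filtermap)
  ultimately obtain a where a: "inf (nhds a) (filtermap \<tau> F) \<noteq> bot"
    using K unfolding compact_filter by blast
  define G where "G = inf F (filtercomap \<tau> (nhds a))"
  have "G \<noteq> bot"
  proof
    assume "G = bot"
    then have "eventually (\<lambda>_. False) G" by simp
    then obtain P Q where P: "eventually P F" and Q: "eventually Q (filtercomap \<tau> (nhds a))"
      and PQ: "\<And>x. P x \<Longrightarrow> Q x \<Longrightarrow> False"
      unfolding G_def eventually_inf by blast
    obtain Q' where Q': "eventually Q' (nhds a)" "\<And>x. Q' (\<tau> x) \<Longrightarrow> Q x"
      using Q unfolding eventually_filtercomap by blast
    have "eventually (\<lambda>b. \<not> Q' b) (filtermap \<tau> F)"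
      unfolding eventually_filtermap using P by eventually_elim (use PQ Q' in blast)
    then have "eventually (\<lambda>_. False) (inf (nhds a) (filtermap \<tau> F))"
      unfolding eventually_inf using Q'(1) by blast
    then show False using a by (simp add: trivial_limit_def)
  qed
  moreover have "G \<le> F" by (simp add: G_def)
  moreover have "(\<tau> \<longlongrightarrow> a) G"
    using filterlim_filtercomap[of \<tau> "nhds a"] by (rule filterlim_mono) (auto simp: G_def)
  ultimately show thesis using that by blast
qed

text \<open>
  Along the filter of \<open>contraction_filter_exists\<close> the Taylor coefficients are bounded, so
  by Tychonoff's theorem a finer filter has a coefficientwise limit \<open>g\<close>. For the weight of
  the kernel at \<open>z\<close> the bound on the norm, paired with the kernel, says that the modulus
  of \<open>f z\<close> is eventually almost at most 1; thus \<open>g\<close> is bounded by 1.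
\<close>

lemma almost_contractive_attained:
  assumes V: "almost_contractive V"
  obtains G g where "G \<noteq> bot" "g \<in> Hinf" "Hinf_norm g \<le> 1" "eventually (\<lambda>f. f \<in> V) G"
    "\<And>z. z \<in> ball 0 1 \<Longrightarrow> ((\<lambda>f. f z) \<longlongrightarrow> g z) G" "limitin weak_star_Hinf (\<lambda>f. f) g G"
proof -
  obtain F where F: "F \<noteq> bot"
    and evF: "\<And>h \<epsilon>. outer h \<Longrightarrow> \<epsilon> > 0 \<Longrightarrow> eventually (\<lambda>f. f \<in> V \<and> (norm (mult_op f h))\<^sup>2 < (norm h)\<^sup>2 + \<epsilon>) F"
    using contraction_filter_exists[OF V] by blast
  \<comment> \<open>Through an outer majorant the bound for outer functions passes to arbitrary elements
    of the Hardy space.\<close>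
  have single: "eventually (\<lambda>f. f \<in> V \<and> (norm (mult_op f x))\<^sup>2 \<le> (norm x)\<^sup>2 + \<epsilon>) F" if "\<epsilon> > 0" for x \<epsilon>
  proof -
    obtain h where h: "outer h" "(norm h)\<^sup>2 \<le> 1 * (norm x)\<^sup>2 + 0 * (norm x)\<^sup>2 + \<epsilon> / 2"
      "\<And>f. f \<in> Hinf \<Longrightarrow> 1 * (norm (mult_op f x))\<^sup>2 + 0 * (norm (mult_op f x))\<^sup>2 \<le> (norm (mult_op f h))\<^sup>2"
      using outer_majorant_two[of 1 0 "\<epsilon> / 2" x x] \<open>\<epsilon> > 0\<close> by auto
    have "\<epsilon> / 2 > 0" using \<open>\<epsilon> > 0\<close> by simp
    from evF[OF h(1) this] show ?thesis
    proof eventually_elim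
      case (elim f)
      then have "f \<in> V" by blast
      from h(3)[OF almost_contractiveD(1)[OF V this]]
      have "(norm (mult_op f x))\<^sup>2 \<le> (norm (mult_op f h))\<^sup>2" by simp
      then have "(norm (mult_op f x))\<^sup>2 \<le> (norm x)\<^sup>2 + \<epsilon>" using elim h(2) by linarith
      then show ?case using elim by blast
    qed
  qed
  \<comment> \<open>The kernel at 0 is the constant 1, so this bounds the Taylor coefficients of f.\<close>
  define R where "R = sqrt ((norm (szego 0))\<^sup>2 + 1)"
  define \<tau> where "\<tau> f = hcoeff (h2_of f)" for f
  have norm_R: "eventually (\<lambda>f. norm (h2_of f) \<le> R) F"
    using single[OF zero_less_one, of "szego 0"]
    by eventually_elim (auto simp: R_def h2_of_def intro!: real_le_rsqrt)
  then have "eventually (\<lambda>f. \<tau> f \<in> {a. \<forall>n. cmod (a n) \<le> R}) F"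
    by eventually_elim (auto simp: \<tau>_def intro: order_trans[OF cmod_hcoeff_le])
  then obtain G a where G: "G \<noteq> bot" "G \<le> F" and \<tau>_lim: "(\<tau> \<longlongrightarrow> a) G"
    using cluster_filter[OF compact_sequences F] by metis
  have evG: "eventually P F \<Longrightarrow> eventually P G" for P using G(2) by (rule filter_leD)
  have GV: "eventually (\<lambda>f. f \<in> V) G"
    using evG[OF single[OF zero_less_one, of 0]] by eventually_elim auto
  have GH: "eventually (\<lambda>f. f \<in> Hinf) G"
    using GV by eventually_elim (rule almost_contractiveD(1)[OF V])
  have coeff: "((\<lambda>f. hcoeff (h2_of f) n) \<longlongrightarrow> a n) G" for n
  proof -
    have "isCont (\<lambda>b :: nat \<Rightarrow> complex. b n) a"
      by (rule continuous_on_interior[OF continuous_on_product_coordinates]) simp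
    from isCont_tendsto_compose[OF this \<tau>_lim] show ?thesis by (simp add: \<tau>_def)
  qed
  have partial: "(\<Sum>n<N. (cmod (a n))\<^sup>2) \<le> R\<^sup>2" for N
  proof (rule tendsto_upperbound[OF _ _ G(1)])
    show "((\<lambda>f. \<Sum>n<N. (cmod (hcoeff (h2_of f) n))\<^sup>2) \<longlongrightarrow> (\<Sum>n<N. (cmod (a n))\<^sup>2)) G"
      by (intro tendsto_intros coeff)
    show "eventually (\<lambda>f. (\<Sum>n<N. (cmod (hcoeff (h2_of f) n))\<^sup>2) \<le> R\<^sup>2) G"
      using evG[OF norm_R]
    proof eventually_elim
      case (elim f)
      have "(\<Sum>n<N. (cmod (hcoeff (h2_of f) n))\<^sup>2) \<le> (norm (h2_of f))\<^sup>2"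
        unfolding norm_hardy2_sq by (rule sum_le_suminf[OF summable_hcoeff]) auto
      also have "\<dots> \<le> R\<^sup>2" using elim by (intro power_mono) auto
      finally show ?case .
    qed
  qed
  have "summable (\<lambda>n. (cmod (a n))\<^sup>2)" by (rule summableI_nonneg_bounded[OF _ partial]) simp
  then obtain y where y: "\<And>n. hcoeff y n = a n" using ell2_hardy2 by blast
  define g where "g = hfun y"
  have weak: "((\<lambda>f. hinner (h2_of f) k) \<longlongrightarrow> hinner y k) G" for k
    by (rule hardy2_weak_limit[OF _ evG[OF norm_R]]) (use coeff y in simp)
  have point: "((\<lambda>f. f z) \<longlongrightarrow> g z) G" if z: "z \<in> ball 0 1" for z
  proof -
    have "((\<lambda>f. hfun (h2_of f) z) \<longlongrightarrow> g z) G"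
      using weak[of "szego z"] by (simp add: hinner_szego[OF z] g_def)
    moreover have "eventually (\<lambda>f. hfun (h2_of f) z = f z) G"
      using GH by eventually_elim (use z in simp)
    ultimately show ?thesis by (simp add: tendsto_cong)
  qed
  have g_le: "cmod (g z) \<le> 1" if z: "z \<in> ball 0 1" for z
  proof -
    define s where "s = (norm (szego z))\<^sup>2"
    have "hfun (szego z) 0 = 1" using z by (simp add: szego.rep_eq)
    then have "szego z \<noteq> 0" by auto
    then have s: "s > 0" by (simp add: s_def)
    have "(cmod (g z))\<^sup>2 * s \<le> s + \<epsilon>" if \<epsilon>: "\<epsilon> > 0" for \<epsilon>
    proof (rule tendsto_upperbound[OF _ _ G(1)])
      show "((\<lambda>f. (cmod (f z))\<^sup>2 * s) \<longlongrightarrow> (cmod (g z))\<^sup>2 * s) G"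
        by (intro tendsto_intros point z)
      show "eventually (\<lambda>f. (cmod (f z))\<^sup>2 * s \<le> s + \<epsilon>) G"
        using evG[OF single[OF \<epsilon>, of "szego z"]] GH
      proof eventually_elim
        case (elim f)
        have "hinner (mult_op f (szego z)) (szego z) = f z * hinner (szego z) (szego z)"
          using elim(2) z by (simp add: hinner_szego)
        then have "cmod (f z) * s = cmod (hinner (mult_op f (szego z)) (szego z))"
          by (simp add: hinner_same norm_mult norm_power s_def)
        also have "\<dots> \<le> norm (mult_op f (szego z)) * norm (szego z)" by (rule hinner_Cauchy_Schwarz)
        finally have "(cmod (f z) * s)\<^sup>2 \<le> (norm (mult_op f (szego z)) * norm (szego z))\<^sup>2"
          using s by (intro power_mono) auto
        then have "((cmod (f z))\<^sup>2 * s) * s \<le> (norm (mult_op f (szego z)))\<^sup>2 * s"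
          by (simp add: power_mult_distrib s_def power2_eq_square mult_ac)
        then have "(cmod (f z))\<^sup>2 * s \<le> (norm (mult_op f (szego z)))\<^sup>2"
          using s by (simp add: mult_le_cancel_right)
        then show ?case using elim(1) by (simp add: s_def)
      qed
    qed
    then have "(cmod (g z))\<^sup>2 * s \<le> 1 * s" using field_le_epsilon[of "(cmod (g z))\<^sup>2 * s" s] by simp
    then have "(cmod (g z))\<^sup>2 \<le> 1" using s by (simp only: mult_le_cancel_right)
    then show ?thesis by (simp add: abs_square_le_1)
  qed
  have gH: "g \<in> Hinf"
    unfolding Hinf_def bounded_iff using hfun_holomorphic[of y] g_le
    by (auto simp: g_def intro!: exI[of _ 1])
  have "h2_of g = y"
    by (rule hardy2_eqI) (use gH in \<open>simp add: g_def\<close>)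
  have bounded: "eventually (\<lambda>f. (norm (mult_op f h))\<^sup>2 < (norm h)\<^sup>2 + 1) G" if "outer h" for h
    using evG[OF evF[OF that zero_less_one]] by eventually_elim blast
  have "limitin weak_star_Hinf (\<lambda>f. f) g G"
    by (rule weak_star_limit[OF GH gH _ bounded]) (simp_all add: \<open>h2_of g = y\<close> y coeff)
  moreover have "Hinf_norm g \<le> 1"
    unfolding Hinf_norm_def by (rule cSUP_least) (use g_le in auto)
  ultimately show thesis using that G(1) gH GV point by blast
qed

section \<open>Nevanlinna-Pick interpolation\<close>

text \<open>
  A function attained from the interpolants by \<open>almost_contractive_attained\<close> is a
  contraction, has the same values at the nodes, and belongs to \<open>A\<close> because \<open>A\<close> is
  weak-* closed.
\<close>

theorem theorem4p1:
  fixes A :: "(complex \<Rightarrow> complex) set"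
    and n :: nat
    and lam w :: "nat \<Rightarrow> complex"
  assumes "unital_subalgebra A"
    and "closedin weak_star_Hinf A"
    and "inj_on lam {1..n}"
    and "lam ` {1..n} \<subseteq> ball 0 1"
    and "separates A (lam ` {1..n})"
  shows "(\<exists>f\<in>A. Hinf_norm f \<le> 1 \<and> (\<forall>i\<in>{1..n}. f (lam i) = w i)) \<longleftrightarrow>
    (\<forall>h. outer h \<longrightarrow>
      positive_semidefinite {1..n} (\<lambda>i j. (1 - w i * cnj (w j)) *
        hinner (proj (cyclic_subspace A h) (szego (lam j))) (szego (lam i))))"
proof
  assume "\<exists>f\<in>A. Hinf_norm f \<le> 1 \<and> (\<forall>i\<in>{1..n}. f (lam i) = w i)"
  then obtain f where f: "f \<in> A" "Hinf_norm f \<le> 1" "\<And>i. i \<in> {1..n} \<Longrightarrow> f (lam i) = w i" by blast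
  have "bdd_above ((\<lambda>z. cmod (f z)) ` ball 0 1)"
    using unital_subalgebraD(1)[OF assms(1) f(1)] unfolding Hinf_def bounded_iff bdd_above_def by auto
  then have "cmod (f z) \<le> 1" if "z \<in> ball 0 1" for z
    using f(2) cSUP_upper[OF that, of "\<lambda>z. cmod (f z)"] unfolding Hinf_norm_def by force
  then show "\<forall>h. outer h \<longrightarrow>
      positive_semidefinite {1..n} (\<lambda>i j. (1 - w i * cnj (w j)) *
        hinner (proj (cyclic_subspace A h) (szego (lam j))) (szego (lam i)))"
    using Pick_matrix_positive[OF assms(1) f(1) _ assms(4) f(3)] by blast
next
  assume psd: "\<forall>h. outer h \<longrightarrow>
      positive_semidefinite {1..n} (\<lambda>i j. (1 - w i * cnj (w j)) *
        hinner (proj (cyclic_subspace A h) (szego (lam j))) (szego (lam i)))"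
  define V where "V = {f \<in> A. \<forall>i\<in>{1..n}. f (lam i) = w i}"
  have "almost_contractive V"
    unfolding almost_contractive_def
  proof (intro conjI ballI allI impI)
    show "V \<subseteq> Hinf" using unital_subalgebraD(1)[OF assms(1)] by (auto simp: V_def)
  next
    fix f g and t :: real assume fg: "f \<in> V" "g \<in> V"
    then have "(\<lambda>z. of_real t * f z + of_real (1 - t) * g z) \<in> A"
      by (intro unital_subalgebraD(3,5)[OF assms(1)]) (auto simp: V_def)
    moreover have "of_real t * c + of_real (1 - t) * c = c" for c :: complex
      by (simp add: algebra_simps)
    ultimately show "(\<lambda>z. of_real t * f z + of_real (1 - t) * g z) \<in> V"
      using fg by (simp add: V_def)
  next
    fix h and \<epsilon> :: real assume h: "outer h" and \<epsilon>: "\<epsilon> > 0"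
    have "((\<lambda>d. (norm h + d)\<^sup>2) \<longlongrightarrow> (norm h + 0)\<^sup>2) (at_right 0)" by (intro tendsto_intros)
    then have "eventually (\<lambda>d. (norm h + d)\<^sup>2 < (norm h)\<^sup>2 + \<epsilon>) (at_right 0)"
      by (rule order_tendstoD) (use \<epsilon> in simp)
    moreover have "eventually (\<lambda>d::real. d > 0) (at_right 0)" by (rule eventually_at_right_less)
    ultimately obtain d where d: "d > 0" "(norm h + d)\<^sup>2 < (norm h)\<^sup>2 + \<epsilon>"
      using eventually_happens'[OF trivial_limit_at_right_real eventually_conj] by blast
    have h_ne: "hfun h (lam i) \<noteq> 0" if "i \<in> {1..n}" for i
      using outer_nonzero[OF h] assms(4) that by blast
    obtain f where f: "f \<in> A" "\<And>i. i \<in> {1..n} \<Longrightarrow> f (lam i) = w i" "norm (mult_op f h) < norm h + d"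
      using interpolant_of_small_norm[OF assms(1) _ assms(3-5) h_ne _ d(1), of w] psd h by blast
    have "(norm (mult_op f h))\<^sup>2 \<le> (norm h + d)\<^sup>2" using f(3) by (intro power_mono) auto
    then show "\<exists>f\<in>V. (norm (mult_op f h))\<^sup>2 < (norm h)\<^sup>2 + \<epsilon>"
      using f d(2) by (intro bexI[of _ f]) (auto simp: V_def)
  qed
  then obtain G g where G: "G \<noteq> bot" and g: "g \<in> Hinf" "Hinf_norm g \<le> 1"
    and GV: "eventually (\<lambda>f. f \<in> V) G" and point: "\<And>z. z \<in> ball 0 1 \<Longrightarrow> ((\<lambda>f. f z) \<longlongrightarrow> g z) G"
    and lim: "limitin weak_star_Hinf (\<lambda>f. f) g G"
    using almost_contractive_attained by blast
  have "eventually (\<lambda>f. f \<in> A) G" using GV by eventually_elim (simp add: V_def)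
  then have "g \<in> A" using limitin_closedin[OF lim assms(2)] G by blast
  moreover have "g (lam i) = w i" if i: "i \<in> {1..n}" for i
  proof (rule tendsto_unique[OF G])
    show "((\<lambda>f. f (lam i)) \<longlongrightarrow> g (lam i)) G" by (intro point subsetD[OF assms(4)] imageI i)
    have "eventually (\<lambda>f. f (lam i) = w i) G" using GV by eventually_elim (use i in \<open>auto simp: V_def\<close>)
    then show "((\<lambda>f. f (lam i)) \<longlongrightarrow> w i) G" by (rule tendsto_eventually)
  qed
  ultimately show "\<exists>f\<in>A. Hinf_norm f \<le> 1 \<and> (\<forall>i\<in>{1..n}. f (lam i) = w i)" using g(2) by blast
qed

end
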